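(* For each positive integer $n$ let $d=d_n=(n-1)^2+1$. Let $\pi_1,\dots,\pi_d$ be independent uniformly random elements of the symmetric group $S_n$. Then, as $n\to\infty$, $$\Pr\bigl(P_{\pi_1},\dots,P_{\pi_d}\text{ are linearly dependent over }\mathbb R\bigr)=O(n^{-1/2}).$$ Consequently, if $\mathcal S_n$ is a uniformly random $d$-element subset of the set $\mathcal P_n$ of all $n\times n$ permutation matrices, then $$\Pr\bigl(\mathcal S_n\text{ is linearly independent over }\mathbb R\bigr)=1-O(n^{-1/2}).$$
   Context: For $\pi\in S_n$, $P_\pi$ denotes the $n\times n$ permutation matrix with entry $1$ in position $(i,\pi(i))$ for each $i$ and $0$ elsewhere. $\mathcal P_n=\{P_\pi:\pi\in S_n\}$. The number $d_n$ is the dimension of the real linear span of $\mathcal P_n$. In the first statement the family is an indexed family, so a repeated matrix counts as linear dependence. Constants implicit in $O(\cdot)$ are absolute. *)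

theory Defs
  imports
    "HOL-Probability.Probability"
    "HOL-Library.Landau_Symbols"
    "Jordan_Normal_Form.VS_Connect"
begin

(* Rows and columns are indexed from 0, so S_n is the set of permutations of {..<n}. *)
definition sym_group :: "nat \<Rightarrow> (nat \<Rightarrow> nat) set" where
  "sym_group n = {\<pi>. \<pi> permutes {..<n}}"

definition perm_mat :: "nat \<Rightarrow> (nat \<Rightarrow> nat) \<Rightarrow> real mat" where
  "perm_mat n \<pi> = mat n n (\<lambda>(i, j). if j = \<pi> i then 1 else 0)"

definition perm_mats :: "nat \<Rightarrow> real mat set" where
  "perm_mats n = perm_mat n ` sym_group n"

abbreviation real_mats :: "nat \<Rightarrow> (real, real mat) module" where
  "real_mats n \<equiv> module_mat TYPE(real) n n"

definition lin_dep_set :: "nat \<Rightarrow> real mat set \<Rightarrow> bool" where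
  "lin_dep_set n S \<longleftrightarrow> LinearCombinations.module.lin_dep class_ring (real_mats n) S"

(* Dependence of an indexed family; in contrast to lin_dep_set (range of the family),
   a repeated matrix makes the family dependent. *)
definition lin_dep_family :: "nat \<Rightarrow> 'i set \<Rightarrow> ('i \<Rightarrow> real mat) \<Rightarrow> bool" where
  "lin_dep_family n I A \<longleftrightarrow>
     (\<exists>c :: 'i \<Rightarrow> real. (\<exists>i\<in>I. c i \<noteq> 0) \<and>
        finsum (real_mats n) (\<lambda>i. c i \<cdot>\<^sub>m A i) I = 0\<^sub>m n n)"

(* d_n: the dimension of the real linear span of the permutation matrices *)
definition perm_dim :: "nat \<Rightarrow> nat" where
  "perm_dim n = vectorspace.dim class_ring
     ((real_mats n)\<lparr>carrier :=
        LinearCombinations.module.span class_ring (real_mats n) (perm_mats n)\<rparr>)"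

(* Joint law of m independent uniformly random elements of S_n, indexed by {..<m};
   id is only the irrelevant default value outside the index set. *)
definition random_perms :: "nat \<Rightarrow> nat \<Rightarrow> (nat \<Rightarrow> nat \<Rightarrow> nat) pmf" where
  "random_perms n m = Pi_pmf {..<m} id (\<lambda>_. pmf_of_set (sym_group n))"

(* Meaningful for m at most n!, i.e. when there are m-element subsets at all;
   this holds for m = perm_dim n. *)
definition random_perm_mat_subset :: "nat \<Rightarrow> nat \<Rightarrow> real mat set pmf" where
  "random_perm_mat_subset n m = pmf_of_set {S. S \<subseteq> perm_mats n \<and> card S = m}"

end

(* Expose the permutations one at a time.  A dependence means that some permutation matrix lies in
   the span V of its predecessors; let c = d - dim V.  If c >= 5, five linear functionals vanishing
   on V yield a vector-valued statistic SUM_i M(i, pi(i)) in R^5, and a Littlewood--Offord bound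
   shows that it vanishes with probability O(n^(-5/2)); over at most n^2 steps this contributes
   O(n^(-1/2)).  Each of the last four steps costs O(n^(-1/2)) in the same way, with one functional.

   The Littlewood--Offord bound needs every nonzero combination of the functionals to be generic:
   a positive proportion of its 2x2 minors a_ij + a_kl - a_il - a_kj is nonzero.  While dim V <= d/2
   the functionals can be prescribed on half of all positions and are chosen generic.  Later, every
   nontrivial functional vanishing on the first d/2 permutations is generic outside an event of
   probability O(1/n): up to row and column terms a nongeneric functional has small support, so it is
   determined by its support and by few of the permutations, and each of the remaining permutations
   then satisfies a fixed nontrivial equation.

   For the bound itself, build a uniform bijection by repeatedly removing two random rows and two
   random columns and matching them in one of the two ways.  Given the removed rows and columns, the
   statistic is a random signed sum of half minors.  Genericity makes the process collect linearly
   many disjoint bases among these minors, and Halasz's inequality applies. *)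

theory Submission
  imports Defs "HOL-Library.Function_Algebras" "HOL-Computational_Algebra.Polynomial"
begin

no_notation scalar_prod (infix "\<bullet>" 70)

section \<open>Random signed sums\<close>

text \<open>The number five comes from the count of steps: n^2 terms of order n^(-c/2) add up to
  O(n^(-1/2)) exactly when c \<ge> 5. The obstacle is sparse functionals. The one that reads a
  single entry vanishes at a random permutation with probability 1 - 1/n, so no strong bound holds
  for all functionals. After few permutations such functionals annihilate V, and genericity is a
  matter of choice; when V has small codimension no choice remains, and genericity has to come from
  the randomness of the earlier permutations. Hence the two regimes. A normalized functional with s
  essential positions takes a given value with probability at most 1 - c min(1, s/n). With order n^2
  permutations left to test it, this gives exp(-c' s n) for s \<le> n, which beats the n^(O(s))
  choices of a support and of determining permutations. The functional itself ranges over a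
  continuum, yet it need not be recovered: the equations at the determining permutations imply those
  at all exposed ones, so any normalized functional with the same support that satisfies the former
  can stand in for it.\<close>

fun sign_expect :: "'a::ab_group_add list \<Rightarrow> ('a \<Rightarrow> real) \<Rightarrow> real" where
  "sign_expect [] g = g 0"
| "sign_expect (w # ws) g =
     (sign_expect ws (\<lambda>y. g (w + y)) + sign_expect ws (\<lambda>y. g (y - w))) / 2"

definition sign_prob :: "'a::ab_group_add list \<Rightarrow> 'a \<Rightarrow> real" where
  "sign_prob ws x = sign_expect ws (\<lambda>y. of_bool (y = x))"

text \<open>The values that the random signed sum can take; they turn expectations into finite sums
  although the group may be infinite.\<close>

fun sign_sums :: "'a::ab_group_add list \<Rightarrow> 'a set" where
  "sign_sums [] = {0}"
| "sign_sums (w # ws) = (\<lambda>y. w + y) ` sign_sums ws \<union> (\<lambda>y. y - w) ` sign_sums ws"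

lemma finite_sign_sums [simp]: "finite (sign_sums ws)"
  by (induction ws) auto

lemma sign_expect_cong:
  "(\<And>y. y \<in> sign_sums ws \<Longrightarrow> g y = h y) \<Longrightarrow> sign_expect ws g = sign_expect ws h"
proof (induction ws arbitrary: g h)
  case (Cons w ws)
  have "sign_expect ws (\<lambda>y. g (w + y)) = sign_expect ws (\<lambda>y. h (w + y))"
       "sign_expect ws (\<lambda>y. g (y - w)) = sign_expect ws (\<lambda>y. h (y - w))"
    by (rule Cons.IH, rule Cons.prems, simp)+
  then show ?case by simp
qed simp

lemma sign_expect_mono:
  "(\<And>y. g y \<le> h y) \<Longrightarrow> sign_expect ws g \<le> sign_expect ws h"
proof (induction ws arbitrary: g h)
  case (Cons w ws)
  have "sign_expect ws (\<lambda>y. g (w + y)) \<le> sign_expect ws (\<lambda>y. h (w + y))"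
       "sign_expect ws (\<lambda>y. g (y - w)) \<le> sign_expect ws (\<lambda>y. h (y - w))"
    by (rule Cons.IH, rule Cons.prems)+
  then show ?case by simp
qed simp

lemma sign_expect_const [simp]: "sign_expect ws (\<lambda>_. c) = c"
  by (induction ws) auto

lemma sign_expect_cmult: "sign_expect ws (\<lambda>y. g y * c) = sign_expect ws g * c"
  by (induction ws arbitrary: g) (auto simp: algebra_simps)

lemma sign_expect_add:
  "sign_expect ws (\<lambda>y. g y + h y) = sign_expect ws g + sign_expect ws h"
  by (induction ws arbitrary: g h) (auto simp: algebra_simps add_divide_distrib)

lemma sign_expect_sum:
  "finite I \<Longrightarrow> sign_expect ws (\<lambda>y. \<Sum>i\<in>I. g i y) = (\<Sum>i\<in>I. sign_expect ws (g i))"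
  by (induction I rule: finite_induct) (auto simp: sign_expect_add)

lemma sign_expect_append:
  "sign_expect (us @ vs) g = sign_expect us (\<lambda>y. sign_expect vs (\<lambda>z. g (y + z)))"
  by (induction us arbitrary: g) (auto simp: algebra_simps)

lemma sign_expect_move: "sign_expect (us @ w # vs) g = sign_expect (w # us @ vs) g"
proof (induction us arbitrary: g)
  case (Cons u us)
  show ?case
    using Cons[of "\<lambda>y. g (u + y)"] Cons[of "\<lambda>y. g (y - u)"]
    by (simp add: add_divide_distrib) (simp add: algebra_simps)
qed simp

text \<open>The signs are exchangeable, so only the multiset of vectors matters. This licenses every
  regrouping of blocks below.\<close>

lemma sign_expect_mset:
  "mset us = mset vs \<Longrightarrow> sign_expect us g = sign_expect vs g"
proof (induction us arbitrary: vs g)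
  case (Cons u us)
  have "u \<in> set vs" using mset_eq_setD[OF Cons.prems] by auto
  then obtain v1 v2 where vs: "vs = v1 @ u # v2" by (auto dest: split_list)
  then have "mset us = mset (v1 @ v2)" using Cons.prems by simp
  then have *: "sign_expect us h = sign_expect (v1 @ v2) h" for h by (rule Cons.IH)
  show ?case unfolding vs sign_expect_move by (simp add: *)
qed simp

lemma sign_expect_uminus: "sign_expect ws (\<lambda>y. g (- y)) = sign_expect ws g"
proof (induction ws arbitrary: g)
  case (Cons w ws)
  have "sign_expect ws (\<lambda>y. g (- (w + y))) = sign_expect ws (\<lambda>y. g (y - w))"
    using Cons[of "\<lambda>y. g (y - w)"] by (simp add: algebra_simps)
  moreover have "sign_expect ws (\<lambda>y. g (- (y - w))) = sign_expect ws (\<lambda>y. g (w + y))"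
    using Cons[of "\<lambda>y. g (w + y)"] by (simp add: algebra_simps)
  ultimately show ?case by simp
qed simp

lemma sign_prob_nil: "sign_prob [] x = of_bool (x = 0)"
  by (auto simp: sign_prob_def)

lemma sign_prob_Cons:
  "sign_prob (w # ws) x = (sign_prob ws (x - w) + sign_prob ws (x + w)) / 2"
proof -
  have "(\<lambda>y. of_bool (w + y = x)) = (\<lambda>y. of_bool (y = x - w) :: real)"
       "(\<lambda>y. of_bool (y - w = x)) = (\<lambda>y. of_bool (y = x + w) :: real)"
    by (auto simp: fun_eq_iff algebra_simps)
  then show ?thesis unfolding sign_prob_def by simp
qed

lemma sign_prob_nonneg [simp]: "0 \<le> sign_prob ws x"
  using sign_expect_mono[of "\<lambda>_. 0" "\<lambda>y. of_bool (y = x)" ws] by (simp add: sign_prob_def)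

lemma sign_prob_le_1 [simp]: "sign_prob ws x \<le> 1"
  using sign_expect_mono[of "\<lambda>y. of_bool (y = x)" "\<lambda>_. 1" ws] by (simp add: sign_prob_def)

lemma sign_prob_eq_0: "x \<notin> sign_sums ws \<Longrightarrow> sign_prob ws x = 0"
  unfolding sign_prob_def using sign_expect_cong[of ws "\<lambda>y. of_bool (y = x)" "\<lambda>_. 0"] by auto

lemma sign_prob_mset: "mset us = mset vs \<Longrightarrow> sign_prob us x = sign_prob vs x"
  unfolding sign_prob_def by (rule sign_expect_mset)

lemma sign_prob_append:
  "sign_prob (us @ vs) x = sign_expect us (\<lambda>y. sign_prob vs (x - y))"
proof -
  have "(y + z = x) = (z = x - y)" for y z by (auto simp: algebra_simps)
  then show ?thesis by (simp add: sign_prob_def sign_expect_append)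
qed

lemma sign_prob_uminus: "sign_prob ws (- x) = sign_prob ws x"
proof -
  have "(\<lambda>y. of_bool (y = - x)) = (\<lambda>y. of_bool (- y = x) :: real)"
    by (simp add: fun_eq_iff) (metis minus_minus)
  then show ?thesis
    unfolding sign_prob_def by (simp add: sign_expect_uminus[of ws "\<lambda>y. of_bool (y = x)"])
qed

lemma sign_expect_eq_sum:
  "sign_expect ws g = (\<Sum>y\<in>sign_sums ws. sign_prob ws y * g y)"
proof -
  have "sign_expect ws g = sign_expect ws (\<lambda>y. \<Sum>x\<in>sign_sums ws. of_bool (y = x) * g x)"
  proof (rule sign_expect_cong)
    fix y assume "y \<in> sign_sums ws"
    then have "(\<Sum>x\<in>sign_sums ws. of_bool (y = x) * g x) =
               (\<Sum>x\<in>sign_sums ws. if y = x then g x else 0)"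
      by (intro sum.cong) auto
    also have "\<dots> = g y" using \<open>y \<in> _\<close> by (simp add: sum.delta')
    finally show "g y = (\<Sum>x\<in>sign_sums ws. of_bool (y = x) * g x)" by simp
  qed
  also have "\<dots> = (\<Sum>x\<in>sign_sums ws. sign_expect ws (\<lambda>y. of_bool (y = x) * g x))"
    by (rule sign_expect_sum) simp
  also have "\<dots> = (\<Sum>x\<in>sign_sums ws. sign_prob ws x * g x)"
    by (simp add: sign_expect_cmult sign_prob_def)
  finally show ?thesis .
qed

lemma sign_prob_append_le:
  assumes "\<And>z. sign_prob vs z \<le> b"
  shows "sign_prob (us @ vs) x \<le> b"
  unfolding sign_prob_append using sign_expect_mono[of "\<lambda>y. sign_prob vs (x - y)" "\<lambda>_. b" us] assms
  by simp

text \<open>Reversing all signs shows that the sum is symmetric, so two independent copies cancel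
  with the collision probability of one. This is the quantity that Cauchy--Schwarz produces.\<close>

lemma sign_prob_double:
  "sign_prob (us @ us) 0 = (\<Sum>y\<in>sign_sums us. (sign_prob us y)\<^sup>2)"
  unfolding sign_prob_append sign_expect_eq_sum
  by (simp add: sign_prob_uminus power2_eq_square)

text \<open>The inequality \<open>2 p q \<le> p\<^sup>2 + q\<^sup>2\<close> bounds a convolution by the collision
  probabilities of its two factors.\<close>

lemma sign_prob_append_le_max:
  "sign_prob (us @ vs) x \<le> max (sign_prob (us @ us) 0) (sign_prob (vs @ vs) 0)"
proof -
  have "sign_prob (us @ vs) x = (\<Sum>y\<in>sign_sums us. sign_prob us y * sign_prob vs (x - y))"
    by (simp add: sign_prob_append sign_expect_eq_sum)
  also have "\<dots> \<le> (\<Sum>y\<in>sign_sums us. ((sign_prob us y)\<^sup>2 + (sign_prob vs (x - y))\<^sup>2) / 2)"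
  proof (rule sum_mono)
    fix y
    show "sign_prob us y * sign_prob vs (x - y) \<le> ((sign_prob us y)\<^sup>2 + (sign_prob vs (x - y))\<^sup>2) / 2"
      using sum_squares_bound[of "sign_prob us y" "sign_prob vs (x - y)"] by simp
  qed
  also have "\<dots> = ((\<Sum>y\<in>sign_sums us. (sign_prob us y)\<^sup>2) +
      (\<Sum>y\<in>sign_sums us. (sign_prob vs (x - y))\<^sup>2)) / 2"
    by (simp add: sum.distrib sum_divide_distrib[symmetric])
  also have "(\<Sum>y\<in>sign_sums us. (sign_prob vs (x - y))\<^sup>2) =
      (\<Sum>z\<in>(\<lambda>y. x - y) ` sign_sums us. (sign_prob vs z)\<^sup>2)"
    by (subst sum.reindex) (auto simp: inj_on_def)
  also have "\<dots> = (\<Sum>z\<in>(\<lambda>y. x - y) ` sign_sums us \<inter> sign_sums vs. (sign_prob vs z)\<^sup>2)"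
    by (rule sum.mono_neutral_right) (auto simp: sign_prob_eq_0)
  also have "\<dots> \<le> (\<Sum>z\<in>sign_sums vs. (sign_prob vs z)\<^sup>2)"
    by (rule sum_mono2) auto
  finally show ?thesis by (simp add: sign_prob_double)
qed

text \<open>Cauchy--Schwarz is iterated on halves: one half of the blocks, each taken twice,
  dominates, and the doubled blocks form a list of half the length. After \<open>Suc k\<close>
  rounds a single block carries all the multiplicity.\<close>

lemma sign_prob_concat_le:
  assumes "length Bs = 2 ^ Suc k"
  shows "\<exists>B\<in>set Bs. sign_prob (concat Bs) x \<le> sign_prob (concat (replicate (2 ^ Suc k) B)) 0"
  using assms
proof (induction k arbitrary: Bs x)
  case 0
  then have "length Bs = Suc (Suc 0)" by simp
  then obtain B C where "Bs = [B, C]" by (auto simp: length_Suc_conv)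
  then show ?case
    using sign_prob_append_le_max[of B C x] by (auto simp: max_def numeral_2_eq_2 split: if_splits)
next
  case (Suc k)
  define C D where "C = take (2 ^ Suc k) Bs" and "D = drop (2 ^ Suc k) Bs"
  have Bs: "Bs = C @ D" and len: "length C = 2 ^ Suc k" "length D = 2 ^ Suc k"
    using Suc.prems by (auto simp: C_def D_def)
  have rep: "concat (replicate r (B @ B)) = concat (replicate (2 * r) B)" for r and B :: "'a list"
    by (induction r) auto
  have key: "\<exists>B\<in>set E. sign_prob (concat E @ concat E) 0 \<le> sign_prob (concat (replicate (2 ^ Suc (Suc k)) B)) 0"
    if "length E = 2 ^ Suc k" for E :: "'a list list"
  proof -
    \<comment> \<open>Two copies of the half are regrouped as one copy of each doubled block, the
      form that the induction hypothesis accepts.\<close>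
    have "mset (concat E @ concat E) = mset (concat (map (\<lambda>B. B @ B) E))"
      by (induction E) (auto simp: ac_simps)
    then have eq: "sign_prob (concat E @ concat E) 0 = sign_prob (concat (map (\<lambda>B. B @ B) E)) 0"
      by (rule sign_prob_mset)
    from that Suc.IH[of "map (\<lambda>B. B @ B) E" 0] obtain B where "B \<in> set E" and
      "sign_prob (concat (map (\<lambda>B. B @ B) E)) 0 \<le> sign_prob (concat (replicate (2 ^ Suc k) (B @ B))) 0"
      by auto
    then show ?thesis unfolding eq rep power_Suc[of 2 "Suc k"] by blast
  qed
  obtain B where B: "B \<in> set C"
    "sign_prob (concat C @ concat C) 0 \<le> sign_prob (concat (replicate (2 ^ Suc (Suc k)) B)) 0"
    using key[OF len(1)] by blast
  obtain B' where B': "B' \<in> set D"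
    "sign_prob (concat D @ concat D) 0 \<le> sign_prob (concat (replicate (2 ^ Suc (Suc k)) B')) 0"
    using key[OF len(2)] by blast
  consider "sign_prob (concat Bs) x \<le> sign_prob (concat C @ concat C) 0"
    | "sign_prob (concat Bs) x \<le> sign_prob (concat D @ concat D) 0"
    using sign_prob_append_le_max[of "concat C" "concat D" x] unfolding Bs concat_append by linarith
  then show ?case
  proof cases
    case 1 then show ?thesis using B by (intro bexI[of _ B]) (auto simp: Bs)
  next
    case 2 then show ?thesis using B' by (intro bexI[of _ B']) (auto simp: Bs)
  qed
qed

section \<open>Return probabilities of walks along independent vectors\<close>

lemma sign_sums_span: "sign_sums ws \<subseteq> span (set ws)" for ws :: "'a::real_vector list"
proof (induction ws)
  case (Cons w ws)
  then have "sign_sums ws \<subseteq> span (set (w # ws))"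
    using span_mono[of "set ws" "set (w # ws)"] by auto
  then show ?case by (auto intro: span_add span_diff span_base)
qed simp

text \<open>With j minus signs the sum is (r - 2 j) b, and \<open>b \<noteq> 0\<close> keeps these
  values distinct; the recursion is Pascal's rule. An integer j covers the boundary term j - 1 =
  -1.\<close>

lemma sign_prob_replicate:
  fixes b :: "'a::real_vector"
  assumes "b \<noteq> 0"
  shows "sign_prob (replicate r b) ((real r - 2 * of_int j) *\<^sub>R b) =
           (if j \<ge> 0 then real (r choose nat j) / 2 ^ r else 0)"
proof (induction r arbitrary: j)
  case 0
  have "nat j = 0 \<longleftrightarrow> j = 0" if "j \<ge> 0" using that by auto
  then show ?case using assms by (auto simp: sign_prob_nil binomial_eq_0)
next
  case (Suc r)
  have a: "(real (Suc r) - 2 * of_int j) *\<^sub>R b - b = (real r - 2 * of_int j) *\<^sub>R b"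
    by (simp add: algebra_simps)
  have c: "(real (Suc r) - 2 * of_int j) *\<^sub>R b + b = (real r - 2 * of_int (j - 1)) *\<^sub>R b"
    by (simp add: scaleR_left_distrib scaleR_left_diff_distrib scaleR_2)
  show ?case
  proof (cases "j \<ge> 1")
    case True
    then have "j = int (Suc (nat (j - 1)))" by simp
    then obtain i where "j = int (Suc i)" by blast
    then show ?thesis unfolding replicate_Suc sign_prob_Cons a c Suc.IH
      by (simp add: nat_add_distrib field_simps)
  next
    case False
    then consider "j = 0" | "j < 0" by linarith
    then show ?thesis unfolding replicate_Suc sign_prob_Cons a c Suc.IH
      by cases auto
  qed
qed

lemma sign_prob_replicate_0:
  fixes b :: "'a::real_vector"
  assumes "b \<noteq> 0"
  shows "sign_prob (replicate (2 * h) b) 0 = real ((2 * h) choose h) / 4 ^ h"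
  using sign_prob_replicate[OF assms, of "2 * h" "int h"] by (simp add: power_mult)

text \<open>The square of the left side times 2 h + 1 starts at 1 and does not increase: consecutive
  values differ by the factor (2h+1)(2h+3)/(2h+2)^2 \<le> 1.\<close>

lemma central_binomial_le: "real ((2 * h) choose h) / 4 ^ h \<le> 1 / sqrt (2 * real h + 1)"
proof -
  have "(real ((2 * h) choose h) / 4 ^ h)\<^sup>2 * (2 * real h + 1) \<le> 1"
  proof (induction h)
    case (Suc h)
    have a: "Suc h * (2 * Suc h choose Suc h) = 2 * Suc h * (Suc (2 * h) choose h)"
      using Suc_times_binomial_eq[of "Suc (2 * h)" h] by simp
    have b: "Suc h * (Suc (2 * h) choose h) = Suc (2 * h) * (2 * h choose h)"
      using binomial_absorb_comp[of "Suc (2 * h)" h] by simp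
    have "Suc h * (Suc h * (2 * Suc h choose Suc h)) = Suc h * (2 * (2 * h + 1) * (2 * h choose h))"
      unfolding a using b by (simp only: mult.assoc mult.left_commute) simp
    then have "Suc h * (2 * Suc h choose Suc h) = 2 * (2 * h + 1) * (2 * h choose h)"
      by (metis mult_cancel1 nat.distinct(1))
    then have "real (Suc h) * real (2 * Suc h choose Suc h) = real (2 * (2 * h + 1) * (2 * h choose h))"
      by (metis of_nat_mult)
    then have eq: "real (2 * Suc h choose Suc h) = 2 * (2 * real h + 1) * real (2 * h choose h) / (real h + 1)"
      by (simp add: field_simps)
    define c where "c = real (2 * h choose h) / 4 ^ h"
    have E: "real (2 * Suc h choose Suc h) / 4 ^ Suc h = c * (2 * real h + 1) / (2 * (real h + 1))"
      unfolding eq c_def by (simp add: divide_simps) (simp add: algebra_simps)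
    then have "(real (2 * Suc h choose Suc h) / 4 ^ Suc h)\<^sup>2 * (2 * real (Suc h) + 1) =
       (c\<^sup>2 * (2 * real h + 1)) * ((2 * real h + 1) * (2 * real h + 3) / (4 * (real h + 1)\<^sup>2))"
      unfolding E by (simp add: power2_eq_square field_simps)
    also have "\<dots> \<le> 1 * 1"
    proof (intro mult_mono)
      show "(2 * real h + 1) * (2 * real h + 3) / (4 * (real h + 1)\<^sup>2) \<le> 1"
        by (subst divide_le_eq_1_pos) (auto simp: power2_eq_square algebra_simps add_pos_nonneg)
    qed (use Suc.IH in \<open>auto simp: c_def\<close>)
    finally show ?case by simp
  qed simp
  then have "(real ((2 * h) choose h) / 4 ^ h)\<^sup>2 \<le> (1 / sqrt (2 * real h + 1))\<^sup>2"
    by (simp add: power_divide field_simps)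
  then show ?thesis by (rule power2_le_imp_le) simp
qed

text \<open>Along an independent system the coordinates of the sum are independent: after collecting
  the copies of each vector, the sum vanishes exactly when every coordinate walk returns to
  0.\<close>

lemma sign_prob_concat_replicate:
  fixes B :: "'a::real_vector list"
  assumes "independent (set B)" "distinct B"
  shows "sign_prob (concat (replicate (2 * h) B)) 0 = (real ((2 * h) choose h) / 4 ^ h) ^ length B"
proof -
  have "mset (concat (replicate r B)) = mset (concat (map (replicate r) B))" for r
  proof (induction r)
    case 0 then show ?case by (induction B) auto
  next
    case (Suc r)
    have "mset (concat (map (replicate (Suc r)) B)) = mset B + mset (concat (map (replicate r) B))"
      by (induction B) (simp_all add: ac_simps)
    moreover have "mset (concat (replicate (Suc r) B)) = mset B + mset (concat (replicate r B))"
      by simp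
    ultimately show ?case using Suc.IH by argo
  qed
  then have "sign_prob (concat (replicate (2 * h) B)) 0 = sign_prob (concat (map (replicate (2 * h)) B)) 0"
    by (rule sign_prob_mset)
  also have "\<dots> = (real ((2 * h) choose h) / 4 ^ h) ^ length B"
    using assms
  proof (induction B)
    case (Cons b B)
    let ?u = "replicate (2 * h) b" and ?v = "concat (map (replicate (2 * h)) B)"
    have ind: "independent (set B)" "b \<notin> span (set B)"
      using Cons.prems by (auto simp: independent_insert)
    then have "b \<noteq> 0" using span_zero by auto
    have sv: "span (set ?v) \<subseteq> span (set B)" by (rule span_mono) auto
    have su: "span (set ?u) \<subseteq> span {b}" by (rule span_mono) auto
    have "sign_prob (?u @ ?v) 0 = sign_expect ?u (\<lambda>y. of_bool (y = 0) * sign_prob ?v 0)"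
      unfolding sign_prob_append
    proof (rule sign_expect_cong)
      fix y assume "y \<in> sign_sums ?u"
      then have "y \<in> span {b}" using sign_sums_span su by blast
      then obtain k where y: "y = k *\<^sub>R b" by (auto simp: span_singleton)
      show "sign_prob ?v (0 - y) = of_bool (y = 0) * sign_prob ?v 0"
      proof (cases "y = 0")
        case False
        \<comment> \<open>A nonzero multiple of \<open>b\<close> cannot be cancelled by the
          remaining vectors.\<close>
        have "- y \<notin> span (set B)"
        proof
          assume "- y \<in> span (set B)"
          then have "(- 1 / k) *\<^sub>R (- y) \<in> span (set B)" by (rule span_scale)
          then show False using y False ind(2) by auto
        qed
        then have "- y \<notin> sign_sums ?v" using sign_sums_span sv by blast
        then show ?thesis using False by (simp add: sign_prob_eq_0)
      qed simp
    qed
    also have "\<dots> = sign_prob ?u 0 * sign_prob ?v 0"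
      by (simp add: sign_expect_cmult sign_prob_def[of ?u])
    finally show ?case
      using Cons \<open>b \<noteq> 0\<close> ind by (simp add: sign_prob_replicate_0)
  qed (simp add: sign_prob_nil)
  finally show ?thesis .
qed

text \<open>The Littlewood--Offord inequality of Halasz; a number of systems that is a power of two
  lets Cauchy--Schwarz replace Hoelder's inequality.\<close>

lemma sign_prob_blocks:
  fixes Bs :: "'a::real_vector list list"
  assumes "length Bs = 2 ^ Suc k"
    and "\<And>B. B \<in> set Bs \<Longrightarrow> independent (set B) \<and> distinct B \<and> length B = c"
  shows "sign_prob (concat Bs) x \<le> (1 / sqrt (2 ^ Suc k)) ^ c"
proof -
  obtain B where B: "B \<in> set Bs"
    "sign_prob (concat Bs) x \<le> sign_prob (concat (replicate (2 ^ Suc k) B)) 0"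
    using sign_prob_concat_le[OF assms(1)] by blast
  have "sign_prob (concat (replicate (2 * 2 ^ k) B)) 0 = (real ((2 * 2 ^ k) choose 2 ^ k) / 4 ^ 2 ^ k) ^ c"
    using assms(2)[OF B(1)] by (subst sign_prob_concat_replicate) auto
  also have "\<dots> \<le> (1 / sqrt (2 * real (2 ^ k) + 1)) ^ c"
    by (intro power_mono central_binomial_le) auto
  also have "\<dots> \<le> (1 / sqrt (2 ^ Suc k)) ^ c"
    by (intro power_mono divide_left_mono mult_pos_pos) (auto intro: add_pos_pos)
  finally show ?thesis using B(2) by simp
qed

section \<open>Averages over bijections\<close>

text \<open>Extensional functions, so that each bijection counts once. Rows and columns are
  arbitrary sets because both shrink during the argument.\<close>

definition bijs :: "'a set \<Rightarrow> 'b set \<Rightarrow> ('a \<Rightarrow> 'b) set" where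
  "bijs R C = {f \<in> R \<rightarrow>\<^sub>E C. bij_betw f R C}"

text \<open>The factorial makes this a mean when \<open>R\<close> and \<open>C\<close> have equally
  many elements. A general \<open>G\<close> in place of an event allows averaging a probability over
  signs that are still to be drawn.\<close>

definition bij_avg ::
    "'a set \<Rightarrow> 'b set \<Rightarrow> ('a \<Rightarrow> 'b \<Rightarrow> 'e::comm_monoid_add) \<Rightarrow> ('e \<Rightarrow> real) \<Rightarrow> real" where
  "bij_avg R C M G = (\<Sum>f\<in>bijs R C. G (\<Sum>i\<in>R. M i (f i))) / fact (card R)"

definition quads :: "'a set \<Rightarrow> 'b set \<Rightarrow> ('a \<times> 'a \<times> 'b \<times> 'b) set" where
  "quads R C = {(i, k, j, l). i \<in> R \<and> k \<in> R \<and> i \<noteq> k \<and> j \<in> C \<and> l \<in> C \<and> j \<noteq> l}"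

text \<open>The difference between the two ways of matching rows \<open>i\<close>, \<open>k\<close>
  with columns \<open>j\<close>, \<open>l\<close>, an additive analogue of a 2x2 determinant. Row
  and column terms added to \<open>M\<close> cancel in it.\<close>

definition minor :: "('a \<Rightarrow> 'b \<Rightarrow> 'e::ab_group_add) \<Rightarrow> 'a \<Rightarrow> 'a \<Rightarrow> 'b \<Rightarrow> 'b \<Rightarrow> 'e" where
  "minor M i k j l = M i j + M k l - M i l - M k j"

lemma finite_bijs [simp]: "finite R \<Longrightarrow> finite C \<Longrightarrow> finite (bijs R C)"
  unfolding bijs_def by (rule finite_subset[OF _ finite_PiE]) auto

lemma bijs_peel:
  assumes "i \<in> R"
  shows "bij_betw (\<lambda>(j, f). f(i := j)) (SIGMA j:C. bijs (R - {i}) (C - {j})) (bijs R C)"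
\<comment> \<open>Resetting the removed row to \<open>undefined\<close> keeps the remaining
  bijection extensional.\<close>
proof (rule bij_betw_byWitness[where f' = "\<lambda>f. (f i, f(i := undefined))"])
  show "\<forall>a\<in>SIGMA j:C. bijs (R - {i}) (C - {j}).
      (\<lambda>f. (f i, f(i := undefined))) ((\<lambda>(j, f). f(i := j)) a) = a"
  proof
    fix a assume "a \<in> (SIGMA j:C. bijs (R - {i}) (C - {j}))"
    then obtain j f where a: "a = (j, f)" and "f \<in> bijs (R - {i}) (C - {j})" by blast
    then have "f i = undefined"
      using PiE_arb[of f "R - {i}" "\<lambda>_. C - {j}" i] by (simp add: bijs_def)
    then show "(\<lambda>f. (f i, f(i := undefined))) ((\<lambda>(j, f). f(i := j)) a) = a"
      by (simp add: a fun_upd_idem)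
  qed
  show "\<forall>a'\<in>bijs R C. (\<lambda>(j, f). f(i := j)) ((\<lambda>f. (f i, f(i := undefined))) a') = a'"
    by simp
  show "(\<lambda>(j, f). f(i := j)) ` (SIGMA j:C. bijs (R - {i}) (C - {j})) \<subseteq> bijs R C"
  proof clarify
    fix j f assume *: "j \<in> C" "f \<in> bijs (R - {i}) (C - {j})"
    have "bij_betw (f(i := j)) (R - {i}) (C - {j})"
      using *(2) by (subst bij_betw_cong[of _ _ f]) (auto simp: bijs_def)
    then have "bij_betw (f(i := j)) (insert i (R - {i})) (insert j (C - {j}))"
      using notIn_Un_bij_betw[of i "R - {i}" "f(i := j)" "C - {j}"] by simp
    then have "bij_betw (f(i := j)) R C"
      using assms * by (simp add: insert_absorb)
    moreover have "f(i := j) \<in> R \<rightarrow>\<^sub>E C"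
    proof (rule PiE_I)
      fix x assume "x \<in> R" then show "(f(i := j)) x \<in> C"
        using * PiE_mem[of f "R - {i}" "\<lambda>_. C - {j}" x] by (auto simp: bijs_def)
    next
      fix x assume "x \<notin> R" then show "(f(i := j)) x = undefined"
        using * assms PiE_arb[of f "R - {i}" "\<lambda>_. C - {j}" x] by (auto simp: bijs_def)
    qed
    ultimately show "f(i := j) \<in> bijs R C" by (simp add: bijs_def)
  qed
  show "(\<lambda>f. (f i, f(i := undefined))) ` bijs R C \<subseteq> (SIGMA j:C. bijs (R - {i}) (C - {j}))"
  proof clarify
    fix f assume f: "f \<in> bijs R C"
    then have fi: "f i \<in> C" using assms PiE_mem[of f R "\<lambda>_. C" i] by (simp add: bijs_def)
    have "bij_betw f (R - {i}) (C - {f i})"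
      using f assms unfolding bijs_def bij_betw_def inj_on_def by blast
    then have bij: "bij_betw (f(i := undefined)) (R - {i}) (C - {f i})"
      by (subst bij_betw_cong[of _ _ f]) auto
    have "f(i := undefined) \<in> R - {i} \<rightarrow>\<^sub>E C - {f i}"
    proof (rule PiE_I)
      fix x assume "x \<in> R - {i}" then show "(f(i := undefined)) x \<in> C - {f i}"
        using bij by (blast dest: bij_betwE)
    next
      fix x assume "x \<notin> R - {i}" then show "(f(i := undefined)) x = undefined"
        using f PiE_arb[of f R "\<lambda>_. C" x] by (auto simp: bijs_def)
    qed
    with bij fi show "f i \<in> C \<and> f(i := undefined) \<in> bijs (R - {i}) (C - {f i})"
      by (simp add: bijs_def)
  qed
qed

lemma sum_bijs_peel:
  assumes "i \<in> R" "finite R" "finite C"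
  shows "(\<Sum>f\<in>bijs R C. h f) = (\<Sum>j\<in>C. \<Sum>f\<in>bijs (R - {i}) (C - {j}). h (f(i := j)))"
proof -
  have "(\<Sum>f\<in>bijs R C. h f) = (\<Sum>(j, f)\<in>(SIGMA j:C. bijs (R - {i}) (C - {j})). h (f(i := j)))"
    using sum.reindex_bij_betw[OF bijs_peel[OF assms(1)], of h C]
    by (simp add: case_prod_unfold)
  also have "\<dots> = (\<Sum>j\<in>C. \<Sum>f\<in>bijs (R - {i}) (C - {j}). h (f(i := j)))"
    using assms by (subst sum.Sigma) auto
  finally show ?thesis .
qed

lemma card_bijs: "finite R \<Longrightarrow> finite C \<Longrightarrow> card R = card C \<Longrightarrow> card (bijs R C) = fact (card R)"
proof (induction R arbitrary: C rule: finite_induct)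
  case empty
  then have "C = {}" by simp
  then have "bijs {} C = {\<lambda>_. undefined}" by (auto simp: bijs_def bij_betw_def)
  then show ?case by (metis card.empty card_1_singleton_iff fact_0 One_nat_def)
next
  case (insert i R)
  have "card (bijs (insert i R) C) = (\<Sum>j\<in>C. card (bijs R (C - {j})))"
    using sum_bijs_peel[of i "insert i R" C "\<lambda>_. 1::nat"] insert by simp
  also have "\<dots> = (\<Sum>j\<in>C. fact (card R))"
  proof (rule sum.cong)
    fix j assume "j \<in> C"
    then show "card (bijs R (C - {j})) = fact (card R)"
      using insert.prems insert.hyps by (intro insert.IH) (auto simp: card_Diff_singleton)
  qed simp
  also have "\<dots> = fact (card (insert i R))"
    using insert.hyps insert.prems by (metis card_insert_disjoint fact_Suc of_nat_id sum_constant)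
  finally show ?case .
qed

lemma bij_avg_const:
  "finite R \<Longrightarrow> finite C \<Longrightarrow> card R = card C \<Longrightarrow> bij_avg R C M (\<lambda>_. c) = c"
  by (simp add: bij_avg_def card_bijs)

lemma bij_avg_mono: "(\<And>y. G y \<le> H y) \<Longrightarrow> bij_avg R C M G \<le> bij_avg R C M H"
  by (auto simp: bij_avg_def intro!: divide_right_mono sum_mono)

lemma bij_avg_add: "bij_avg R C M (\<lambda>y. G y + H y) = bij_avg R C M G + bij_avg R C M H"
  by (simp add: bij_avg_def sum.distrib add_divide_distrib)

lemma bij_avg_divide: "bij_avg R C M (\<lambda>y. G y / c) = bij_avg R C M G / c"
  by (simp add: bij_avg_def sum_divide_distrib mult.commute)

lemma bij_avg_peel:
  assumes "i \<in> R" "finite R" "finite C" "card R = card C"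
  shows "bij_avg R C M G =
    (\<Sum>j\<in>C. bij_avg (R - {i}) (C - {j}) M (\<lambda>y. G (M i j + y))) / real (card C)"
proof -
  have eq: "(\<Sum>k\<in>R. M k ((f(i := j)) k)) = M i j + (\<Sum>k\<in>R - {i}. M k (f k))" for f j
    using assms by (simp add: sum.remove[of R i])
  have "0 < card R" using assms by (auto simp: card_gt_0_iff)
  then have "(fact (card R) :: real) = fact (card (R - {i})) * real (card C)"
    using assms by (simp add: fact_reduce)
  then show ?thesis
    unfolding bij_avg_def sum_bijs_peel[OF assms(1-3)] eq
    by (simp add: sum_divide_distrib)
qed

section \<open>Removing two rows and two columns at a time\<close>

lemma quads_eq:
  "quads R C = (SIGMA i:R. SIGMA k:R - {i}. SIGMA j:C. C - {j})"
  by (auto simp: quads_def)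

lemma finite_quads [simp]: "finite R \<Longrightarrow> finite C \<Longrightarrow> finite (quads R C)"
  by (simp add: quads_eq)

lemma sum_quads:
  assumes "finite R" "finite C"
  shows "(\<Sum>(i, k, j, l)\<in>quads R C. h i k j l) =
    (\<Sum>i\<in>R. \<Sum>k\<in>R - {i}. \<Sum>j\<in>C. \<Sum>l\<in>C - {j}. h i k j l)"
  unfolding quads_eq using assms by (simp add: sum.Sigma[symmetric])

lemma card_quads:
  assumes "finite R" "finite C" "card R = card C"
  shows "card (quads R C) = (card R * (card R - 1))\<^sup>2"
proof -
  have "card (quads R C) = (\<Sum>(i, k, j, l)\<in>quads R C. 1)" by (simp add: case_prod_unfold)
  also have "\<dots> = (\<Sum>i\<in>R. \<Sum>k\<in>R - {i}. \<Sum>j\<in>C. \<Sum>l\<in>C - {j}. 1)"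
    using assms by (intro sum_quads)
  also have "\<dots> = (card R * (card R - 1))\<^sup>2"
    using assms by (simp add: power2_eq_square)
  finally show ?thesis .
qed

text \<open>For fixed rows \<open>i\<close> and \<open>k\<close>, conditioning on their images
  averages over ordered pairs of columns. The result is the same for every pair of rows, so the rows
  may be averaged too.\<close>

lemma bij_avg_quads:
  assumes "finite R" "finite C" "card R = card C" "card R \<ge> 2"
  shows "bij_avg R C M G =
    (\<Sum>(i, k, j, l)\<in>quads R C. bij_avg (R - {i, k}) (C - {j, l}) M (\<lambda>y. G (M i j + M k l + y)))
      / real (card (quads R C))"
proof -
  define r where "r = real (card C)"
  have r: "r \<ge> 2" using assms by (simp add: r_def)
  define A where "A i k j l = bij_avg (R - {i, k}) (C - {j, l}) M (\<lambda>y. G (M i j + M k l + y))" for i k j l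
  have two: "bij_avg R C M G = (\<Sum>j\<in>C. \<Sum>l\<in>C - {j}. A i k j l) / (r * (r - 1))"
    if "i \<in> R" "k \<in> R - {i}" for i k
  proof -
    have d: "R - {i} - {k} = R - {i, k}" "C - {j} - {l} = C - {j, l}" for j l by auto
    have "bij_avg (R - {i}) (C - {j}) M (\<lambda>y. G (M i j + y)) = (\<Sum>l\<in>C - {j}. A i k j l) / (r - 1)"
      if "j \<in> C" for j
      using bij_avg_peel[of k "R - {i}" "C - {j}" M "\<lambda>y. G (M i j + y)"] assms that \<open>i \<in> R\<close> \<open>k \<in> _\<close>
      unfolding A_def d by (simp add: r_def add.assoc of_nat_diff)
    then show ?thesis
      using bij_avg_peel[OF that(1) assms(1-3), of M G]
      by (simp add: r_def sum_divide_distrib mult.commute cong: sum.cong)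
  qed
  have "(\<Sum>(i, k, j, l)\<in>quads R C. A i k j l) = (\<Sum>i\<in>R. \<Sum>k\<in>R - {i}. \<Sum>j\<in>C. \<Sum>l\<in>C - {j}. A i k j l)"
    by (rule sum_quads) fact+
  also have "\<dots> = (\<Sum>i\<in>R. \<Sum>k\<in>R - {i}. bij_avg R C M G * (r * (r - 1)))"
    using r by (intro sum.cong refl) (use two in \<open>simp add: field_simps\<close>)
  also have "\<dots> = (r * (r - 1))\<^sup>2 * bij_avg R C M G"
    using assms r by (simp add: r_def of_nat_diff power2_eq_square)
  finally show ?thesis
    using r assms unfolding A_def by (auto simp: card_quads r_def of_nat_diff)
qed

text \<open>Exchanging the images of the two chosen rows gives each bijection and its twist equal weight.\<close>

lemma bij_avg_quads_sym:
  fixes M :: "'a \<Rightarrow> 'b \<Rightarrow> 'e::comm_monoid_add"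
  assumes "finite R" "finite C" "card R = card C" "card R \<ge> 2"
  shows "bij_avg R C M G =
    (\<Sum>(i, k, j, l)\<in>quads R C. bij_avg (R - {i, k}) (C - {j, l}) M
        (\<lambda>y. (G (M i j + M k l + y) + G (M i l + M k j + y)) / 2)) / real (card (quads R C))"
proof -
  define A where "A i k j l = bij_avg (R - {i, k}) (C - {j, l}) M (\<lambda>y. G (M i j + M k l + y))" for i k j l
  have "(\<Sum>(i, k, j, l)\<in>quads R C. A i k j l) = (\<Sum>(i, k, j, l)\<in>quads R C. A i k l j)"
    by (rule sum.reindex_bij_witness[of _ "\<lambda>(i, k, j, l). (i, k, l, j)" "\<lambda>(i, k, j, l). (i, k, l, j)"])
       (auto simp: quads_def)
  then have "(\<Sum>(i, k, j, l)\<in>quads R C. A i k j l) = (\<Sum>(i, k, j, l)\<in>quads R C. (A i k j l + A i k l j) / 2)"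
    by (simp add: case_prod_unfold sum.distrib sum_divide_distrib[symmetric])
  moreover have "C - {l, j} = C - {j, l}" for j l by auto
  ultimately show ?thesis
    unfolding bij_avg_quads[OF assms] A_def by (simp add: bij_avg_divide bij_avg_add)
qed

section \<open>Vector-valued anticoncentration by collecting bases\<close>

text \<open>State of the collecting process: completed bases \<open>Bs\<close> and a system
  \<open>cur\<close> under construction. As \<open>cur\<close> is shorter than a basis, some nonzero
  functional vanishes on it.\<close>

definition good_blocks :: "'e::euclidean_space list \<Rightarrow> 'e list list \<Rightarrow> bool" where
  "good_blocks cur Bs \<longleftrightarrow>
     independent (set cur) \<and> distinct cur \<and> length cur < DIM('e) \<and>
     (\<forall>B\<in>set Bs. independent (set B) \<and> distinct B \<and> length B = DIM('e))"

text \<open>Let u be the number of half minors collected so far. Each removal finds with probability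
  at least p a minor outside the span of \<open>cur\<close>; this halves the potential 2^(u0 - u),
  which therefore shrinks on average by the factor 1 - p/2. At the end the potential exceeds 1
  wherever fewer than \<open>u0\<close> vectors were collected, which pays for the trivial bound
  there; elsewhere \<open>h\<close> applies.\<close>

lemma bij_avg_sign_prob_le:
  fixes M :: "'a \<Rightarrow> 'b \<Rightarrow> 'e::euclidean_space"
  assumes fin: "finite R0" "finite C0"
    and p: "0 \<le> p" "p \<le> 1"
    and dense: "\<And>R C \<phi>. \<lbrakk>R \<subseteq> R0; C \<subseteq> C0; card R = card C; N < card R; \<phi> \<noteq> 0\<rbrakk> \<Longrightarrow>
       p * real (card (quads R C)) \<le> real (card {(i, k, j, l) \<in> quads R C. \<phi> \<bullet> minor M i k j l \<noteq> 0})"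
    and H: "\<And>cur Bs x. good_blocks cur (Bs :: 'e list list) \<Longrightarrow>
       u0 \<le> DIM('e) * length Bs + length cur \<Longrightarrow> sign_prob (cur @ concat Bs) x \<le> h"
    and h: "0 \<le> h"
    and RC: "R \<subseteq> R0" "C \<subseteq> C0" "card R = card C" "N + 2 * t \<le> card R"
    and good: "good_blocks cur Bs"
  shows "bij_avg R C M (\<lambda>y. sign_prob (cur @ concat Bs) (x - y))
    \<le> h + 2 ^ u0 / 2 ^ (DIM('e) * length Bs + length cur) * (1 - p / 2) ^ t"
  using RC good
proof (induction t arbitrary: R C cur Bs x)
  case 0
  have finRC: "finite R" "finite C" using 0 fin by (auto intro: finite_subset)
  let ?u = "DIM('e) * length Bs + length cur"
  have "sign_prob (cur @ concat Bs) z \<le> h + 2 ^ u0 / 2 ^ ?u" for z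
  proof (cases "u0 \<le> ?u")
    case True
    have "(0::real) \<le> 2 ^ u0 / 2 ^ ?u" by simp
    with H[OF 0(5) True, of z] show ?thesis by linarith
  next
    case False
    then have "(2::real) ^ ?u \<le> 2 ^ u0" by (intro power_increasing) auto
    then have "(1::real) \<le> 2 ^ u0 / 2 ^ ?u" by simp
    moreover have "sign_prob (cur @ concat Bs) z \<le> 1" by simp
    ultimately show ?thesis using h by linarith
  qed
  then show ?case
    using bij_avg_mono[of "\<lambda>y. sign_prob (cur @ concat Bs) (x - y)" "\<lambda>_. h + 2 ^ u0 / 2 ^ ?u" R C M]
      finRC 0 by (simp add: bij_avg_const)
next
  case (Suc t)
  have finRC: "finite R" "finite C" using Suc.prems fin by (auto intro: finite_subset)
  have r2: "card R \<ge> 2" "N < card R" using Suc.prems by auto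
  let ?u = "DIM('e) * length Bs + length cur" and ?ws = "cur @ concat Bs"
  define K where "K = 2 ^ u0 / 2 ^ ?u * (1 - p / 2) ^ t"
  have K0: "0 \<le> K" using p by (simp add: K_def)
  define G where "G y = sign_prob ?ws (x - y)" for y
  define A where "A i k j l = bij_avg (R - {i, k}) (C - {j, l}) M
        (\<lambda>y. (G (M i j + M k l + y) + G (M i l + M k j + y)) / 2)" for i k j l
  define S where "S = {(i, k, j, l) \<in> quads R C. minor M i k j l \<notin> span (set cur)}"
  have SQ: "S \<subseteq> quads R C" by (auto simp: S_def)
  have "dim (set cur) < DIM('e)"
    using dim_le_card[of "set cur" "set cur"] card_length[of cur] Suc.prems(5)
    by (auto simp: good_blocks_def span_superset)
  \<comment> \<open>A functional orthogonal to \<open>cur\<close> certifies new directions: a minor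
    on which \<phi> is nonzero lies outside the span.\<close>
  then obtain \<phi> where \<phi>: "\<phi> \<noteq> 0" "\<And>y. y \<in> span (set cur) \<Longrightarrow> \<phi> \<bullet> y = 0"
    using orthogonal_to_subspace_exists by (metis real_inner_class.orthogonal_def)
  have "p * real (card (quads R C)) \<le> real (card {(i, k, j, l) \<in> quads R C. \<phi> \<bullet> minor M i k j l \<noteq> 0})"
    using Suc.prems r2 \<phi> by (intro dense) auto
  also have "\<dots> \<le> real (card S)"
  proof -
    have "{(i, k, j, l) \<in> quads R C. \<phi> \<bullet> minor M i k j l \<noteq> 0} \<subseteq> S"
      using \<phi>(2) by (auto simp: S_def)
    then show ?thesis
      using finite_subset[OF SQ finite_quads[OF finRC]] by (simp add: card_mono)
  qed
  finally have S: "p * real (card (quads R C)) \<le> real (card S)" .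
  have bound: "A i k j l \<le> h + K * (1 - of_bool ((i, k, j, l) \<in> S) / 2)"
    if q: "(i, k, j, l) \<in> quads R C" for i k j l
  proof -
    let ?R = "R - {i, k}" and ?C = "C - {j, l}"
    have RC': "?R \<subseteq> R0" "?C \<subseteq> C0" "card ?R = card ?C" "N + 2 * t \<le> card ?R"
      using Suc.prems q finRC by (auto simp: quads_def card_Diff_subset)
    show ?thesis
    proof (cases "(i, k, j, l) \<in> S")
      case False
      \<comment> \<open>A dependent minor is discarded: both matchings are bounded separately by the
        induction hypothesis with the state unchanged.\<close>
      have le: "bij_avg ?R ?C M (\<lambda>y. G (m + y)) \<le> h + K" for m
        using Suc.IH[OF RC' Suc.prems(5), of "x - m"] unfolding G_def K_def
        by (simp add: algebra_simps)
      have "A i k j l = (bij_avg ?R ?C M (\<lambda>y. G (M i j + M k l + y)) +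
          bij_avg ?R ?C M (\<lambda>y. G (M i l + M k j + y))) / 2"
        by (simp add: A_def bij_avg_divide bij_avg_add)
      also have "\<dots> \<le> h + K" using le[of "M i j + M k l"] le[of "M i l + M k j"] by simp
      finally show ?thesis using False by simp
    next
      case True
      \<comment> \<open>The two matchings contribute midpoint plus and midpoint minus half of the
        minor, so the choice between them is one fresh random sign.\<close>
      define w where "w = (1 / 2) *\<^sub>R minor M i k j l"
      define m where "m = (1 / 2) *\<^sub>R (M i j + M k l + M i l + M k j)"
      have wm: "M i j + M k l = m + w" "M i l + M k j = m - w"
      proof -
        have "(M i j + M k l + M i l + M k j) + minor M i k j l = 2 *\<^sub>R (M i j + M k l)"
             "(M i j + M k l + M i l + M k j) - minor M i k j l = 2 *\<^sub>R (M i l + M k j)"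
          by (simp_all add: minor_def scaleR_2)
        then show "M i j + M k l = m + w" "M i l + M k j = m - w"
          unfolding w_def m_def scaleR_right_distrib[symmetric] scaleR_right_diff_distrib[symmetric]
          by simp_all
      qed
      have w: "w \<notin> span (set cur)"
      proof
        assume "w \<in> span (set cur)"
        then have "2 *\<^sub>R w \<in> span (set cur)" by (rule span_scale)
        then show False using True by (simp add: w_def S_def)
      qed
      have "(\<lambda>y. (G (M i j + M k l + y) + G (M i l + M k j + y)) / 2) =
            (\<lambda>y. sign_prob (w # ?ws) (x - m - y))"
        unfolding wm G_def sign_prob_Cons by (simp add: algebra_simps)
      then have A: "A i k j l = bij_avg ?R ?C M (\<lambda>y. sign_prob (w # ?ws) (x - m - y))"
        by (simp add: A_def)
      have ind: "independent (set (w # cur))" "distinct (w # cur)"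
        using w Suc.prems(5) span_base[of w "set cur"] by (auto simp: good_blocks_def independent_insert)
      have "bij_avg ?R ?C M (\<lambda>y. sign_prob (w # ?ws) (x - m - y))
          \<le> h + 2 ^ u0 / 2 ^ Suc ?u * (1 - p / 2) ^ t"
      \<comment> \<open>A vector that completes \<open>cur\<close> to a basis moves it to the
        blocks, and an empty system is started.\<close>
      proof (cases "Suc (length cur) = DIM('e)")
        case True
        then have "good_blocks [] ((w # cur) # Bs)"
          using ind Suc.prems(5) by (simp add: good_blocks_def independent_empty)
        from Suc.IH[OF RC' this, of "x - m"] show ?thesis
          by (simp add: True[symmetric] algebra_simps)
      next
        case False
        then have "good_blocks (w # cur) Bs"
          using ind Suc.prems(5) by (simp add: good_blocks_def)
        from Suc.IH[OF RC' this, of "x - m"] show ?thesis by simp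
      qed
      then show ?thesis using True by (simp add: A K_def field_simps)
    qed
  qed
  have "(\<Sum>(i, k, j, l)\<in>quads R C. A i k j l)
      \<le> (\<Sum>q\<in>quads R C. h + K * (1 - of_bool (q \<in> S) / 2))"
  proof (rule sum_mono)
    fix q assume "q \<in> quads R C"
    moreover obtain i k j l where "q = (i, k, j, l)" by (cases q)
    ultimately show "(case q of (i, k, j, l) \<Rightarrow> A i k j l) \<le> h + K * (1 - of_bool (q \<in> S) / 2)"
      using bound[of i k j l] by (simp only: prod.case)
  qed
  also have "\<dots> = real (card (quads R C)) * (h + K) - K / 2 * real (card S)"
  proof -
    have "(\<Sum>q\<in>quads R C. h + K * (1 - of_bool (q \<in> S) / 2)) =
        (\<Sum>q\<in>quads R C. (h + K) - K / 2 * of_bool (q \<in> S))"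
      by (simp add: algebra_simps)
    also have "\<dots> = real (card (quads R C)) * (h + K) - K / 2 * (\<Sum>q\<in>quads R C. of_bool (q \<in> S))"
      unfolding sum_subtractf sum_distrib_left by simp
    also have "(\<Sum>q\<in>quads R C. of_bool (q \<in> S) :: real) = real (card S)"
    proof -
      have "(\<Sum>q\<in>quads R C. of_bool (q \<in> S) :: real) = (\<Sum>q\<in>S. 1)"
        using SQ finRC by (intro sum.mono_neutral_cong_right) auto
      then show ?thesis by simp
    qed
    finally show ?thesis .
  qed
  also have "\<dots> \<le> real (card (quads R C)) * (h + K) - K / 2 * (p * real (card (quads R C)))"
    using S K0 by (intro diff_left_mono mult_left_mono) auto
  also have "\<dots> = real (card (quads R C)) * (h + K * (1 - p / 2))"
    by (simp add: algebra_simps)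
  finally have "(\<Sum>(i, k, j, l)\<in>quads R C. A i k j l) / real (card (quads R C)) \<le> h + K * (1 - p / 2)"
    using r2 card_quads[OF finRC] Suc.prems(3) by (simp add: divide_le_eq mult.commute)
  then have "bij_avg R C M G \<le> h + K * (1 - p / 2)"
    using bij_avg_quads_sym[OF finRC Suc.prems(3) r2(1), of M G] by (simp only: A_def)
  also have "K * (1 - p / 2) = 2 ^ u0 / 2 ^ ?u * (1 - p / 2) ^ Suc t"
    unfolding K_def power_Suc by (simp only: mult_ac)
  finally show ?case by (simp only: G_def[abs_def])
qed

section \<open>The Littlewood--Offord bound for a random permutation\<close>

definition nz_minors :: "nat \<Rightarrow> (nat \<Rightarrow> nat \<Rightarrow> real) \<Rightarrow> (nat \<times> nat \<times> nat \<times> nat) set" where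
  "nz_minors n a = {(i, k, j, l) \<in> quads {..<n} {..<n}. minor a i k j l \<noteq> 0}"

lemma card_quads_le:
  assumes "R \<subseteq> {..<n}" "C \<subseteq> {..<n}"
  shows "card (quads R C) \<le> n ^ 4"
proof -
  have "quads R C \<subseteq> {..<n} \<times> {..<n} \<times> {..<n} \<times> {..<n}" using assms by (auto simp: quads_def)
  from card_mono[OF _ this] show ?thesis by (simp add: power4_eq_xxxx mult.assoc)
qed

text \<open>A lost quadruple has one of its four indices among at most \<open>s\<close> deleted rows
  or columns, with at most n^3 choices for the others. So a positive density of minors survives the
  removal of a small proportion of the lines.\<close>

lemma card_restrict_quads:
  assumes Z: "Z \<subseteq> quads {..<n} {..<n}" and RC: "R \<subseteq> {..<n}" "C \<subseteq> {..<n}"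
    and s: "n \<le> card R + s" "n \<le> card C + s"
  shows "card Z \<le> card (Z \<inter> quads R C) + 4 * s * n ^ 3"
proof -
  let ?n = "{..<n}"
  let ?A = "?n - R" and ?B = "?n - C"
  have fin: "finite R" "finite C" "finite Z"
    using finite_subset[OF RC(1)] finite_subset[OF RC(2)] finite_subset[OF Z] by simp_all
  have A: "card ?A \<le> s" "card ?B \<le> s"
    using s card_Diff_subset[OF fin(1) RC(1)] card_Diff_subset[OF fin(2) RC(2)] by simp_all
  let ?U = "?A \<times> ?n \<times> ?n \<times> ?n \<union> (?n \<times> ?A \<times> ?n \<times> ?n \<union> (?n \<times> ?n \<times> ?B \<times> ?n \<union> ?n \<times> ?n \<times> ?n \<times> ?B))"
  have "Z - quads R C \<subseteq> ?U"
  proof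
    fix z assume z: "z \<in> Z - quads R C"
    obtain i k j l where zz: "z = (i, k, j, l)" by (cases z)
    have "(i, k, j, l) \<in> quads ?n ?n" using z Z zz by blast
    then have m: "i < n" "k < n" "j < n" "l < n" "i \<noteq> k" "j \<noteq> l" by (simp_all add: quads_def)
    then have "i \<notin> R \<or> k \<notin> R \<or> j \<notin> C \<or> l \<notin> C" using z by (simp add: zz quads_def)
    then show "z \<in> ?U" using m by (elim disjE) (simp_all add: zz)
  qed
  then have "card (Z - quads R C) \<le> card ?U" by (intro card_mono) auto
  also have "\<dots> \<le> card (?A \<times> ?n \<times> ?n \<times> ?n) + (card (?n \<times> ?A \<times> ?n \<times> ?n) +
      (card (?n \<times> ?n \<times> ?B \<times> ?n) + card (?n \<times> ?n \<times> ?n \<times> ?B)))"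
    by (meson card_Un_le add_left_mono order_trans)
  also have "\<dots> = (card ?A + card ?A + card ?B + card ?B) * n ^ 3"
    by (simp add: card_cartesian_product power3_eq_cube algebra_simps)
  also have "\<dots> \<le> (4 * s) * n ^ 3" using A by (intro mult_right_mono) auto
  finally have "card (Z - quads R C) \<le> 4 * s * n ^ 3" by simp
  moreover have "card Z = card (Z \<inter> quads R C) + card (Z - quads R C)"
    using card_Un_disjoint[of "Z \<inter> quads R C" "Z - quads R C"] fin(3)
    by (simp add: Int_Diff_Un Int_Diff_disjoint)
  ultimately show ?thesis by linarith
qed

lemma minor_inner: "minor (\<lambda>i j. \<phi> \<bullet> M i j) i k j l = \<phi> \<bullet> minor M i k j l"
  by (simp add: minor_def inner_simps)

text \<open>As \<open>cur\<close> is shorter than a basis, this many vectors contain at least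
  \<open>2 ^ Suc k\<close> complete bases. The signs of all further vectors are conditioned
  on.\<close>

lemma good_blocks_sign_prob:
  fixes cur :: "'e::euclidean_space list"
  assumes good: "good_blocks cur Bs" and u: "DIM('e) * 2 ^ Suc k \<le> DIM('e) * length Bs + length cur"
  shows "sign_prob (cur @ concat Bs) x \<le> (1 / sqrt (2 ^ Suc k)) ^ DIM('e)"
proof -
  have "length Bs \<ge> 2 ^ Suc k"
  proof (rule ccontr)
    assume "\<not> ?thesis"
    then have "length Bs + 1 \<le> 2 ^ Suc k" by simp
    then have "DIM('e) * (length Bs + 1) \<le> DIM('e) * 2 ^ Suc k" by (rule mult_left_mono) simp
    then show False using u good by (simp add: good_blocks_def)
  qed
  then have len: "length (take (2 ^ Suc k) Bs) = 2 ^ Suc k" by simp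
  have "mset (concat Bs) = mset (concat (take (2 ^ Suc k) Bs)) + mset (concat (drop (2 ^ Suc k) Bs))"
    by (metis append_take_drop_id concat_append mset_append)
  then have "sign_prob (cur @ concat Bs) x =
      sign_prob ((cur @ concat (drop (2 ^ Suc k) Bs)) @ concat (take (2 ^ Suc k) Bs)) x"
    by (intro sign_prob_mset) simp
  also have "\<dots> \<le> (1 / sqrt (2 ^ Suc k)) ^ DIM('e)"
    by (intro sign_prob_append_le sign_prob_blocks[OF len])
       (use good in \<open>auto simp: good_blocks_def dest: in_set_takeD\<close>)
  finally show ?thesis .
qed

lemma bij_avg_le_1:
  assumes "finite R" "finite C" "card R = card C"
  shows "bij_avg R C M (\<lambda>y. of_bool (P y)) \<le> 1"
  using bij_avg_mono[of "\<lambda>y. of_bool (P y)" "\<lambda>_. 1" R C M] bij_avg_const[OF assms, of M 1] by simp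

lemma littlewood_offord_bijs:
  assumes "\<epsilon> > 0"
  shows "\<exists>K. \<forall>n\<ge>1. \<forall>M :: nat \<Rightarrow> nat \<Rightarrow> 'e::euclidean_space.
    (\<forall>\<phi>. \<phi> \<noteq> 0 \<longrightarrow> \<epsilon> * real n ^ 4 \<le> real (card (nz_minors n (\<lambda>i j. \<phi> \<bullet> M i j)))) \<longrightarrow>
    bij_avg {..<n} {..<n} M (\<lambda>y. of_bool (y = 0)) \<le> K / sqrt (real n) ^ DIM('e)"
proof -
  define e where "e = min \<epsilon> 1"
  have e: "0 < e" "e \<le> 1" "e \<le> \<epsilon>" using assms by (auto simp: e_def)
  define D where "D = DIM('e)"
  have D: "D \<ge> 1" by (simp add: D_def)
  define N0 where "N0 = 16 * (16 * real D / e + 1) / e"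
  define c where "c = e\<^sup>2 / (256 * real D)"
  have c: "0 < c" using e D by (simp add: c_def)
  define K where "K = max (sqrt N0 ^ D) (2 * (1 / sqrt (c / 2)) ^ D)"
  show ?thesis
  proof (intro exI[of _ K] allI impI)
    fix n :: nat and M :: "nat \<Rightarrow> nat \<Rightarrow> 'e"
    assume n: "n \<ge> 1" and nz: "\<forall>\<phi>. \<phi> \<noteq> 0 \<longrightarrow> \<epsilon> * real n ^ 4 \<le> real (card (nz_minors n (\<lambda>i j. \<phi> \<bullet> M i j)))"
    let ?n = "{..<n}"
    \<comment> \<open>Deleting 2T rows and 2T columns loses at most 8 T n^3 \<le> (e/2) n^4 nonzero
      minors, so the density e/2 persists throughout the process.\<close>
    define T where "T = nat \<lfloor>e * n / 16\<rfloor>"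
    have en: "0 \<le> e * n / 16" using e by simp
    have T: "real T \<le> e * n / 16" "e * n / 16 < real T + 1"
      unfolding T_def using en by (auto simp: of_nat_nat) linarith+
    define p where "p = e / 2"
    have p: "0 < p" "p \<le> 1" using e by (auto simp: p_def)
    \<comment> \<open>About the number of bases to collect. Asking for u0 \<le> D X vectors costs a
      factor of at most exp(D X), while T removals gain exp(- p T / 2) = exp(-2 D X).\<close>
    define X where "X = p * T / (4 * D)"
    show "bij_avg ?n ?n M (\<lambda>y. of_bool (y = 0)) \<le> K / sqrt (real n) ^ DIM('e)"
    \<comment> \<open>For bounded n the trivial bound 1 is absorbed into \<open>K\<close> through
      \<open>N0\<close>.\<close>
    proof (cases "X < 2")
      case True
      have "real T < 16 * D / e"
        using True D e by (simp add: X_def p_def field_simps)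
      then have "e * n / 16 < 16 * D / e + 1" using T(2) by linarith
      then have "e * n < 16 * (16 * D / e + 1)" by simp
      then have "real n \<le> N0" using e unfolding N0_def by (simp add: pos_le_divide_eq mult.commute)
      then have "sqrt (real n) ^ D \<le> sqrt N0 ^ D" by (intro power_mono) auto
      also have "\<dots> \<le> K" by (simp add: K_def)
      finally have "1 \<le> K / sqrt (real n) ^ D" using n by (simp add: field_simps)
      then show ?thesis using bij_avg_le_1[of ?n ?n M "\<lambda>y. y = 0"] by (simp add: D_def)
    next
      case False
      then have "X \<ge> 2" by simp
      have T1: "T \<ge> 1" using False by (cases T) (auto simp: X_def)
      have "e * n / 32 \<le> T" using T(2) T1 by linarith
      then have Xc: "c * n \<le> X"
        using D e unfolding X_def c_def p_def by (simp add: field_simps power2_eq_square)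
      \<comment> \<open>The bound for blocks needs a power of two; rounding \<open>X\<close> down to
        one loses a factor of at most 2.\<close>
      obtain m :: nat where m: "2 ^ m \<le> X" "X < 2 ^ Suc m"
      proof -
        have "\<exists>m. X < 2 ^ m" by (rule real_arch_pow) simp
        define m where "m = (LEAST m. X < 2 ^ m)"
        have mm: "X < 2 ^ m" unfolding m_def using \<open>\<exists>m. X < 2 ^ m\<close> by (rule LeastI_ex)
        moreover have "m \<noteq> 0" using mm \<open>X \<ge> 2\<close> by (cases m) auto
        moreover have "\<not> X < 2 ^ (m - 1)"
          using \<open>m \<noteq> 0\<close> unfolding m_def by (intro not_less_Least) simp
        ultimately show ?thesis using that[of "m - 1"] by simp
      qed
      have "m \<noteq> 0" using m \<open>X \<ge> 2\<close> by (cases m) auto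
      then obtain k where k: "m = Suc k" by (cases m) auto
      define u0 where "u0 = D * 2 ^ m"
      define h where "h = (1 / sqrt (2 ^ m)) ^ D"
      have T2: "2 * T + 1 \<le> n"
      proof -
        have "e * n \<le> n" using e by (simp add: mult_left_le_one_le)
        then have "16 * real T \<le> real n" using T(1) by simp
        then show ?thesis using T1 by linarith
      qed
      have "bij_avg ?n ?n M (\<lambda>y. sign_prob ([] @ concat []) (0 - y))
          \<le> h + 2 ^ u0 / 2 ^ (DIM('e) * length ([] :: 'e list list) + length ([] :: 'e list)) * (1 - p / 2) ^ T"
      proof (rule bij_avg_sign_prob_le[where N = "n - 2 * T - 1" and ?R0.0 = ?n and ?C0.0 = ?n])
        fix R C and \<phi> :: 'e
        assume RC: "R \<subseteq> ?n" "C \<subseteq> ?n" "card R = card C" "n - 2 * T - 1 < card R" and \<phi>: "\<phi> \<noteq> 0"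
        let ?Z = "nz_minors n (\<lambda>i j. \<phi> \<bullet> M i j)"
        have "card ?Z \<le> card (?Z \<inter> quads R C) + 4 * (2 * T) * n ^ 3"
          using RC by (intro card_restrict_quads) (auto simp: nz_minors_def)
        then have a: "real (card ?Z) \<le> real (card (?Z \<inter> quads R C)) + 8 * T * real n ^ 3"
          unfolding of_nat_le_iff[symmetric, where 'a = real] by simp
        have "8 * T * real n ^ 3 \<le> 8 * (e * n / 16) * real n ^ 3"
          using T by (intro mult_right_mono mult_left_mono) auto
        also have "\<dots> = e / 2 * real n ^ 4" by (simp add: power4_eq_xxxx power3_eq_cube)
        finally have b: "8 * T * real n ^ 3 \<le> e / 2 * real n ^ 4" .
        have "e * real n ^ 4 \<le> \<epsilon> * real n ^ 4" using e by (intro mult_right_mono) auto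
        also have "\<dots> \<le> card ?Z" using nz \<phi> by auto
        finally have "p * real n ^ 4 \<le> card (?Z \<inter> quads R C)" using a b by (simp add: p_def)
        moreover have "real (card (quads R C)) \<le> real n ^ 4"
          using card_quads_le[OF RC(1,2)] unfolding of_nat_le_iff[symmetric, where 'a = real] by simp
        then have "p * card (quads R C) \<le> p * real n ^ 4" using p by (intro mult_left_mono) auto
        moreover have "?Z \<inter> quads R C = {(i, k, j, l) \<in> quads R C. \<phi> \<bullet> minor M i k j l \<noteq> 0}"
          using RC by (auto simp: nz_minors_def minor_inner quads_def)
        ultimately show "p * card (quads R C) \<le> card {(i, k, j, l) \<in> quads R C. \<phi> \<bullet> minor M i k j l \<noteq> 0}"
          by simp
      next
        fix cur and Bs :: "'e list list" and x
        assume "good_blocks cur Bs" "u0 \<le> DIM('e) * length Bs + length cur"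
        then show "sign_prob (cur @ concat Bs) x \<le> h"
          unfolding h_def k D_def by (intro good_blocks_sign_prob) (auto simp: u0_def D_def k)
      qed (use p T2 in \<open>auto simp: good_blocks_def independent_empty h_def\<close>)
      moreover have "(0 - y = (0::'e)) = (y = 0)" for y by auto
      ultimately have main: "bij_avg ?n ?n M (\<lambda>y. of_bool (y = 0)) \<le> h + 2 ^ u0 * (1 - p / 2) ^ T"
        by (simp add: sign_prob_nil)
      have X2: "X / 2 \<le> 2 ^ m" using m by simp
      have cn: "0 < c * n" using c n by simp
      have sq: "1 / sqrt X \<le> 1 / sqrt (X / 2)" using \<open>X \<ge> 2\<close> by (intro divide_left_mono) auto
      have h: "h \<le> (1 / sqrt (X / 2)) ^ D"
        unfolding h_def using X2 \<open>X \<ge> 2\<close> by (intro power_mono divide_left_mono) auto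
      have "(2::real) ^ u0 \<le> exp (real u0)"
      proof -
        have "(2::real) ^ u0 \<le> exp 1 ^ u0" using exp_ge_add_one_self[of 1] by (intro power_mono) auto
        then show ?thesis by (simp add: exp_of_nat_mult[symmetric])
      qed
      also have "real u0 \<le> D * X" using m by (simp add: u0_def mult_left_mono)
      finally have "(2::real) ^ u0 \<le> exp (D * X)" by simp
      moreover have "(1 - p / 2) ^ T \<le> exp (- (2 * (D * X)))"
      proof -
        have "(1 - p / 2) ^ T \<le> exp (- (p / 2)) ^ T"
          using p exp_ge_add_one_self[of "- (p / 2)"] by (intro power_mono) auto
        also have "\<dots> = exp (- (T * (p / 2)))" by (simp add: exp_of_nat_mult[symmetric])
        also have "real T * (p / 2) = 2 * (D * X)" using D by (simp add: X_def)
        finally show ?thesis .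
      qed
      ultimately have "2 ^ u0 * (1 - p / 2) ^ T \<le> exp (D * X) * exp (- (2 * (D * X)))"
        using p by (intro mult_mono) auto
      also have "\<dots> = exp (- X) ^ D" by (simp add: exp_add[symmetric] exp_of_nat_mult[symmetric])
      also have "\<dots> \<le> (1 / sqrt (X / 2)) ^ D"
      proof (intro power_mono)
        have "sqrt X \<le> exp X"
        proof -
          have "sqrt X \<le> sqrt (X\<^sup>2)" using \<open>X \<ge> 2\<close> by (intro real_sqrt_le_mono) (auto simp: power2_eq_square)
          also have "\<dots> = X" using \<open>X \<ge> 2\<close> by simp
          also have "\<dots> \<le> exp X" using exp_ge_add_one_self[of X] by linarith
          finally show ?thesis .
        qed
        then have "exp (- X) \<le> 1 / sqrt X" using \<open>X \<ge> 2\<close> by (simp add: exp_minus field_simps)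
        then show "exp (- X) \<le> 1 / sqrt (X / 2)" using sq by linarith
      qed simp
      finally have "bij_avg ?n ?n M (\<lambda>y. of_bool (y = 0)) \<le> 2 * (1 / sqrt (X / 2)) ^ D"
        using main h by linarith
      also have "\<dots> \<le> 2 * (1 / sqrt (c * n / 2)) ^ D"
        using Xc cn by (intro mult_left_mono power_mono divide_left_mono) auto
      also have "\<dots> = 2 * (1 / sqrt (c / 2)) ^ D / sqrt n ^ D"
      proof -
        have "c * n / 2 = (c / 2) * n" by simp
        then show ?thesis unfolding \<open>c * n / 2 = (c / 2) * n\<close> real_sqrt_mult
          by (simp add: power_divide power_mult_distrib)
      qed
      also have "\<dots> \<le> K / sqrt n ^ D" by (intro divide_right_mono) (auto simp: K_def)
      finally show ?thesis by (simp add: D_def)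
    qed
  qed
qed

section \<open>Anticoncentration of real statistics with few nonzero minors\<close>

text \<open>Probability that one of \<open>t\<close> successively removed random quads lies in \<open>Z\<close>.\<close>

fun hit :: "('a \<times> 'a \<times> 'b \<times> 'b) set \<Rightarrow> nat \<Rightarrow> 'a set \<Rightarrow> 'b set \<Rightarrow> real" where
  "hit Z 0 R C = 0"
| "hit Z (Suc t) R C = (\<Sum>(i, k, j, l)\<in>quads R C.
     if (i, k, j, l) \<in> Z then 1 else hit Z t (R - {i, k}) (C - {j, l})) / real (card (quads R C))"

lemma quads_remove:
  assumes "(i, k, j, l) \<in> quads R C" "finite R" "finite C" "card R = card C"
  shows "card (R - {i, k}) = card R - 2" "card (C - {j, l}) = card R - 2"
  using assms by (auto simp: quads_def card_Diff_subset)

lemma card_quads_pos: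
  assumes "finite R" "finite C" "card R = card C" "card R \<ge> 2"
  shows "0 < real (card (quads R C))"
  using assms by (auto simp: card_quads)

text \<open>Once a removed quadruple has a nonzero minor, its two matchings give different totals,
  and at most one of them can equal \<open>x\<close>: from there on the probability is at most
  1/2.\<close>

lemma bij_avg_hit:
  fixes a :: "'a \<Rightarrow> 'b \<Rightarrow> real"
  assumes "finite R" "finite C" "card R = card C" "2 * t \<le> card R"
    and Z: "\<And>i k j l. (i, k, j, l) \<in> Z \<Longrightarrow> minor a i k j l \<noteq> 0"
  shows "bij_avg R C a (\<lambda>y. of_bool (y = x)) \<le> 1 - hit Z t R C / 2"
  using assms(1-4)
proof (induction t arbitrary: R C x)
  case 0
  then show ?case using bij_avg_le_1 by simp
next
  case (Suc t)
  have r2: "card R \<ge> 2" using Suc.prems by simp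
  let ?N = "real (card (quads R C))"
  have N: "0 < ?N" by (rule card_quads_pos) (use Suc.prems r2 in auto)
  define G where "G y = (of_bool (y = x) :: real)" for y
  define A where "A i k j l = bij_avg (R - {i, k}) (C - {j, l}) a
        (\<lambda>y. (G (a i j + a k l + y) + G (a i l + a k j + y)) / 2)" for i k j l
  define h where "h i k j l = (if (i, k, j, l) \<in> Z then 1 else hit Z t (R - {i, k}) (C - {j, l}))" for i k j l
  have bound: "A i k j l \<le> 1 - h i k j l / 2" if q: "(i, k, j, l) \<in> quads R C" for i k j l
  proof -
    let ?R = "R - {i, k}" and ?C = "C - {j, l}"
    have RC': "finite ?R" "finite ?C" "card ?R = card ?C" "2 * t \<le> card ?R"
      using Suc.prems quads_remove[OF q] by auto
    show ?thesis
    proof (cases "(i, k, j, l) \<in> Z")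
      case True
      then have "a i j + a k l \<noteq> a i l + a k j" using Z[of i k j l] by (simp add: minor_def algebra_simps)
      then have "A i k j l \<le> bij_avg ?R ?C a (\<lambda>_. 1 / 2)"
        unfolding A_def G_def by (intro bij_avg_mono) auto
      then show ?thesis using True RC' by (simp add: h_def bij_avg_const)
    next
      case False
      have le: "bij_avg ?R ?C a (\<lambda>y. G (m + y)) \<le> 1 - hit Z t ?R ?C / 2" for m
      proof -
        have "G (m + y) = of_bool (y = x - m)" for y by (auto simp: G_def)
        then show ?thesis using Suc.IH[OF RC', of "x - m"] by simp
      qed
      have "A i k j l = (bij_avg ?R ?C a (\<lambda>y. G (a i j + a k l + y)) +
          bij_avg ?R ?C a (\<lambda>y. G (a i l + a k j + y))) / 2"
        by (simp add: A_def bij_avg_divide bij_avg_add)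
      then show ?thesis
        using le[of "a i j + a k l"] le[of "a i l + a k j"] False by (simp add: h_def)
    qed
  qed
  have "(\<Sum>(i, k, j, l)\<in>quads R C. A i k j l) \<le> (\<Sum>(i, k, j, l)\<in>quads R C. 1 - h i k j l / 2)"
    by (rule sum_mono) (use bound in auto)
  also have "\<dots> = ?N - (\<Sum>(i, k, j, l)\<in>quads R C. h i k j l) / 2"
    by (simp add: case_prod_unfold sum_subtractf sum_divide_distrib)
  finally have "(\<Sum>(i, k, j, l)\<in>quads R C. A i k j l) / ?N
      \<le> (?N - (\<Sum>(i, k, j, l)\<in>quads R C. h i k j l) / 2) / ?N"
    by (rule divide_right_mono) simp
  also have "\<dots> = 1 - hit Z (Suc t) R C / 2"
    using N by (simp add: h_def diff_divide_distrib)
  also have "(\<Sum>(i, k, j, l)\<in>quads R C. A i k j l) / ?N = bij_avg R C a (\<lambda>y. of_bool (y = x))"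
    using bij_avg_quads_sym[OF Suc.prems(1-3) r2, of a G] by (simp only: A_def G_def[abs_def])
  finally show ?case .
qed

text \<open>Union bound over the \<open>t\<close> removals.\<close>

lemma hit_upper:
  assumes "finite R" "finite C" "card R = card C" "N + 2 * t \<le> card R"
    and q: "0 \<le> q"
    and dense: "\<And>R' C'. \<lbrakk>R' \<subseteq> R; C' \<subseteq> C; card R' = card C'; N < card R'\<rbrakk> \<Longrightarrow>
       real (card (Z \<inter> quads R' C')) \<le> q * real (card (quads R' C'))"
  shows "hit Z t R C \<le> t * q"
  using assms(1-4) dense
proof (induction t arbitrary: R C)
  case (Suc t)
  have r2: "card R \<ge> 2" "N < card R" using Suc.prems by auto
  let ?N = "real (card (quads R C))"
  have N: "0 < ?N" by (rule card_quads_pos) (use Suc.prems r2 in auto)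
  have "(\<Sum>(i, k, j, l)\<in>quads R C. if (i, k, j, l) \<in> Z then 1 else hit Z t (R - {i, k}) (C - {j, l}))
      \<le> (\<Sum>z\<in>quads R C. of_bool (z \<in> Z) + t * q)"
  proof (rule sum_mono)
    fix z assume z: "z \<in> quads R C"
    obtain i k j l where zz: "z = (i, k, j, l)" by (cases z)
    have "hit Z t (R - {i, k}) (C - {j, l}) \<le> t * q"
    proof (rule Suc.IH)
      show "card (R - {i, k}) = card (C - {j, l})" "N + 2 * t \<le> card (R - {i, k})"
        using Suc.prems quads_remove[of i k j l R C] z zz by auto
    qed (use Suc.prems(1,2) in \<open>auto intro!: Suc.prems(5)\<close>)
    then show "(case z of (i, k, j, l) \<Rightarrow> if (i, k, j, l) \<in> Z then 1 else hit Z t (R - {i, k}) (C - {j, l}))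
        \<le> of_bool (z \<in> Z) + t * q" using q by (simp add: zz)
  qed
  also have "\<dots> = real (card (Z \<inter> quads R C)) + t * q * ?N"
    using Suc.prems(1,2) by (simp add: sum.distrib Int_def conj_commute)
  also have "\<dots> \<le> q * ?N + t * q * ?N"
    using Suc.prems(5)[of R C] Suc.prems(3) r2 by simp
  also have "\<dots> = real (Suc t) * q * ?N" by (simp add: algebra_simps)
  finally show ?case using N by (simp add: divide_le_eq)
qed simp

text \<open>Double counting of disjoint pairs of quadruples: the number of quadruples avoiding a
  given one does not depend on it. Hence the density of \<open>Z\<close> among the remaining
  quadruples is preserved on average.\<close>

lemma sum_card_quads_remove:
  assumes "finite R" "finite C" "card R = card C"
  shows "(\<Sum>(i, k, j, l)\<in>quads R C. real (card (Z \<inter> quads (R - {i, k}) (C - {j, l})))) =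
    real (card (Z \<inter> quads R C)) * real (((card R - 2) * (card R - 3))\<^sup>2)"
proof -
  let ?P = "\<lambda>(i, k, j, l) (i', k', j', l'). i' \<noteq> i \<and> i' \<noteq> k \<and> k' \<noteq> i \<and> k' \<noteq> k \<and> j' \<noteq> j \<and> j' \<noteq> l \<and> l' \<noteq> j \<and> l' \<noteq> l"
  have sub: "Z \<inter> quads (R - {i, k}) (C - {j, l}) = {w \<in> Z \<inter> quads R C. ?P (i, k, j, l) w}" for i k j l
    by (auto simp: quads_def)
  have fin: "finite (Z \<inter> quads R C)" using assms by simp
  have "(\<Sum>(i, k, j, l)\<in>quads R C. real (card (Z \<inter> quads (R - {i, k}) (C - {j, l})))) =
      (\<Sum>z\<in>quads R C. \<Sum>w\<in>Z \<inter> quads R C. of_bool (?P z w))"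
    unfolding sub using fin by (intro sum.cong refl) (auto simp: Int_def intro!: arg_cong[where f = card])
  also have "\<dots> = (\<Sum>w\<in>Z \<inter> quads R C. \<Sum>z\<in>quads R C. of_bool (?P z w))" by (rule sum.swap)
  also have "\<dots> = (\<Sum>w\<in>Z \<inter> quads R C. real (((card R - 2) * (card R - 3))\<^sup>2))"
  proof (rule sum.cong)
    fix w assume w: "w \<in> Z \<inter> quads R C"
    obtain i k j l where ww: "w = (i, k, j, l)" by (cases w)
    have "{z \<in> quads R C. ?P z w} = quads (R - {i, k}) (C - {j, l})" by (auto simp: quads_def ww)
    then have "(\<Sum>z\<in>quads R C. of_bool (?P z w)) = real (card (quads (R - {i, k}) (C - {j, l})))"
      using assms by (simp add: Int_def)
    also have "\<dots> = real (((card R - 2) * (card R - 3))\<^sup>2)"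
      using quads_remove[of i k j l R C] w assms by (subst card_quads) (auto simp: ww)
    finally show "(\<Sum>z\<in>quads R C. of_bool (?P z w)) = real (((card R - 2) * (card R - 3))\<^sup>2)" .
  qed simp
  finally show ?thesis by simp
qed

text \<open>Inclusion-exclusion to second order: the expected number of hits is t times the density,
  and pairs of hits account for at most (t q)^2. In the recursion, a hit at the first removal is
  counted again only with the probability of a later hit, which is at most t q.\<close>

lemma hit_lower:
  assumes "finite R" "finite C" "card R = card C" "N + 2 * t \<le> card R"
    and q: "0 \<le> q"
    and dense: "\<And>R' C'. \<lbrakk>R' \<subseteq> R; C' \<subseteq> C; card R' = card C'; N < card R'\<rbrakk> \<Longrightarrow>
       real (card (Z \<inter> quads R' C')) \<le> q * real (card (quads R' C'))"
  shows "t * (card (Z \<inter> quads R C) / card (quads R C)) - (t * q)\<^sup>2 \<le> hit Z t R C"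
  using assms(1-4) dense
proof (induction t arbitrary: R C)
  case (Suc t)
  have r2: "card R \<ge> 2" "N < card R" using Suc.prems by auto
  let ?N = "real (card (quads R C))" and ?z = "real (card (Z \<inter> quads R C))"
  have N: "0 < ?N" by (rule card_quads_pos) (use Suc.prems r2 in auto)
  define B where "B = t * (?z / ?N) - (t * q)\<^sup>2"
  define f where "f i k j l = t * (card (Z \<inter> quads (R - {i, k}) (C - {j, l})) / card (quads (R - {i, k}) (C - {j, l}))) - (t * q)\<^sup>2" for i k j l
  have zN: "?z / ?N \<le> q" using Suc.prems(5)[of R C] Suc.prems(3) r2 N by (simp add: divide_le_eq)
  have fsum: "(\<Sum>(i, k, j, l)\<in>quads R C. f i k j l) = B * ?N"
  proof (cases "t = 0")
    case False
    then have r4: "card R \<ge> 4" using Suc.prems by simp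
    let ?m = "real (((card R - 2) * (card R - 3))\<^sup>2)"
    have m: "?m > 0" using r4 by simp
    have cq: "card (quads (R - {i, k}) (C - {j, l})) = ((card R - 2) * (card R - 3))\<^sup>2"
      if "(i, k, j, l) \<in> quads R C" for i k j l
      using quads_remove[OF that] Suc.prems by (subst card_quads) auto
    have "(\<Sum>(i, k, j, l)\<in>quads R C. f i k j l) =
        (\<Sum>(i, k, j, l)\<in>quads R C. t / ?m * card (Z \<inter> quads (R - {i, k}) (C - {j, l})) - (t * q)\<^sup>2)"
      by (intro sum.cong refl) (clarsimp simp: f_def cq)
    also have "\<dots> = t / ?m * (\<Sum>(i, k, j, l)\<in>quads R C. real (card (Z \<inter> quads (R - {i, k}) (C - {j, l})))) - (t * q)\<^sup>2 * ?N"
      by (simp add: case_prod_unfold sum_subtractf sum_distrib_left)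
    also have "\<dots> = t * ?z - (t * q)\<^sup>2 * ?N"
      unfolding sum_card_quads_remove[OF Suc.prems(1-3)] using m by (simp only: times_divide_eq_left times_divide_eq_right) simp
    finally show ?thesis using N by (simp add: B_def left_diff_distrib)
  qed (simp add: f_def B_def case_prod_unfold)
  have "(\<Sum>(i, k, j, l)\<in>quads R C. f i k j l) + (\<Sum>z\<in>quads R C. of_bool (z \<in> Z) * (1 - t * q))
      \<le> (\<Sum>(i, k, j, l)\<in>quads R C. if (i, k, j, l) \<in> Z then 1 else hit Z t (R - {i, k}) (C - {j, l}))"
    unfolding sum.distrib[symmetric]
  proof (rule sum_mono)
    fix z assume z: "z \<in> quads R C"
    obtain i k j l where zz: "z = (i, k, j, l)" by (cases z)
    have c: "card (R - {i, k}) = card (C - {j, l})" "N + 2 * t \<le> card (R - {i, k})"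
      using Suc.prems quads_remove[of i k j l R C] z zz by auto
    have lo: "f i k j l \<le> hit Z t (R - {i, k}) (C - {j, l})" unfolding f_def
      by (rule Suc.IH) (use c Suc.prems(1,2) in \<open>auto intro!: Suc.prems(5)\<close>)
    have up: "hit Z t (R - {i, k}) (C - {j, l}) \<le> t * q"
      by (rule hit_upper[where N = N]) (use c q Suc.prems(1,2) in \<open>auto intro!: Suc.prems(5)\<close>)
    show "(case z of (i, k, j, l) \<Rightarrow> f i k j l) + of_bool (z \<in> Z) * (1 - t * q) \<le>
        (case z of (i, k, j, l) \<Rightarrow> if (i, k, j, l) \<in> Z then 1 else hit Z t (R - {i, k}) (C - {j, l}))"
      using lo up by (simp add: zz)
  qed
  also have "(\<Sum>z\<in>quads R C. of_bool (z \<in> Z) * (1 - t * q)) = ?z * (1 - t * q)"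
    unfolding sum_distrib_right[symmetric] using Suc.prems(1,2) by (simp add: Int_def conj_commute)
  finally have "(B * ?N + ?z * (1 - t * q)) / ?N \<le> hit Z (Suc t) R C"
    unfolding fsum hit.simps by (rule divide_right_mono) simp
  moreover define r where "r = ?z / ?N"
  moreover have "(B * ?N + ?z * (1 - t * q)) / ?N = B + r - r * (t * q)"
    using N by (simp add: r_def field_simps)
  ultimately have "B + r - r * (t * q) \<le> hit Z (Suc t) R C" by (simp only:)
  moreover have "r * (t * q) \<le> q * (t * q)"
    using zN q unfolding r_def by (intro mult_right_mono) auto
  moreover have "Suc t * r - (Suc t * q)\<^sup>2 \<le> B + r - q * (t * q)"
  proof -
    have "0 \<le> q * q" "0 \<le> q * (q * t)" using q by auto
    then show ?thesis unfolding B_def r_def[symmetric] by (simp add: power2_eq_square algebra_simps)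
  qed
  ultimately show ?case unfolding r_def[symmetric] by linarith
qed simp

text \<open>The density of nonzero minors may tend to 0 here, so the vector bound does not apply,
  but a single hit suffices. At density q about 1/q removals are made, or of order n if that is
  fewer, so a hit has probability of order at least min(1, n q), and n q \<ge> s/n.\<close>

lemma prob_const_le:
  fixes a :: "nat \<Rightarrow> nat \<Rightarrow> real"
  assumes n: "n \<ge> 8" and s: "n\<^sup>2 * s \<le> card (nz_minors n a)"
  shows "bij_avg {..<n} {..<n} a (\<lambda>y. of_bool (y = x)) \<le> 1 - min 1 (s / n) / 2 ^ 18"
proof -
  let ?n = "{..<n}"
  define Z where "Z = nz_minors n a"
  define q where "q = real (card Z) / real n ^ 4"
  have q0: "0 \<le> q" by (simp add: q_def)
  have np: "0 < real n" using n by simp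
  have sq: "s / n \<le> n * q"
  proof -
    have "real n ^ 2 * s \<le> card Z"
      using s unfolding Z_def of_nat_le_iff[symmetric, where 'a = real] by simp
    then have "(real n ^ 2 * s) / real n ^ 3 \<le> card Z / real n ^ 3" by (rule divide_right_mono) simp
    then show ?thesis using np by (simp add: q_def power2_eq_square power3_eq_cube power4_eq_xxxx)
  qed
  have Zq: "Z \<inter> quads ?n ?n = Z" by (auto simp: Z_def nz_minors_def)
  have finZ: "finite Z" unfolding Z_def nz_minors_def by (rule finite_subset[of _ "quads ?n ?n"]) auto
  have Qle: "card (quads ?n ?n) \<le> real n ^ 4"
    using card_quads_le[of ?n n ?n] unfolding of_nat_le_iff[symmetric, where 'a = real] by simp
  have Qpos: "0 < real (card (quads ?n ?n))" using n by (intro card_quads_pos) auto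
  have ratio: "q \<le> card Z / card (quads ?n ?n)"
    unfolding q_def using Qle Qpos np by (intro divide_left_mono mult_pos_pos) auto
  \<comment> \<open>With more than half of the rows and columns left there are at least n^4/64
    quadruples, so the density stays below 64 q.\<close>
  have dense: "real (card (Z \<inter> quads R C)) \<le> (64 * q) * real (card (quads R C))"
    if "R \<subseteq> ?n" "C \<subseteq> ?n" "card R = card C" "n div 2 < card R" for R C
  proof -
    have fin: "finite R" "finite C" using that by (auto intro: finite_subset)
    have 1: "real n / 4 \<le> real (card R) - 1" "real n / 2 \<le> card R" using that(4) n by linarith+
    have "card R \<ge> 1" using that(4) n by linarith
    have "(real n / 4) * (real n / 2) \<le> (real (card R) - 1) * real (card R)"
      using 1 np by (intro mult_mono) auto
    then have "((real n / 4) * (real n / 2))\<^sup>2 \<le> ((real (card R) - 1) * real (card R))\<^sup>2"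
      by (intro power_mono) auto
    also have "\<dots> = card (quads R C)"
      using card_quads[OF fin that(3)] \<open>card R \<ge> 1\<close> by (simp add: of_nat_diff mult.commute)
    finally have "real n ^ 4 \<le> 64 * card (quads R C)" by (simp add: power2_eq_square power4_eq_xxxx)
    then have "q * real n ^ 4 \<le> q * (64 * card (quads R C))" using q0 by (rule mult_left_mono)
    moreover have "q * real n ^ 4 = card Z" using np by (simp add: q_def)
    moreover have "card (Z \<inter> quads R C) \<le> card Z" by (intro card_mono finZ) auto
    ultimately show ?thesis by simp
  qed
  have main: "\<exists>t. 2 * t \<le> n \<and> min 1 (s / n) / 2 ^ 17 \<le> hit Z t ?n ?n"
  proof -
    consider "q = 0" | "q \<noteq> 0" "\<not> 1 \<le> 1 / (2 ^ 13 * q)" | "1 \<le> 1 / (2 ^ 13 * q)" "q \<noteq> 0"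
      by blast
    then show ?thesis
    proof cases
      case 1
      then have "min 1 (s / n) \<le> 0" using sq by simp
      then show ?thesis by (intro exI[of _ 0]) simp
    next
      \<comment> \<open>A dense \<open>Z\<close> is hit by the very first removal with constant
        probability.\<close>
      case 2
      then have "1 / 2 ^ 13 \<le> q" using q0 by (auto simp: field_simps)
      moreover have "hit Z 1 ?n ?n = card Z / card (quads ?n ?n)"
      proof -
        have "(\<Sum>z\<in>quads ?n ?n. if z \<in> Z then 1 else 0 :: real) = card Z"
          using Zq by (simp add: sum.If_cases Int_commute)
        then show ?thesis unfolding One_nat_def hit.simps by (simp add: case_prod_unfold)
      qed
      ultimately have "1 / 2 ^ 13 \<le> hit Z 1 ?n ?n" using ratio by linarith
      moreover have "min 1 (s / n) / 2 ^ 17 \<le> 1 / 2 ^ 13" by (simp add: min_def field_simps)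
      ultimately have "min 1 (s / n) / 2 ^ 17 \<le> hit Z 1 ?n ?n" by linarith
      moreover have "2 * 1 \<le> n" using n by simp
      ultimately show ?thesis by blast
    next
      case True: 3
      then have qpos: "q > 0" using q0 by auto
      \<comment> \<open>The cap n/8 keeps more than half of the rows. The other cap makes (64 t q)^2
        at most t q / 2, so the first-order term of \<open>hit_lower\<close> dominates.\<close>
      define y where "y = min (real n / 8) (1 / (2 ^ 13 * q))"
      have y: "1 \<le> y" using True n by (auto simp: y_def)
      define t where "t = nat \<lfloor>y\<rfloor>"
      have t: "real t \<le> y" "y / 2 \<le> real t" "1 \<le> t"
      proof -
        have "1 \<le> \<lfloor>y\<rfloor>" using y by simp
        moreover from this have "real t = real_of_int \<lfloor>y\<rfloor>" by (simp add: t_def)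
        ultimately show "real t \<le> y" "y / 2 \<le> real t" "1 \<le> t" unfolding t_def by linarith+
      qed
      have t4: "n div 2 + 2 * t \<le> n" using t(1) by (simp add: y_def) linarith
      have "t * (card (Z \<inter> quads ?n ?n) / card (quads ?n ?n)) - (t * (64 * q))\<^sup>2 \<le> hit Z t ?n ?n"
        by (rule hit_lower[where N = "n div 2"]) (use t4 q0 dense in auto)
      moreover have "t * q \<le> t * (card (Z \<inter> quads ?n ?n) / card (quads ?n ?n))"
        unfolding Zq using ratio by (intro mult_left_mono) auto
      moreover have tq: "t * q \<le> 1 / 2 ^ 13"
      proof -
        have "t * q \<le> (1 / (2 ^ 13 * q)) * q" using t(1) q0 by (intro mult_right_mono) (auto simp: y_def)
        then show ?thesis using qpos by simp
      qed
      have "(t * (64 * q))\<^sup>2 = 2 ^ 12 * ((t * q) * (t * q))" by (simp add: power2_eq_square)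
      moreover have "(t * q) * (t * q) \<le> (t * q) * (1 / 2 ^ 13)" using tq q0 by (intro mult_left_mono) auto
      ultimately have "t * q / 2 \<le> hit Z t ?n ?n" by simp
      moreover have "min 1 (s / n) / 2 ^ 16 \<le> t * q"
      proof -
        have "y / 2 * q \<le> t * q" using t(2) q0 by (intro mult_right_mono) auto
        then have "y * q / 2 \<le> t * q" by simp
        moreover have "y * q = min (n * q / 8) (1 / 2 ^ 13)"
          using qpos by (auto simp: y_def min_def field_simps)
        moreover have "min 1 (s / n) / 2 ^ 15 \<le> min (n * q / 8) (1 / 2 ^ 13)"
        proof -
          have "min 1 v / 2 ^ 15 \<le> min (w / 8) (1 / 2 ^ 13)" if "v \<le> w" "0 \<le> w" for v w :: real
            using that by (auto simp: min_def)
          then show ?thesis using sq q0 by simp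
        qed
        moreover have "m / 2 ^ 16 \<le> w" if "u / 2 \<le> w" "u = v" "m / 2 ^ 15 \<le> v" for m u v w :: real
          using that by simp
        ultimately show ?thesis by blast
      qed
      ultimately have "min 1 (s / n) / 2 ^ 17 \<le> hit Z t ?n ?n" by simp
      then show ?thesis using t4 by (intro exI[of _ t]) auto
    qed
  qed
  then obtain t where t: "2 * t \<le> n" "min 1 (s / n) / 2 ^ 17 \<le> hit Z t ?n ?n" by blast
  have "bij_avg ?n ?n a (\<lambda>y. of_bool (y = x)) \<le> 1 - hit Z t ?n ?n / 2"
    by (rule bij_avg_hit) (use t in \<open>auto simp: Z_def nz_minors_def\<close>)
  then show ?thesis using t(2) by simp
qed

section \<open>Uniform permutations as averages over bijections\<close>

lemma finite_sym_group [simp]: "finite (sym_group n)"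
  by (simp add: sym_group_def finite_permutations)

lemma card_sym_group: "card (sym_group n) = fact n"
  by (simp add: sym_group_def card_permutations)

lemma sym_group_nonempty [simp]: "sym_group n \<noteq> {}"
  using permutes_id[of "{..<n}"] unfolding sym_group_def by blast

text \<open>The two encodings differ only off \<open>{..<n}\<close>, where a permutation is the
  identity and a member of \<open>bijs\<close> is \<open>undefined\<close>.\<close>

lemma bij_betw_restrict_sym_group:
  "bij_betw (\<lambda>\<pi>. restrict \<pi> {..<n}) (sym_group n) (bijs {..<n} {..<n})"
proof (rule bij_betw_byWitness[where f' = "\<lambda>f i. if i < n then f i else i"])
  show "\<forall>\<pi>\<in>sym_group n. (\<lambda>i. if i < n then restrict \<pi> {..<n} i else i) = \<pi>"
    by (auto simp: sym_group_def fun_eq_iff permutes_def)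
  show "\<forall>f\<in>bijs {..<n} {..<n}. restrict (\<lambda>i. if i < n then f i else i) {..<n} = f"
    by (auto simp: bijs_def fun_eq_iff PiE_def extensional_def)
  show "(\<lambda>\<pi>. restrict \<pi> {..<n}) ` sym_group n \<subseteq> bijs {..<n} {..<n}"
    using permutes_in_image by (fastforce simp: bijs_def sym_group_def permutes_imp_bij)
  show "(\<lambda>f i. if i < n then f i else i) ` bijs {..<n} {..<n} \<subseteq> sym_group n"
  proof clarify
    fix f assume "f \<in> bijs {..<n} {..<n}"
    then have "bij_betw (\<lambda>i. if i < n then f i else i) {..<n} {..<n}"
      by (subst bij_betw_cong[of _ _ f]) (auto simp: bijs_def)
    then show "(\<lambda>i. if i < n then f i else i) \<in> sym_group n"
      unfolding sym_group_def by (intro CollectI bij_imp_permutes) auto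
  qed
qed

lemma prob_sym_group:
  "measure_pmf.prob (pmf_of_set (sym_group n)) {\<pi>. P (\<Sum>i<n. M i (\<pi> i))} =
     bij_avg {..<n} {..<n} M (\<lambda>y. of_bool (P y))"
proof -
  let ?g = "\<lambda>\<pi>. of_bool (P (\<Sum>i<n. M i (\<pi> i))) :: real"
  have "real (card (sym_group n \<inter> {\<pi>. P (\<Sum>i<n. M i (\<pi> i))})) = (\<Sum>\<pi>\<in>sym_group n. ?g \<pi>)"
    by (simp add: Int_def)
  also have "\<dots> = (\<Sum>\<pi>\<in>sym_group n. ?g (restrict \<pi> {..<n}))"
    by (intro sum.cong refl arg_cong[where f = of_bool] arg_cong[where f = P]) auto
  also have "\<dots> = (\<Sum>f\<in>bijs {..<n} {..<n}. ?g f)"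
    by (rule sum.reindex_bij_betw[OF bij_betw_restrict_sym_group])
  finally show ?thesis
    by (simp add: measure_pmf_of_set bij_avg_def card_sym_group)
qed

section \<open>Permutation matrices as functions\<close>

text \<open>Matrices of every size become functions on pairs of indices, so that a single vector
  space serves for bases, spans and linear extensions.\<close>

definition fscale :: "real \<Rightarrow> ('a \<Rightarrow> real) \<Rightarrow> 'a \<Rightarrow> real" where
  "fscale c f = (\<lambda>x. c * f x)"

interpretation fs: vector_space fscale
  by standard (auto simp: fscale_def fun_eq_iff algebra_simps)

interpretation fsp: vector_space_pair fscale "scaleR :: real \<Rightarrow> 'e \<Rightarrow> 'e::real_vector" ..

definition unit_fun :: "'a \<Rightarrow> 'a \<Rightarrow> real" where
  "unit_fun p = (\<lambda>x. of_bool (x = p))"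

lemma inj_on_unit_fun: "inj_on unit_fun I"
proof (rule inj_onI)
  fix p q :: 'a assume "unit_fun p = unit_fun q"
  then have "unit_fun p p = unit_fun q p" by simp
  then show "p = q" by (auto simp: unit_fun_def)
qed

lemma sum_fun_apply: "(\<Sum>i\<in>A. f i) x = (\<Sum>i\<in>A. f i x)"
  by (induction A rule: infinite_finite_induct) auto

lemma independent_unit_fun:
  assumes "finite I"
  shows "fs.independent (unit_fun ` I)"
proof
  assume "fs.dependent (unit_fun ` I)"
  then obtain u p where p: "p \<in> I" "u (unit_fun p) \<noteq> 0"
    and "(\<Sum>v\<in>unit_fun ` I. fscale (u v) v) = 0"
    using assms by (auto simp: fs.dependent_finite)
  then have "(\<Sum>v\<in>unit_fun ` I. fscale (u v) v) p = 0" by simp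
  then have "(\<Sum>q\<in>I. fscale (u (unit_fun q)) (unit_fun q) p) = 0"
    by (simp add: sum_fun_apply sum.reindex[OF inj_on_unit_fun])
  moreover have "(\<Sum>q\<in>I. fscale (u (unit_fun q)) (unit_fun q) p) = (\<Sum>q\<in>I. if q = p then u (unit_fun p) else 0)"
    by (intro sum.cong) (auto simp: fscale_def unit_fun_def)
  ultimately show False using p assms by simp
qed

definition perm_fun :: "nat \<Rightarrow> (nat \<Rightarrow> nat) \<Rightarrow> nat \<times> nat \<Rightarrow> real" where
  "perm_fun n \<pi> = (\<lambda>(i, j). of_bool (i < n \<and> j = \<pi> i))"

lemma perm_fun_eq_sum: "perm_fun n \<pi> = (\<Sum>i<n. unit_fun (i, \<pi> i))"
proof
  fix x :: "nat \<times> nat"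
  obtain i j where x: "x = (i, j)" by (cases x)
  have "(\<Sum>k<n. of_bool ((i, j) = (k, \<pi> k)) :: real) = (\<Sum>k<n. if k = i then of_bool (j = \<pi> i) else 0)"
    by (intro sum.cong) auto
  then show "perm_fun n \<pi> x = (\<Sum>i<n. unit_fun (i, \<pi> i)) x"
    by (auto simp: x perm_fun_def sum_fun_apply unit_fun_def)
qed

lemma linear_perm_fun:
  assumes "Vector_Spaces.linear fscale scaleR g"
  shows "g (perm_fun n \<pi>) = (\<Sum>i<n. g (unit_fun (i, \<pi> i)))"
proof -
  interpret Vector_Spaces.linear fscale scaleR g by fact
  show ?thesis unfolding perm_fun_eq_sum by (rule sum)
qed

text \<open>A basis of the span of \<Theta> is extended to one of the span of all permutations;
  \<open>G\<close> bounds its size from below, so at least DIM('e) vectors are new. Mapping that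
  many of them onto the standard basis and all other basis vectors to 0 gives a linear map that
  kills \<Theta>, and no nonzero \<phi> annihilates its values at all permutations. \<open>M\<close>
  lists its values at the unit matrices.\<close>

lemma annihilator_exists:
  assumes V: "finite \<Theta>" "\<Theta> \<subseteq> sym_group n"
    and G: "fs.independent G" "G \<subseteq> fs.span (perm_fun n ` sym_group n)"
    and card: "card \<Theta> + DIM('e) \<le> card G"
  obtains M :: "nat \<Rightarrow> nat \<Rightarrow> 'e::euclidean_space"
  where "\<And>\<pi>. perm_fun n \<pi> \<in> fs.span (perm_fun n ` \<Theta>) \<Longrightarrow> (\<Sum>i<n. M i (\<pi> i)) = 0"
    and "\<And>\<phi>. \<phi> \<noteq> 0 \<Longrightarrow> \<exists>\<pi>\<in>sym_group n. \<phi> \<bullet> (\<Sum>i<n. M i (\<pi> i)) \<noteq> 0"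
proof -
  obtain B0 where B0: "B0 \<subseteq> perm_fun n ` \<Theta>" "fs.independent B0" "perm_fun n ` \<Theta> \<subseteq> fs.span B0"
    using fs.maximal_independent_subset .
  have "B0 \<subseteq> perm_fun n ` sym_group n" using B0(1) V by blast
  then obtain B where B: "B0 \<subseteq> B" "B \<subseteq> perm_fun n ` sym_group n" "fs.independent B"
    "perm_fun n ` sym_group n \<subseteq> fs.span B"
    using fs.maximal_independent_subset_extend B0(2) by metis
  have fin: "finite B" using B(2) by (rule finite_subset) simp
  have fin0: "finite B0" using B(1) fin by (rule finite_subset)
  have "G \<subseteq> fs.span B" using G(2) fs.span_minimal[OF B(4) fs.subspace_span] by blast
  then have "card G \<le> card B" using fs.independent_span_bound[OF fin G(1)] by blast
  moreover have "card B0 \<le> card \<Theta>"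
    using card_mono[OF _ B0(1)] card_image_le[OF V(1), of "perm_fun n"] V(1) by force
  moreover have "card (B - B0) = card B - card B0" using fin0 B(1) by (intro card_Diff_subset)
  ultimately have "DIM('e) \<le> card (B - B0)" using card by linarith
  then obtain h where h: "h ` (Basis :: 'e set) \<subseteq> B - B0" "inj_on h (Basis :: 'e set)"
    using card_le_inj[of "Basis :: 'e set" "B - B0"] fin by auto
  define f where "f b = (if b \<in> h ` Basis then inv_into Basis h b else (0::'e))" for b
  obtain g where g: "Vector_Spaces.linear fscale scaleR g" "\<forall>x\<in>B. g x = f x"
    using fsp.linear_independent_extend[OF B(3)] by metis
  interpret g: Vector_Spaces.linear fscale scaleR g by fact
  have g0: "g x = 0" if "x \<in> fs.span (perm_fun n ` \<Theta>)" for x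
  proof (rule g.eq_0_on_span)
    show "x \<in> fs.span B0" using that fs.span_minimal[OF B0(3) fs.subspace_span] by blast
    fix b assume "b \<in> B0"
    then have "b \<in> B" "b \<notin> h ` Basis" using B(1) h(1) by auto
    then show "g b = 0" using g(2) by (simp add: f_def)
  qed
  show ?thesis
  proof
    fix \<pi> assume "perm_fun n \<pi> \<in> fs.span (perm_fun n ` \<Theta>)"
    then show "(\<Sum>i<n. g (unit_fun (i, \<pi> i))) = 0"
      using g0 linear_perm_fun[OF g(1)] by metis
  next
    fix \<phi> :: 'e assume "\<phi> \<noteq> 0"
    then obtain u where u: "u \<in> Basis" "\<phi> \<bullet> u \<noteq> 0" using euclidean_all_zero_iff[of \<phi>] by blast
    then have hu: "h u \<in> B" "h u \<in> h ` Basis" using h(1) by auto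
    then obtain \<pi> where \<pi>: "\<pi> \<in> sym_group n" "h u = perm_fun n \<pi>" using B(2) by blast
    have "g (h u) = u" using g(2) hu u(1) h(2) by (simp add: f_def)
    then show "\<exists>\<pi>\<in>sym_group n. \<phi> \<bullet> (\<Sum>i<n. g (unit_fun (i, \<pi> i))) \<noteq> 0"
      using \<pi> u(2) linear_perm_fun[OF g(1), of n \<pi>] by (intro bexI[of _ \<pi>]) auto
  qed
qed

text \<open>A functional that vanishes at every permutation imposes no condition, hence the second
  premise. The property passes to larger \<Theta>, so genericity established halfway serves all
  later steps.\<close>

definition generic :: "real \<Rightarrow> nat \<Rightarrow> (nat \<Rightarrow> nat) set \<Rightarrow> bool" where
  "generic \<epsilon> n \<Theta> \<longleftrightarrow> (\<forall>a. (\<forall>\<pi>\<in>\<Theta>. (\<Sum>i<n. a i (\<pi> i)) = 0) \<longrightarrow>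
     (\<exists>\<pi>\<in>sym_group n. (\<Sum>i<n. a i (\<pi> i)) \<noteq> 0) \<longrightarrow>
     \<epsilon> * real n ^ 4 \<le> real (card (nz_minors n a)))"

text \<open>Pairing the annihilating map with a nonzero \<phi> gives a functional that vanishes on
  \<Theta>' but not at all permutations, so genericity of \<Theta>' delivers the hypothesis of the
  Littlewood--Offord bound.\<close>

lemma prob_in_span_generic:
  assumes "\<epsilon> > 0"
  shows "\<exists>K. \<forall>n\<ge>1. \<forall>\<Theta> \<Theta>' G. finite \<Theta> \<longrightarrow> \<Theta> \<subseteq> sym_group n \<longrightarrow> \<Theta>' \<subseteq> \<Theta> \<longrightarrow> generic \<epsilon> n \<Theta>' \<longrightarrow>
     fs.independent G \<longrightarrow> G \<subseteq> fs.span (perm_fun n ` sym_group n) \<longrightarrow>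
     card \<Theta> + DIM('e::euclidean_space) \<le> card G \<longrightarrow>
     measure_pmf.prob (pmf_of_set (sym_group n)) {\<pi>. perm_fun n \<pi> \<in> fs.span (perm_fun n ` \<Theta>)}
       \<le> K / sqrt (real n) ^ DIM('e)"
proof -
  obtain K where K: "\<forall>n\<ge>1. \<forall>M :: nat \<Rightarrow> nat \<Rightarrow> 'e.
    (\<forall>\<phi>. \<phi> \<noteq> 0 \<longrightarrow> \<epsilon> * real n ^ 4 \<le> real (card (nz_minors n (\<lambda>i j. \<phi> \<bullet> M i j)))) \<longrightarrow>
    bij_avg {..<n} {..<n} M (\<lambda>y. of_bool (y = 0)) \<le> K / sqrt (real n) ^ DIM('e)"
    using littlewood_offord_bijs[OF assms, where 'e = 'e] by blast
  show ?thesis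
  proof (intro exI[of _ K] allI impI)
    fix n :: nat and \<Theta> \<Theta>' :: "(nat \<Rightarrow> nat) set" and G :: "(nat \<times> nat \<Rightarrow> real) set"
    assume n: "n \<ge> 1" and *: "finite \<Theta>" "\<Theta> \<subseteq> sym_group n"
      and gen: "\<Theta>' \<subseteq> \<Theta>" "generic \<epsilon> n \<Theta>'"
      and **: "fs.independent G" "G \<subseteq> fs.span (perm_fun n ` sym_group n)" "card \<Theta> + DIM('e) \<le> card G"
    obtain M :: "nat \<Rightarrow> nat \<Rightarrow> 'e" where M:
      "\<And>\<pi>. perm_fun n \<pi> \<in> fs.span (perm_fun n ` \<Theta>) \<Longrightarrow> (\<Sum>i<n. M i (\<pi> i)) = 0"
      "\<And>\<phi>. \<phi> \<noteq> 0 \<Longrightarrow> \<exists>\<pi>\<in>sym_group n. \<phi> \<bullet> (\<Sum>i<n. M i (\<pi> i)) \<noteq> 0"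
      using annihilator_exists[OF * **] by blast
    have "\<epsilon> * real n ^ 4 \<le> real (card (nz_minors n (\<lambda>i j. \<phi> \<bullet> M i j)))" if "\<phi> \<noteq> 0" for \<phi>
    proof -
      have "\<forall>\<pi>\<in>\<Theta>'. (\<Sum>i<n. \<phi> \<bullet> M i (\<pi> i)) = 0"
      proof
        fix \<pi> assume "\<pi> \<in> \<Theta>'"
        then have "perm_fun n \<pi> \<in> fs.span (perm_fun n ` \<Theta>)" using gen(1) by (auto intro: fs.span_base)
        then show "(\<Sum>i<n. \<phi> \<bullet> M i (\<pi> i)) = 0" using M(1) by (simp add: inner_sum_right[symmetric])
      qed
      moreover have "\<exists>\<pi>\<in>sym_group n. (\<Sum>i<n. \<phi> \<bullet> M i (\<pi> i)) \<noteq> 0"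
        using M(2)[OF that] by (simp add: inner_sum_right)
      ultimately show ?thesis
        using gen(2)[unfolded generic_def, rule_format, of "\<lambda>i j. \<phi> \<bullet> M i j"] by blast
    qed
    then have "bij_avg {..<n} {..<n} M (\<lambda>y. of_bool (y = 0)) \<le> K / sqrt (real n) ^ DIM('e)"
      using K n by blast
    moreover have "measure_pmf.prob (pmf_of_set (sym_group n)) {\<pi>. perm_fun n \<pi> \<in> fs.span (perm_fun n ` \<Theta>)}
      \<le> measure_pmf.prob (pmf_of_set (sym_group n)) {\<pi>. (\<Sum>i<n. M i (\<pi> i)) = 0}"
      using M(1) by (intro measure_pmf.finite_measure_mono) auto
    ultimately show "measure_pmf.prob (pmf_of_set (sym_group n)) {\<pi>. perm_fun n \<pi> \<in> fs.span (perm_fun n ` \<Theta>)}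
      \<le> K / sqrt (real n) ^ DIM('e)"
      using prob_sym_group[of n "\<lambda>y. y = 0" M] by simp
  qed
qed

section \<open>Small spans: functionals prescribed on half of the positions\<close>

text \<open>Two applications of Cauchy--Schwarz, with \<open>F\<close> read as a bipartite graph.\<close>

lemma card_four_cycles:
  assumes "F \<subseteq> {..<n} \<times> {..<n}"
  shows "card F ^ 4 \<le> n ^ 4 * card {(i, k, j, l). (i, j) \<in> F \<and> (k, l) \<in> F \<and> (i, l) \<in> F \<and> (k, j) \<in> F}"
proof -
  define x where "x i j = (of_bool ((i, j) \<in> F) :: real)" for i j
  let ?S = "{(i, k, j, l). (i, j) \<in> F \<and> (k, l) \<in> F \<and> (i, l) \<in> F \<and> (k, j) \<in> F}"
  have F: "real (card F) = (\<Sum>i<n. \<Sum>j<n. x i j)"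
  proof -
    have "real (card F) = (\<Sum>p\<in>{..<n} \<times> {..<n}. of_bool (p \<in> F))"
    proof -
      have "{..<n} \<times> {..<n} \<inter> {p. p \<in> F} = F" using assms by blast
      then show ?thesis by (simp only: sum_of_bool_eq finite_cartesian_product finite_lessThan)
    qed
    then show ?thesis unfolding sum.cartesian_product x_def by (simp only: case_prod_unfold prod.collapse)
  qed
  \<comment> \<open>The number of common neighbours of columns \<open>j\<close> and
    \<open>l\<close>; Cauchy--Schwarz is applied once to the rows and once to pairs of
    columns.\<close>
  define c where "c j l = (\<Sum>i<n. x i j * x i l)" for j l
  have "(real (card F))\<^sup>2 \<le> (\<Sum>i<n. (\<Sum>j<n. x i j)\<^sup>2) * n"
    unfolding F using sum_squared_le_sum_of_squares[of "\<lambda>i. \<Sum>j<n. x i j" "{..<n}"] by simp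
  also have "(\<Sum>i<n. (\<Sum>j<n. x i j)\<^sup>2) = (\<Sum>i<n. \<Sum>j<n. \<Sum>l<n. x i j * x i l)"
    by (simp add: power2_eq_square sum_product)
  also have "\<dots> = (\<Sum>j<n. \<Sum>i<n. \<Sum>l<n. x i j * x i l)" by (rule sum.swap)
  also have "\<dots> = (\<Sum>j<n. \<Sum>l<n. c j l)"
    unfolding c_def by (intro sum.cong refl sum.swap)
  finally have "((real (card F))\<^sup>2)\<^sup>2 \<le> ((\<Sum>j<n. \<Sum>l<n. c j l) * n)\<^sup>2"
    by (intro power_mono) auto
  also have "\<dots> = (\<Sum>p\<in>{..<n} \<times> {..<n}. c (fst p) (snd p))\<^sup>2 * (real n)\<^sup>2"
    by (simp add: sum.cartesian_product power_mult_distrib case_prod_unfold)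
  also have "\<dots> \<le> ((\<Sum>p\<in>{..<n} \<times> {..<n}. (c (fst p) (snd p))\<^sup>2) * card ({..<n} \<times> {..<n})) * (real n)\<^sup>2"
    by (intro mult_right_mono sum_squared_le_sum_of_squares) auto
  also have "\<dots> = (\<Sum>j<n. \<Sum>l<n. (c j l)\<^sup>2) * real n ^ 4"
    by (simp add: sum.cartesian_product power2_eq_square power4_eq_xxxx case_prod_unfold)
  also have "(\<Sum>j<n. \<Sum>l<n. (c j l)\<^sup>2) = (\<Sum>j<n. \<Sum>l<n. \<Sum>i<n. \<Sum>k<n. x i j * x i l * (x k j * x k l))"
    by (simp add: c_def power2_eq_square sum_product)
  also have "\<dots> = (\<Sum>(j, l, i, k)\<in>{..<n} \<times> {..<n} \<times> {..<n} \<times> {..<n}. x i j * x i l * (x k j * x k l))"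
    by (simp add: sum.cartesian_product)
  also have "\<dots> = (\<Sum>z\<in>{..<n} \<times> {..<n} \<times> {..<n} \<times> {..<n}. of_bool (z \<in> ?S))"
    by (rule sum.reindex_bij_witness[of _ "\<lambda>(i, k, j, l). (j, l, i, k)" "\<lambda>(j, l, i, k). (i, k, j, l)"])
       (auto simp: x_def)
  also have "\<dots> = card ?S"
  proof -
    have "?S \<subseteq> {..<n} \<times> {..<n} \<times> {..<n} \<times> {..<n}" using assms by auto
    then have "{..<n} \<times> {..<n} \<times> {..<n} \<times> {..<n} \<inter> {z. z \<in> ?S} = ?S" by blast
    then show ?thesis by (simp only: sum_of_bool_eq finite_cartesian_product finite_lessThan)
  qed
  finally have "real (card F ^ 4) \<le> real (n ^ 4 * card ?S)"
    by (simp add: power2_eq_square power4_eq_xxxx mult_ac)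
  then show ?thesis unfolding of_nat_le_iff .
qed

text \<open>The inner product with \<phi> is a polynomial in i of degree at most DIM('e), and a
  nonzero polynomial has few roots.\<close>

lemma moment_curve:
  obtains \<gamma> :: "nat \<Rightarrow> 'e::euclidean_space"
  where "\<And>\<phi> c. \<phi> \<noteq> 0 \<Longrightarrow> finite {i. \<phi> \<bullet> \<gamma> i = c} \<and> card {i. \<phi> \<bullet> \<gamma> i = c} \<le> DIM('e)"
proof -
  obtain h where h: "bij_betw h (Basis :: 'e set) {0..<DIM('e)}"
    using ex_bij_betw_finite_nat[of "Basis :: 'e set"] by auto
  \<comment> \<open>Exponents start at 1, so the constant \<open>c\<close> cannot cancel the nonzero
    coefficient that comes from \<phi>.\<close>
  define \<gamma> where "\<gamma> i = (\<Sum>b\<in>Basis. (real i ^ Suc (h b)) *\<^sub>R (b :: 'e))" for i :: nat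
  show ?thesis
  proof (rule that[of \<gamma>])
    fix \<phi> :: 'e and c assume "\<phi> \<noteq> 0"
    then obtain u where u: "u \<in> Basis" "\<phi> \<bullet> u \<noteq> 0" using euclidean_all_zero_iff[of \<phi>] by blast
    define P where "P = (\<Sum>b\<in>Basis. monom (\<phi> \<bullet> b) (Suc (h b))) - [:c:]"
    have "poly P (real i) = \<phi> \<bullet> \<gamma> i - c" for i
      by (simp add: P_def \<gamma>_def poly_sum poly_monom inner_sum_right mult.commute)
    then have sub: "real ` {i. \<phi> \<bullet> \<gamma> i = c} \<subseteq> {x. poly P x = 0}" by auto
    have "coeff P (Suc (h u)) = (\<Sum>b\<in>Basis. if b = u then \<phi> \<bullet> u else 0)"
    proof -
      have "(\<Sum>b\<in>Basis. if Suc (h b) = Suc (h u) then \<phi> \<bullet> b else 0) =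
          (\<Sum>b\<in>Basis. if b = u then \<phi> \<bullet> u else 0)"
        using h u by (intro sum.cong) (auto simp: bij_betw_def dest: inj_onD)
      then show ?thesis unfolding P_def coeff_diff coeff_sum coeff_monom by simp
    qed
    then have P0: "P \<noteq> 0" using u by auto
    have deg: "degree P \<le> DIM('e)"
      unfolding P_def
    proof (intro degree_diff_le degree_sum_le)
      fix b :: 'e assume "b \<in> Basis"
      then have "Suc (h b) \<le> DIM('e)" using bij_betwE[OF h] by fastforce
      then show "degree (monom (\<phi> \<bullet> b) (Suc (h b))) \<le> DIM('e)" by (meson degree_monom_le order_trans)
    qed auto
    have fin: "finite {x. poly P x = 0}" using P0 by (rule poly_roots_finite)
    then have "finite (real ` {i. \<phi> \<bullet> \<gamma> i = c})" using sub by (rule finite_subset[rotated])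
    then have 1: "finite {i. \<phi> \<bullet> \<gamma> i = c}" by (rule finite_imageD) (auto simp: inj_on_def)
    have "card {i. \<phi> \<bullet> \<gamma> i = c} = card (real ` {i. \<phi> \<bullet> \<gamma> i = c})"
      by (subst card_image) (auto simp: inj_on_def)
    also have "\<dots> \<le> card {x. poly P x = 0}" by (rule card_mono[OF fin sub])
    also have "\<dots> \<le> DIM('e)" using card_poly_roots_bound[OF P0] deg by linarith
    finally show "finite {i. \<phi> \<bullet> \<gamma> i = c} \<and> card {i. \<phi> \<bullet> \<gamma> i = c} \<le> DIM('e)" using 1 by blast
  qed
qed

text \<open>With \<open>M i j = j \<gamma>(i)\<close> on \<open>F\<close>, where \<open>\<gamma>\<close> is the moment curve, the minors of four-cycles in \<open>F\<close> are
  \<open>(j - l) (\<gamma> i - \<gamma> k)\<close>, and few of these are orthogonal to a given vector.\<close>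

lemma card_nz_minors_moment:
  fixes M :: "nat \<Rightarrow> nat \<Rightarrow> 'e::euclidean_space"
  assumes \<gamma>: "\<And>\<phi> c. \<phi> \<noteq> 0 \<Longrightarrow> finite {i. \<phi> \<bullet> \<gamma> i = c} \<and> card {i. \<phi> \<bullet> \<gamma> i = c} \<le> DIM('e)"
    and F: "F \<subseteq> {..<n} \<times> {..<n}" "\<And>i j. (i, j) \<in> F \<Longrightarrow> M i j = real j *\<^sub>R \<gamma> i"
    and card: "n\<^sup>2 \<le> 2 * card F" and n: "n \<ge> 32 * (DIM('e) + 1)" and \<phi>: "\<phi> \<noteq> 0"
  shows "1 / 32 * real n ^ 4 \<le> real (card (nz_minors n (\<lambda>i j. \<phi> \<bullet> M i j)))"
proof -
  let ?S = "{(i, k, j, l). (i, j) \<in> F \<and> (k, l) \<in> F \<and> (i, l) \<in> F \<and> (k, j) \<in> F}"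
  let ?N = "nz_minors n (\<lambda>i j. \<phi> \<bullet> M i j)"
  let ?D = "(\<lambda>(i, k, j). (i, k, j, j)) ` ({..<n} \<times> {..<n} \<times> {..<n})"
  let ?E = "SIGMA i:{..<n}. {k. \<phi> \<bullet> \<gamma> k = \<phi> \<bullet> \<gamma> i} \<times> {..<n} \<times> {..<n}"
  have finN: "finite ?N" unfolding nz_minors_def by (rule finite_subset[of _ "quads {..<n} {..<n}"]) auto
  have finE: "finite ?E" using \<gamma>[OF \<phi>] by auto
  have "?S \<subseteq> ?N \<union> (?D \<union> ?E)"
  proof
    fix z assume z: "z \<in> ?S"
    obtain i k j l where zz: "z = (i, k, j, l)" by (cases z)
    have f: "(i, j) \<in> F" "(k, l) \<in> F" "(i, l) \<in> F" "(k, j) \<in> F" using z zz by auto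
    then have m: "i < n" "j < n" "k < n" "l < n" using F(1) by auto
    have "minor (\<lambda>i j. \<phi> \<bullet> M i j) i k j l = (real j - real l) * (\<phi> \<bullet> \<gamma> i - \<phi> \<bullet> \<gamma> k)"
      using f by (simp add: minor_def F(2) algebra_simps)
    moreover have "z \<in> ?D" if "j = l" using that m zz by (auto intro!: image_eqI[of _ _ "(i, k, j)"])
    moreover have "z \<in> ?E" if "\<phi> \<bullet> \<gamma> k = \<phi> \<bullet> \<gamma> i" using that m zz by auto
    ultimately show "z \<in> ?N \<union> (?D \<union> ?E)" using m by (auto simp: zz nz_minors_def quads_def)
  qed
  then have "card ?S \<le> card (?N \<union> (?D \<union> ?E))" by (intro card_mono) (use finN finE in auto)
  also have "\<dots> \<le> card ?N + (card ?D + card ?E)"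
    by (meson card_Un_le add_left_mono order_trans)
  also have "card ?D \<le> n ^ 3"
    by (rule order_trans[OF card_image_le]) (auto simp: power3_eq_cube card_cartesian_product)
  also have "card ?E \<le> DIM('e) * n ^ 3"
  proof -
    have "card ?E = (\<Sum>i<n. card {k. \<phi> \<bullet> \<gamma> k = \<phi> \<bullet> \<gamma> i} * (n * n))"
      using \<gamma>[OF \<phi>] by (subst card_SigmaI) (auto simp: card_cartesian_product)
    also have "\<dots> \<le> (\<Sum>i<n. DIM('e) * (n * n))"
      using \<gamma>[OF \<phi>] by (intro sum_mono mult_right_mono) auto
    finally show ?thesis by (simp add: power3_eq_cube mult_ac)
  qed
  finally have S: "real (card ?S) \<le> card ?N + (1 + real DIM('e)) * real n ^ 3"
    unfolding of_nat_le_iff[symmetric, where 'a = real] by (simp add: algebra_simps)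
  have "(real n ^ 2) ^ 4 \<le> (2 * real (card F)) ^ 4"
    using card unfolding of_nat_le_iff[symmetric, where 'a = real] by (intro power_mono) auto
  also have "\<dots> = 16 * real (card F) ^ 4" by (simp add: power_mult_distrib)
  also have "\<dots> \<le> 16 * (real n ^ 4 * card ?S)"
    using card_four_cycles[OF F(1)] unfolding of_nat_le_iff[symmetric, where 'a = real] by simp
  finally have "real n ^ 4 * real n ^ 4 \<le> real n ^ 4 * (16 * card ?S)"
    by (simp add: power_mult[symmetric] power_add[symmetric])
  moreover have "0 < real n ^ 4" using n by simp
  ultimately have A: "real n ^ 4 \<le> 16 * card ?S" by (rule mult_left_le_imp_le)
  \<comment> \<open>At least n^4/16 four-cycles exist, and at most (1 + DIM('e)) n^3 of them have a
    vanishing minor; the lower bound on n makes the latter at most n^4/32.\<close>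
  have "32 * (real DIM('e) + 1) \<le> n" using n unfolding of_nat_le_iff[symmetric, where 'a = real] by simp
  then have "32 * (real DIM('e) + 1) * real n ^ 3 \<le> n * real n ^ 3" by (rule mult_right_mono) simp
  then have "32 * ((1 + real DIM('e)) * real n ^ 3) \<le> real n ^ 4"
    by (simp add: power4_eq_xxxx power3_eq_cube algebra_simps)
  with A S show ?thesis by linarith
qed

text \<open>By exchange, a basis of the span of \<Theta> is completed by unit matrices at no fewer
  than n^2/2 positions. A linear map that kills \<Theta> may take arbitrary values there, and values
  on the moment curve make it generic without any randomness of \<Theta>.\<close>

lemma prob_in_span_small:
  shows "\<exists>K. \<forall>n \<ge> 32 * (DIM('e) + 1). \<forall>\<Theta>. finite \<Theta> \<longrightarrow> 2 * card \<Theta> \<le> n\<^sup>2 \<longrightarrow>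
     measure_pmf.prob (pmf_of_set (sym_group n)) {\<pi>. perm_fun n \<pi> \<in> fs.span (perm_fun n ` \<Theta>)}
       \<le> K / sqrt (real n) ^ DIM('e::euclidean_space)"
proof -
  obtain K where K: "\<forall>n\<ge>1. \<forall>M :: nat \<Rightarrow> nat \<Rightarrow> 'e.
    (\<forall>\<phi>. \<phi> \<noteq> 0 \<longrightarrow> 1 / 32 * real n ^ 4 \<le> real (card (nz_minors n (\<lambda>i j. \<phi> \<bullet> M i j)))) \<longrightarrow>
    bij_avg {..<n} {..<n} M (\<lambda>y. of_bool (y = 0)) \<le> K / sqrt (real n) ^ DIM('e)"
    using littlewood_offord_bijs[of "1 / 32", where 'e = 'e] by auto
  obtain \<gamma> :: "nat \<Rightarrow> 'e" where
    \<gamma>: "\<And>\<phi> c. \<phi> \<noteq> 0 \<Longrightarrow> finite {i. \<phi> \<bullet> \<gamma> i = c} \<and> card {i. \<phi> \<bullet> \<gamma> i = c} \<le> DIM('e)"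
    using moment_curve by blast
  show ?thesis
  proof (intro exI[of _ K] allI impI)
    fix n and \<Theta> :: "(nat \<Rightarrow> nat) set"
    assume n: "n \<ge> 32 * (DIM('e) + 1)" and \<Theta>: "finite \<Theta>" "2 * card \<Theta> \<le> n\<^sup>2"
    let ?I = "{..<n} \<times> {..<n}"
    obtain B0 where B0: "B0 \<subseteq> perm_fun n ` \<Theta>" "fs.independent B0" "perm_fun n ` \<Theta> \<subseteq> fs.span B0"
      using fs.maximal_independent_subset .
    obtain B where B: "B0 \<subseteq> B" "B \<subseteq> B0 \<union> unit_fun ` ?I" "fs.independent B"
      "B0 \<union> unit_fun ` ?I \<subseteq> fs.span B"
      using fs.maximal_independent_subset_extend[of B0 "B0 \<union> unit_fun ` ?I"] B0(2) by blast
    have finB0: "finite B0" using B0(1) \<Theta>(1) by (blast intro: finite_subset)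
    have finB: "finite B" using B(2) by (rule finite_subset) (use finB0 in auto)
    have inju: "inj_on unit_fun ?I" by (rule inj_on_unit_fun)
    have "unit_fun ` ?I \<subseteq> fs.span B" using B(4) by blast
    with fs.independent_span_bound[OF finB independent_unit_fun[of ?I]]
    have "card (unit_fun ` ?I) \<le> card B" by simp
    then have nB: "n\<^sup>2 \<le> card B" by (simp add: card_image[OF inju] power2_eq_square)
    define F where "F = {p \<in> ?I. unit_fun p \<in> B - B0}"
    have FI: "F \<subseteq> ?I" by (auto simp: F_def)
    then have finF: "finite F" by (rule finite_subset) simp
    have "card B0 \<le> card \<Theta>"
      using card_mono[OF _ B0(1)] card_image_le[OF \<Theta>(1), of "perm_fun n"] \<Theta>(1) by force
    moreover have "B \<subseteq> B0 \<union> unit_fun ` F" using B(2) by (auto simp: F_def)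
    then have "card B \<le> card B0 + card F"
      by (meson card_Un_le card_image_le card_mono finB0 finF finite_UnI finite_imageI add_left_mono order_trans)
    ultimately have F2: "n\<^sup>2 \<le> 2 * card F" using nB \<Theta>(2) by linarith
    define f where "f b = (if b \<in> unit_fun ` F then (\<lambda>(i, j). real j *\<^sub>R \<gamma> i) (inv_into ?I unit_fun b) else 0)" for b
    obtain g where g: "Vector_Spaces.linear fscale scaleR g" "\<forall>x\<in>B. g x = f x"
      using fsp.linear_independent_extend[OF B(3)] by metis
    interpret g: Vector_Spaces.linear fscale scaleR g by fact
    have g0: "g x = 0" if "x \<in> fs.span (perm_fun n ` \<Theta>)" for x
    proof (rule g.eq_0_on_span)
      show "x \<in> fs.span B0" using that fs.span_minimal[OF B0(3) fs.subspace_span] by blast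
      fix b assume "b \<in> B0"
      then show "g b = 0" using g(2) B(1) by (auto simp: f_def F_def)
    qed
    define M where "M i j = g (unit_fun (i, j))" for i j
    have MF: "M i j = real j *\<^sub>R \<gamma> i" if "(i, j) \<in> F" for i j
    proof -
      have "(i, j) \<in> ?I" "unit_fun (i, j) \<in> B" using that by (auto simp: F_def)
      then show ?thesis
        using g(2) that inv_into_f_f[OF inju, of "(i, j)"] by (simp add: M_def f_def)
    qed
    have "\<forall>\<phi>. \<phi> \<noteq> 0 \<longrightarrow> 1 / 32 * real n ^ 4 \<le> real (card (nz_minors n (\<lambda>i j. \<phi> \<bullet> M i j)))"
      using card_nz_minors_moment[OF \<gamma> FI MF F2 n] by blast
    moreover have "1 \<le> n" using n by simp
    ultimately have "bij_avg {..<n} {..<n} M (\<lambda>y. of_bool (y = 0)) \<le> K / sqrt (real n) ^ DIM('e)"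
      using K by blast
    moreover have "measure_pmf.prob (pmf_of_set (sym_group n)) {\<pi>. perm_fun n \<pi> \<in> fs.span (perm_fun n ` \<Theta>)}
      \<le> measure_pmf.prob (pmf_of_set (sym_group n)) {\<pi>. (\<Sum>i<n. M i (\<pi> i)) = 0}"
      using g0 linear_perm_fun[OF g(1), of n] unfolding M_def
      by (intro measure_pmf.finite_measure_mono) (auto, metis)
    ultimately show "measure_pmf.prob (pmf_of_set (sym_group n)) {\<pi>. perm_fun n \<pi> \<in> fs.span (perm_fun n ` \<Theta>)}
      \<le> K / sqrt (real n) ^ DIM('e)"
      using prob_sym_group[of n "\<lambda>y. y = 0" M] by simp
  qed
qed

section \<open>Functionals vanishing on many permutations\<close>

text \<open>Given the coordinates outside \<open>K\<close>, every \<open>W k f\<close> is a fixed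
  set and the coordinates in \<open>K\<close> are still independent; the induction draws one of them
  last. It serves for many permutations against one chosen equation, and for one permutation against
  its predecessors.\<close>

lemma prob_Pi_pmf_le:
  fixes p :: "'b pmf" and W :: "'a \<Rightarrow> ('a \<Rightarrow> 'b) \<Rightarrow> 'b set"
  assumes "finite A" "K \<subseteq> A" "0 \<le> r"
    and dep: "\<And>k f g. k \<in> K \<Longrightarrow> (\<And>i. i \<in> A - K \<Longrightarrow> f i = g i) \<Longrightarrow> W k f = W k g"
    and prob: "\<And>k f. k \<in> K \<Longrightarrow> measure_pmf.prob p (W k f) \<le> r"
  shows "measure_pmf.prob (Pi_pmf A d (\<lambda>_. p)) {f. \<forall>k\<in>K. f k \<in> W k f} \<le> r ^ card K"
proof -
  have "finite K" using assms(1,2) by (rule finite_subset[rotated])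
  then show ?thesis using assms(1,2) dep prob
  proof (induction K arbitrary: A rule: finite_induct)
    case empty
    then show ?case by simp
  next
    case (insert k K)
    define A' where "A' = A - {k}"
    have A: "A = insert k A'" "k \<notin> A'" "finite A'" "K \<subseteq> A'" "A' - K = A - insert k K"
      using insert.hyps insert.prems(1,2) by (auto simp: A'_def)
    let ?E = "{f. \<forall>j\<in>insert k K. f j \<in> W j f}" and ?E' = "{f. \<forall>j\<in>K. f j \<in> W j f}"
    have IH: "measure_pmf.prob (Pi_pmf A' d (\<lambda>_. p)) ?E' \<le> r ^ card K"
    proof (rule insert.IH)
      fix j and f g :: "'a \<Rightarrow> 'b" assume "j \<in> K" and "\<And>i. i \<in> A' - K \<Longrightarrow> f i = g i"
      then show "W j f = W j g" unfolding A(5) using insert.prems(3)[of j f g] by simp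
    next
      fix j f assume "j \<in> K"
      then show "measure_pmf.prob p (W j f) \<le> r" using insert.prems(4)[of j f] by simp
    qed (rule A(3), rule A(4))
    have W: "W j (f(k := y)) = W j f" if "j \<in> insert k K" for j f y
      by (rule insert.prems(3)[OF that]) auto
    have mem: "f(k := y) \<in> ?E \<longleftrightarrow> y \<in> W k f \<and> f \<in> ?E'" for f y
    proof -
      have "(f(k := y)) j \<in> W j (f(k := y)) \<longleftrightarrow> f j \<in> W j f" if "j \<in> K" for j
        using W[of j f y] that insert.hyps(2) by auto
      moreover have "(f(k := y)) k \<in> W k (f(k := y)) \<longleftrightarrow> y \<in> W k f"
        using W[of k f y] by simp
      ultimately show ?thesis by blast
    qed
    have "emeasure (Pi_pmf A d (\<lambda>_. p)) ?E =
        (\<integral>\<^sup>+f. emeasure p {y. f(k := y) \<in> ?E} \<partial>measure_pmf (Pi_pmf A' d (\<lambda>_. p)))"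
    proof -
      have "Pi_pmf A d (\<lambda>_. p) = bind_pmf (Pi_pmf A' d (\<lambda>_. p)) (\<lambda>f. map_pmf (\<lambda>y. f(k := y)) p)"
        unfolding A(1) by (subst Pi_pmf_insert'[OF A(3,2)], subst bind_commute_pmf) (simp add: map_pmf_def)
      then show ?thesis by (simp add: emeasure_bind_pmf emeasure_map_pmf vimage_def)
    qed
    also have "\<dots> \<le> (\<integral>\<^sup>+f. ennreal r * indicator ?E' f \<partial>measure_pmf (Pi_pmf A' d (\<lambda>_. p)))"
    proof (rule nn_integral_mono)
      fix f
      show "emeasure p {y. f(k := y) \<in> ?E} \<le> ennreal r * indicator ?E' f"
      proof (cases "f \<in> ?E'")
        case True
        have "emeasure p {y. f(k := y) \<in> ?E} \<le> emeasure p (W k f)"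
          by (rule emeasure_mono) (use mem in auto)
        also have "\<dots> \<le> ennreal r"
          using insert.prems(4)[of k f] by (simp add: measure_pmf.emeasure_eq_measure ennreal_leI)
        finally show ?thesis using True by simp
      next
        case False
        then have empty: "{y. f(k := y) \<in> ?E} = {}" using mem by blast
        show ?thesis unfolding empty by simp
      qed
    qed
    also have "\<dots> = ennreal r * emeasure (Pi_pmf A' d (\<lambda>_. p)) ?E'"
      by (simp add: nn_integral_cmult)
    also have "\<dots> \<le> ennreal r * ennreal (r ^ card K)"
      using IH by (intro mult_left_mono) (simp_all add: measure_pmf.emeasure_eq_measure ennreal_leI)
    also have "\<dots> = ennreal (r ^ card (insert k K))"
      using insert.hyps assms(3) by (simp add: ennreal_mult[symmetric])
    finally show ?case
      using assms(3) by (simp add: measure_pmf.emeasure_eq_measure)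
  qed
qed

section \<open>Nongeneric functionals and their supports\<close>

text \<open>The second condition turns the size s of the support into anticoncentration, through the
  ratio s/n in \<open>prob_const_le\<close>.\<close>

definition normalized :: "nat \<Rightarrow> (nat \<times> nat) set \<Rightarrow> (nat \<Rightarrow> nat \<Rightarrow> real) \<Rightarrow> bool" where
  "normalized n S b \<longleftrightarrow> (\<forall>i j. b i j \<noteq> 0 \<longleftrightarrow> (i, j) \<in> S) \<and> n\<^sup>2 * card S \<le> card (nz_minors n b)"

text \<open>Subtracting row and column terms makes one row and one column vanish.  Choosing them so that the
  support becomes as small as possible, the density of nonzero minors is at least that of the support.\<close>

lemma not_generic_normalized:
  assumes ng: "\<not> generic \<epsilon> n \<Theta>" and \<Theta>: "\<Theta> \<subseteq> sym_group n" "\<Theta> \<noteq> {}" and n: "n \<ge> 1"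
  obtains S b \<kappa> where "S \<subseteq> {..<n} \<times> {..<n}" "S \<noteq> {}" "real (card S) < \<epsilon> * (real n)\<^sup>2"
    "normalized n S b" "\<forall>\<pi>\<in>\<Theta>. (\<Sum>i<n. b i (\<pi> i)) = \<kappa>"
proof -
  obtain a where a0: "\<And>\<pi>. \<pi> \<in> \<Theta> \<Longrightarrow> (\<Sum>i<n. a i (\<pi> i)) = 0"
    and a1: "\<exists>\<pi>\<in>sym_group n. (\<Sum>i<n. a i (\<pi> i)) \<noteq> 0"
    and nz: "real (card (nz_minors n a)) < \<epsilon> * real n ^ 4"
    using ng unfolding generic_def by (auto simp: not_le)
  let ?I = "{..<n} \<times> {..<n}"
  define T where "T k l = {(i, j) \<in> ?I. minor a i k j l \<noteq> 0}" for k l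
  have finT: "finite (T k l)" for k l unfolding T_def by (rule finite_subset[of _ ?I]) auto
  \<comment> \<open>Quadruples with i = k or j = l have minor 0 and drop out, so the sets
    \<open>T k l\<close> sort the nonzero minors by second row and second column; the smallest set
    is at most the average.\<close>
  have sumT: "(\<Sum>(k, l)\<in>?I. card (T k l)) = card (nz_minors n a)"
  proof -
    have "(\<Sum>(k, l)\<in>?I. card (T k l)) = card (SIGMA p:?I. T (fst p) (snd p))"
      by (subst card_SigmaI) (auto simp: finT case_prod_unfold)
    also have "bij_betw (\<lambda>((k, l), (i, j)). (i, k, j, l)) (SIGMA p:?I. T (fst p) (snd p)) (nz_minors n a)"
      by (rule bij_betw_byWitness[where f' = "\<lambda>(i, k, j, l). ((k, l), (i, j))"])
         (auto simp: T_def nz_minors_def quads_def, auto simp: minor_def)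
    then have "card (SIGMA p:?I. T (fst p) (snd p)) = card (nz_minors n a)" by (rule bij_betw_same_card)
    finally show ?thesis .
  qed
  have "finite ?I" "(0, 0) \<in> ?I" using n by auto
  then obtain p where p: "p \<in> ?I" "\<And>q. q \<in> ?I \<Longrightarrow> card (T (fst p) (snd p)) \<le> card (T (fst q) (snd q))"
    using ex_has_least_nat[of "\<lambda>q. q \<in> ?I" "(0, 0)" "\<lambda>q. card (T (fst q) (snd q))"] by blast
  define k l where "k = fst p" and "l = snd p"
  have kl: "k < n" "l < n" using p(1) by (auto simp: k_def l_def)
  define S where "S = T k l"
  define b where "b i j = (if i < n \<and> j < n then minor a i k j l else 0)" for i j
  \<comment> \<open>A permutation meets every row and every column once, so the subtracted row and
    column terms amount to one constant for all permutations.\<close>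
  define \<kappa> where "\<kappa> = n * a k l - (\<Sum>i<n. a i l) - (\<Sum>j<n. a k j)"
  have fb: "(\<Sum>i<n. b i (\<pi> i)) = (\<Sum>i<n. a i (\<pi> i)) + \<kappa>" if "\<pi> \<in> sym_group n" for \<pi>
  proof -
    have \<pi>: "\<pi> permutes {..<n}" using that by (simp add: sym_group_def)
    have "(\<Sum>i<n. b i (\<pi> i)) = (\<Sum>i<n. minor a i k (\<pi> i) l)"
      using permutes_in_image[OF \<pi>] by (intro sum.cong) (auto simp: b_def)
    also have "\<dots> = (\<Sum>i<n. a i (\<pi> i)) + n * a k l - (\<Sum>i<n. a i l) - (\<Sum>i<n. a k (\<pi> i))"
      by (simp add: minor_def sum.distrib sum_subtractf)
    also have "(\<Sum>i<n. a k (\<pi> i)) = (\<Sum>j<n. a k j)"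
      using sum.permute[OF \<pi>, of "a k"] by (simp add: o_def)
    finally show ?thesis by (simp add: \<kappa>_def)
  qed
  have nzb: "nz_minors n b = nz_minors n a"
  proof -
    have "minor b i k' j l' = minor a i k' j l'" if "(i, k', j, l') \<in> quads {..<n} {..<n}" for i k' j l'
      using that by (simp add: quads_def b_def minor_def)
    then show ?thesis by (auto simp: nz_minors_def)
  qed
  have nS: "n\<^sup>2 * card S \<le> card (nz_minors n a)"
  proof -
    have "(\<Sum>q\<in>?I. card S) \<le> (\<Sum>(k, l)\<in>?I. card (T k l))"
      unfolding S_def k_def l_def case_prod_unfold by (rule sum_mono) (use p(2) in auto)
    then show ?thesis unfolding sumT by (simp add: power2_eq_square)
  qed
  show ?thesis
  proof (rule that[of S b \<kappa>])
    show "S \<subseteq> ?I" by (auto simp: S_def T_def)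
    show "normalized n S b" using nS unfolding normalized_def nzb by (auto simp: b_def S_def T_def)
    show "\<forall>\<pi>\<in>\<Theta>. (\<Sum>i<n. b i (\<pi> i)) = \<kappa>"
      using fb a0 \<Theta>(1) by auto
    have "(real n)\<^sup>2 * real (card S) < \<epsilon> * real n ^ 4"
      using nS nz unfolding of_nat_le_iff[symmetric, where 'a = real] by simp
    also have "\<dots> = (real n)\<^sup>2 * (\<epsilon> * (real n)\<^sup>2)" by (simp add: power2_eq_square power4_eq_xxxx)
    finally show "real (card S) < \<epsilon> * (real n)\<^sup>2" using n by (simp add: mult_less_cancel_left)
    \<comment> \<open>With empty support the original functional would be constant on the
      permutations, hence zero because it vanishes on the nonempty \<Theta>.\<close>
    show "S \<noteq> {}"
    proof
      assume "S = {}"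
      then have "b i j = 0" for i j by (auto simp: b_def S_def T_def)
      then have *: "(\<Sum>i<n. a i (\<pi> i)) = - \<kappa>" if "\<pi> \<in> sym_group n" for \<pi> using fb[OF that] by simp
      obtain \<pi> where "\<pi> \<in> \<Theta>" using \<Theta>(2) by blast
      then have "\<kappa> = 0" using *[of \<pi>] a0[of \<pi>] \<Theta>(1) by auto
      then show False using * a1 by auto
    qed
  qed
qed

text \<open>The permutation matrix restricted to the positions in \<open>S\<close>, with a constant entry added at the
  otherwise unused position \<open>(n, n)\<close>.\<close>

definition restrict_fun :: "nat \<Rightarrow> (nat \<times> nat) set \<Rightarrow> (nat \<Rightarrow> nat) \<Rightarrow> nat \<times> nat \<Rightarrow> real" where
  "restrict_fun n S \<pi> = (\<lambda>p. if p = (n, n) then 1 else of_bool (p \<in> S \<and> snd p = \<pi> (fst p)))"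

text \<open>The vectors \<open>restrict_fun n S (f k)\<close> span a space of dimension at most card
  S + 1, and the equation for \<open>b\<close> and \<kappa> says that a linear form vanishes on
  them. It is enough to test a basis, and the same \<open>T\<close> serves all \<open>b\<close> and
  \<kappa>. Padding \<open>T\<close> to a fixed size keeps the later union bound a plain binomial
  count.\<close>

lemma spanning_indices:
  fixes f :: "nat \<Rightarrow> nat \<Rightarrow> nat" and n m :: nat
  assumes S: "S \<subseteq> {..<n} \<times> {..<n}" and m: "card S + 1 \<le> m"
  obtains T where "T \<subseteq> {..<m}" "card T = card S + 1"
    "\<forall>b \<kappa>. (\<forall>i j. b i j \<noteq> 0 \<longrightarrow> (i, j) \<in> S) \<longrightarrow> (\<forall>t\<in>T. (\<Sum>i<n. b i (f t i)) = \<kappa>) \<longrightarrow>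
       (\<forall>k<m. (\<Sum>i<n. b i (f k i)) = (\<kappa>::real))"
proof -
  let ?y = "\<lambda>k. restrict_fun n S (f k)"
  let ?S' = "insert (n, n) S"
  have finS: "finite S" using S by (rule finite_subset) simp
  obtain B where B: "B \<subseteq> ?y ` {..<m}" "fs.independent B" "?y ` {..<m} \<subseteq> fs.span B"
    using fs.maximal_independent_subset .
  have "?y k \<in> fs.span (unit_fun ` ?S')" for k
  proof -
    have "?y k = (\<Sum>p\<in>?S'. fscale (?y k p) (unit_fun p))"
    proof
      fix x
      have "(\<Sum>p\<in>?S'. fscale (?y k p) (unit_fun p)) x = (\<Sum>p\<in>?S'. if p = x then ?y k x else 0)"
        unfolding sum_fun_apply by (intro sum.cong) (auto simp: fscale_def unit_fun_def)
      also have "\<dots> = ?y k x" using finS by (auto simp: restrict_fun_def)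
      finally show "?y k x = (\<Sum>p\<in>?S'. fscale (?y k p) (unit_fun p)) x" by simp
    qed
    also have "\<dots> \<in> fs.span (unit_fun ` ?S')"
      by (intro fs.span_sum fs.span_scale fs.span_base) auto
    finally show ?thesis .
  qed
  then have "B \<subseteq> fs.span (unit_fun ` ?S')" using B(1) by auto
  then have finB: "finite B" and cB': "card B \<le> card (unit_fun ` ?S')"
    using fs.independent_span_bound[OF _ B(2), of "unit_fun ` ?S'"] finS by auto
  note cB'
  also have "card (unit_fun ` ?S') \<le> card S + 1"
    using card_image_le[of ?S' unit_fun] card_insert_le_m1[of "card S + 1" S "(n, n)"] finS by simp
  finally have cB: "card B \<le> card S + 1" .
  have "\<forall>v\<in>B. \<exists>k. k < m \<and> ?y k = v" using B(1) by auto
  then obtain h where h: "\<forall>v\<in>B. h v < m \<and> ?y (h v) = v" by metis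
  define T0 where "T0 = h ` B"
  have T0: "T0 \<subseteq> {..<m}" "finite T0" "card T0 \<le> card S + 1" "B \<subseteq> ?y ` T0"
    using h finB card_image_le[OF finB, of h] cB by (auto simp: T0_def intro!: image_eqI)
  have "card S + 1 - card T0 \<le> card ({..<m} - T0)" using T0 m by (simp add: card_Diff_subset)
  then obtain T1 where T1: "T1 \<subseteq> {..<m} - T0" "card T1 = card S + 1 - card T0" "finite T1"
    using obtain_subset_with_card_n by metis
  show ?thesis
  proof (rule that[of "T0 \<union> T1"])
    show "T0 \<union> T1 \<subseteq> {..<m}" using T0 T1 by blast
    show "card (T0 \<union> T1) = card S + 1"
      using T0 T1 by (subst card_Un_disjoint) auto
    show "\<forall>b \<kappa>. (\<forall>i j. b i j \<noteq> 0 \<longrightarrow> (i, j) \<in> S) \<longrightarrow> (\<forall>t\<in>T0 \<union> T1. (\<Sum>i<n. b i (f t i)) = \<kappa>) \<longrightarrow>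
       (\<forall>k<m. (\<Sum>i<n. b i (f k i)) = (\<kappa>::real))"
    proof (intro allI impI)
      fix k and b :: "nat \<Rightarrow> nat \<Rightarrow> real" and \<kappa>
      assume k: "k < m" and b: "\<forall>i j. b i j \<noteq> 0 \<longrightarrow> (i, j) \<in> S"
        and T: "\<forall>t\<in>T0 \<union> T1. (\<Sum>i<n. b i (f t i)) = \<kappa>"
      \<comment> \<open>The entry 1 at \<open>(n, n)\<close> carries \<kappa> and makes the affine
        equation linear.\<close>
      define L where "L v = (\<Sum>p\<in>S. b (fst p) (snd p) * v p) - \<kappa> * v (n, n)" for v :: "nat \<times> nat \<Rightarrow> real"
      have Ly: "L (restrict_fun n S \<pi>) = (\<Sum>i<n. b i (\<pi> i)) - \<kappa>" for \<pi>
      proof -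
        have "(\<Sum>p\<in>S. b (fst p) (snd p) * restrict_fun n S \<pi> p) = (\<Sum>p\<in>{p \<in> S. snd p = \<pi> (fst p)}. b (fst p) (snd p))"
          using S finS by (intro sum.mono_neutral_cong_right) (auto simp: restrict_fun_def)
        also have "\<dots> = (\<Sum>i\<in>{i. (i, \<pi> i) \<in> S}. b i (\<pi> i))"
          by (rule sum.reindex_bij_witness[of _ "\<lambda>i. (i, \<pi> i)" fst]) auto
        also have "\<dots> = (\<Sum>i<n. b i (\<pi> i))"
          using S b by (intro sum.mono_neutral_left) auto
        finally show ?thesis by (simp add: L_def restrict_fun_def)
      qed
      have "fs.subspace {v. L v = 0}"
      proof (rule fs.subspaceI)
        show "0 \<in> {v. L v = 0}" by (simp add: L_def)
        fix v w assume vw: "v \<in> {v. L v = 0}"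
        have "L (fscale c v) = c * L v" for c
          by (simp add: L_def fscale_def right_diff_distrib sum_distrib_left mult_ac)
        then show "fscale c v \<in> {v. L v = 0}" for c using vw by simp
        assume "w \<in> {v. L v = 0}"
        moreover have "L (v + w) = L v + L w"
          by (simp add: L_def distrib_left sum.distrib)
        ultimately show "v + w \<in> {v. L v = 0}" using vw by simp
      qed
      moreover have "B \<subseteq> {v. L v = 0}" using T0(4) T by (auto simp: Ly)
      ultimately have "fs.span B \<subseteq> {v. L v = 0}" by (rule fs.span_minimal[rotated])
      then have "L (?y k) = 0" using B(3) k by blast
      then show "(\<Sum>i<n. b i (f k i)) = \<kappa>" by (simp add: Ly)
    qed
  qed
qed

section \<open>Union bound over supports and determining permutations\<close>

text \<open>One term of the expansion of (1 + y)^N is at most the whole sum. The parameter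
  \<open>y\<close> trades the part linear in N against the part linear in s.\<close>

lemma binomial_le_exp:
  assumes "0 < y"
  shows "real (N choose s) \<le> exp (y * N + s * ln (1 / y))"
proof (cases "s \<le> N")
  case True
  have "real (N choose s) * y ^ s = real (N choose s) * y ^ s * 1 ^ (N - s)" by simp
  also have "\<dots> \<le> (\<Sum>k\<le>N. real (N choose k) * y ^ k * 1 ^ (N - k))"
    using True assms by (intro member_le_sum) auto
  also have "\<dots> = (y + 1) ^ N" by (rule binomial_ring[symmetric])
  also have "\<dots> \<le> exp y ^ N"
    using assms exp_ge_add_one_self[of y] by (intro power_mono) (auto simp: add.commute)
  also have "\<dots> = exp (y * N)" by (simp add: exp_of_nat_mult[symmetric] mult.commute)
  finally have "real (N choose s) \<le> exp (y * N) / y ^ s" using assms by (simp add: field_simps)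
  also have "1 / y ^ s = exp (s * ln (1 / y))"
    using assms by (simp add: exp_of_nat_mult power_one_over)
  then have "exp (y * N) / y ^ s = exp (y * N) * exp (s * ln (1 / y))"
    by (metis times_divide_eq_right mult.right_neutral)
  finally show ?thesis by (simp add: exp_add)
qed (simp add: binomial_eq_0)

lemma binomial_le_power: "N choose s \<le> N ^ s"
  by (cases "s \<le> N") (auto simp: binomial_le_pow binomial_eq_0)

text \<open>The union runs over supports \<open>S\<close> of size s and index sets \<open>T\<close>
  of size s + 1. With both fixed, one equation is chosen from the permutations in \<open>T\<close>,
  and each of the other m - (s + 1) permutations satisfies it with probability at most
  \<open>r s\<close>.\<close>

lemma prob_not_generic_sum:
  assumes n: "n \<ge> 8" and A: "finite A" "{..<m} \<subseteq> A" and smax: "real smax \<ge> \<epsilon> * (real n)\<^sup>2" "smax < m"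
    and r: "\<And>s. r s = 1 - min 1 (real s / real n) / 2 ^ 18"
  shows "measure_pmf.prob (Pi_pmf A d (\<lambda>_. pmf_of_set (sym_group n))) {f. \<not> generic \<epsilon> n (f ` {..<m})}
    \<le> (\<Sum>s\<in>{1..smax}. real (n\<^sup>2 choose s) * real (m choose (s + 1)) * r s ^ (m - (s + 1)))"
proof -
  let ?P = "Pi_pmf A d (\<lambda>_. pmf_of_set (sym_group n))"
  let ?I = "{..<n} \<times> {..<n}"
  define J where "J s = {S. S \<subseteq> ?I \<and> card S = s} \<times> {T. T \<subseteq> {..<m} \<and> card T = s + 1}" for s
  define cand where "cand S T f c \<longleftrightarrow> normalized n S (fst c) \<and> (\<forall>t\<in>T. (\<Sum>i<n. fst c i (f t i)) = snd c)"
    for S T and f :: "nat \<Rightarrow> nat \<Rightarrow> nat" and c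
  \<comment> \<open>\<open>Eps\<close> selects a functional from the permutations in
    \<open>T\<close> alone, which makes it independent of the others. Without a candidate the set is
    empty.\<close>
  define W where "W S T f = (if Ex (cand S T f)
     then {\<pi>. (\<Sum>i<n. fst (Eps (cand S T f)) i (\<pi> i)) = snd (Eps (cand S T f))} else {})" for S T f
  define E where "E = (\<lambda>(S, T). {f. \<forall>k\<in>{..<m} - T. f k \<in> W S T f})"
  have r0: "0 \<le> r s" for s
  proof -
    have "min 1 (real s / real n) / 2 ^ 18 \<le> 1" by (simp add: min_def)
    then show ?thesis by (simp add: r)
  qed
  have finJ: "finite (J s)" for s
    unfolding J_def by (intro finite_cartesian_product) (auto intro: finite_subset[of _ "Pow ?I"] finite_subset[of _ "Pow {..<m}"])
  have cardJ: "card (J s) = (n\<^sup>2 choose s) * (m choose (s + 1))" for s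
    unfolding J_def card_cartesian_product by (simp add: n_subsets power2_eq_square)
  have Eb: "measure_pmf.prob ?P (E (S, T)) \<le> r s ^ (m - (s + 1))" if "(S, T) \<in> J s" for S T s
  proof -
    have ST: "S \<subseteq> ?I" "card S = s" "T \<subseteq> {..<m}" "card T = s + 1" using that by (auto simp: J_def)
    have "measure_pmf.prob ?P {f. \<forall>k\<in>{..<m} - T. f k \<in> (\<lambda>k f. W S T f) k f} \<le> r s ^ card ({..<m} - T)"
    proof (rule prob_Pi_pmf_le)
      fix k f g assume "\<And>i. i \<in> A - ({..<m} - T) \<Longrightarrow> f i = (g i :: nat \<Rightarrow> nat)"
      then have "f t = g t" if "t \<in> T" for t using that ST(3) A(2) by blast
      then have "cand S T f = cand S T g" by (auto simp: cand_def fun_eq_iff)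
      then show "W S T f = W S T g" by (simp add: W_def)
    next
      fix f
      show "measure_pmf.prob (pmf_of_set (sym_group n)) (W S T f) \<le> r s"
      proof (cases "Ex (cand S T f)")
        case True
        then have "cand S T f (Eps (cand S T f))" by (metis someI_ex)
        then have nb: "n\<^sup>2 * card S \<le> card (nz_minors n (fst (Eps (cand S T f))))"
          by (simp add: cand_def normalized_def)
        show ?thesis
          using prob_const_le[OF n nb, of "snd (Eps (cand S T f))"] True
          by (simp add: W_def prob_sym_group[of n "\<lambda>y. y = snd (Eps (cand S T f))"] r ST)
      next
        case False then show ?thesis using r0 by (simp add: W_def)
      qed
    qed (use A r0 in auto)
    moreover have "card ({..<m} - T) = m - (s + 1)"
      using ST finite_subset[OF ST(3)] by (simp add: card_Diff_subset)
    ultimately show ?thesis by (simp add: E_def)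
  qed
  have ae: "AE f in ?P. f \<in> (\<Union>s\<in>{1..smax}. \<Union>p\<in>J s. E p) \<or> generic \<epsilon> n (f ` {..<m})"
  proof (rule AE_pmfI)
    fix f assume f: "f \<in> set_pmf ?P"
    show "f \<in> (\<Union>s\<in>{1..smax}. \<Union>p\<in>J s. E p) \<or> generic \<epsilon> n (f ` {..<m})"
    proof (cases "generic \<epsilon> n (f ` {..<m})")
      case False
      have "f k \<in> sym_group n" if "k \<in> A" for k
        using f that A(1) by (auto simp: set_Pi_pmf PiE_dflt_def set_pmf_of_set)
      then have sub: "f ` {..<m} \<subseteq> sym_group n" "f ` {..<m} \<noteq> {}" using A(2) smax by auto
      have n1: "1 \<le> n" using n by simp
      obtain S b \<kappa> where S: "S \<subseteq> ?I" "S \<noteq> {}" "real (card S) < \<epsilon> * (real n)\<^sup>2"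
        "normalized n S b" "\<forall>\<pi>\<in>f ` {..<m}. (\<Sum>i<n. b i (\<pi> i)) = \<kappa>"
        by (rule not_generic_normalized[OF False sub n1])
      have finS: "finite S" using S(1) by (rule finite_subset) simp
      have s: "card S \<in> {1..smax}" using S(2,3) smax(1) finS by (auto simp: Suc_le_eq card_gt_0_iff)
      then have sm: "card S + 1 \<le> m" using smax(2) by auto
      obtain T where T: "T \<subseteq> {..<m}" "card T = card S + 1"
        "\<forall>b \<kappa>. (\<forall>i j. b i j \<noteq> 0 \<longrightarrow> (i, j) \<in> S) \<longrightarrow> (\<forall>t\<in>T. (\<Sum>i<n. b i (f t i)) = \<kappa>) \<longrightarrow>
           (\<forall>k<m. (\<Sum>i<n. b i (f k i)) = (\<kappa>::real))"
        by (rule spanning_indices[where f = f, OF S(1) sm])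
      have "cand S T f (b, \<kappa>)" using S(4,5) T(1) by (auto simp: cand_def)
      then have ex: "Ex (cand S T f)" by blast
      then have "cand S T f (Eps (cand S T f))" by (metis someI_ex)
      \<comment> \<open>The selected functional need not be the witness of nongenericity. As
        \<open>T\<close> decides the equation for every functional supported on \<open>S\<close>,
        the selected one also satisfies it at all indices below m.\<close>
      then have c: "\<forall>i j. fst (Eps (cand S T f)) i j \<noteq> 0 \<longrightarrow> (i, j) \<in> S"
        "\<forall>t\<in>T. (\<Sum>i<n. fst (Eps (cand S T f)) i (f t i)) = snd (Eps (cand S T f))"
        unfolding cand_def normalized_def by blast+
      have "\<forall>k<m. (\<Sum>i<n. fst (Eps (cand S T f)) i (f k i)) = snd (Eps (cand S T f))"
        using T(3) c by blast
      then have "f k \<in> W S T f" if "k < m" for k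
        unfolding W_def if_P[OF ex] using that by blast
      then have "f \<in> E (S, T)" by (simp add: E_def)
      moreover have "(S, T) \<in> J (card S)" using S(1) T(1,2) by (simp add: J_def)
      ultimately show ?thesis using s by blast
    qed simp
  qed
  have "measure_pmf.prob ?P {f. \<not> generic \<epsilon> n (f ` {..<m})} \<le> measure_pmf.prob ?P (\<Union>s\<in>{1..smax}. \<Union>p\<in>J s. E p)"
    by (rule measure_pmf.finite_measure_mono_AE) (use ae in \<open>auto elim!: eventually_mono\<close>)
  also have "\<dots> \<le> (\<Sum>s\<in>{1..smax}. measure_pmf.prob ?P (\<Union>p\<in>J s. E p))"
    by (rule measure_pmf.finite_measure_subadditive_finite) auto
  also have "\<dots> \<le> (\<Sum>s\<in>{1..smax}. \<Sum>p\<in>J s. measure_pmf.prob ?P (E p))"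
    by (intro sum_mono measure_pmf.finite_measure_subadditive_finite finJ) auto
  also have "\<dots> \<le> (\<Sum>s\<in>{1..smax}. \<Sum>p\<in>J s. r s ^ (m - (s + 1)))"
    using Eb by (intro sum_mono) auto
  also have "\<dots> = (\<Sum>s\<in>{1..smax}. real (n\<^sup>2 choose s) * real (m choose (s + 1)) * r s ^ (m - (s + 1)))"
    by (simp add: cardJ)
  finally show ?thesis .
qed

lemma prob_not_generic:
  "\<exists>\<epsilon>>0. \<forall>\<^sub>F n in sequentially. \<forall>m A d. n\<^sup>2 \<le> 8 * m \<longrightarrow> m \<le> n\<^sup>2 \<longrightarrow> finite A \<longrightarrow> {..<m} \<subseteq> A \<longrightarrow>
     measure_pmf.prob (Pi_pmf A d (\<lambda>_. pmf_of_set (sym_group n))) {f. \<not> generic \<epsilon> n (f ` {..<m})}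
       \<le> 1 / real n"
proof -
  \<comment> \<open>The constant of \<open>prob_const_le\<close>. With y = c/128 the two terms y n^2
    from the binomials add up to c n^2/64.\<close>
  define c where "c = (1 / 2 ^ 18 :: real)"
  define y where "y = c / 128"
  define L where "L = ln (1 / y)"
  have c: "0 < c" "c \<le> 1" by (auto simp: c_def)
  have y: "0 < y" "y < 1" using c by (auto simp: y_def)
  have L: "0 < L" unfolding L_def using y by (simp add: ln_gt_zero)
  \<comment> \<open>The bound 1/64 keeps all supports so small that n^2/16 permutations remain for
    testing; the other bound makes the part of the entropy linear in s at most c n^2/64.\<close>
  define \<epsilon> where "\<epsilon> = min (1 / 64) (c / (192 * L))"
  have \<epsilon>: "0 < \<epsilon>" "\<epsilon> \<le> 1 / 64" "3 * \<epsilon> * L \<le> c / 64"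
  proof -
    show "0 < \<epsilon>" using c L by (simp add: \<epsilon>_def)
    show "\<epsilon> \<le> 1 / 64" by (simp add: \<epsilon>_def)
    have "3 * \<epsilon> * L \<le> 3 * (c / (192 * L)) * L" using L by (intro mult_right_mono mult_left_mono) (auto simp: \<epsilon>_def)
    then show "3 * \<epsilon> * L \<le> c / 64" using L by simp
  qed
  have ev: "\<forall>\<^sub>F n in sequentially. ln (real n) / real n < c / 144"
    using filterlim_compose[OF ln_x_over_x_tendsto_0 filterlim_real_sequentially] c
    by (intro order_tendstoD(2)) auto
  have main: "\<forall>\<^sub>F n in sequentially. \<forall>m A d. n\<^sup>2 \<le> 8 * m \<longrightarrow> m \<le> n\<^sup>2 \<longrightarrow> finite A \<longrightarrow> {..<m} \<subseteq> A \<longrightarrow>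
     measure_pmf.prob (Pi_pmf A d (\<lambda>_. pmf_of_set (sym_group n))) {f. \<not> generic \<epsilon> n (f ` {..<m})}
       \<le> 1 / real n"
    using ev eventually_ge_at_top[of 16]
  proof eventually_elim
    case (elim n)
    have np: "real n \<ge> 16" using elim by simp
    have n2: "real n * 16 \<le> (real n)\<^sup>2" using np by (simp add: power2_eq_square)
    have ln: "9 * ln (real n) \<le> c * n / 16" using elim(1) np by (simp add: field_simps)
    have ln0: "0 \<le> ln (real n)" using np by simp
    show ?case
    proof (intro allI impI)
      fix m :: nat and A :: "nat set" and d
      assume m: "n\<^sup>2 \<le> 8 * m" "m \<le> n\<^sup>2" and A: "finite A" "{..<m} \<subseteq> A"
      define smax where "smax = nat \<lceil>\<epsilon> * (real n)\<^sup>2\<rceil>"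
      have en: "0 \<le> \<epsilon> * (real n)\<^sup>2" using \<epsilon> by simp
      have s1: "\<epsilon> * (real n)\<^sup>2 \<le> smax" unfolding smax_def by (simp add: real_nat_ceiling_ge)
      have s2: "real smax \<le> \<epsilon> * (real n)\<^sup>2 + 1" unfolding smax_def using en by linarith
      have e64: "\<epsilon> * (real n)\<^sup>2 \<le> (real n)\<^sup>2 / 64" using mult_right_mono[OF \<epsilon>(2), of "(real n)\<^sup>2"] by simp
      have mr: "(real n)\<^sup>2 \<le> 8 * real m" using m(1) unfolding of_nat_le_iff[symmetric, where 'a = real] by simp
      have s3: "real smax + 2 + (real n)\<^sup>2 / 16 \<le> real m" using s2 e64 mr n2 np by linarith
      have sm: "smax < m"
      proof -
        have "0 \<le> (real n)\<^sup>2 / 16" by simp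
        then have "real smax < real m" using s3 by linarith
        then show ?thesis by simp
      qed
      define r where "r s = 1 - min 1 (real s / real n) / 2 ^ 18" for s
      \<comment> \<open>At most n^2 support sizes occur, so n^(-3) for each gives 1/n in
        total.\<close>
      have summand: "real (n\<^sup>2 choose s) * real (m choose (s + 1)) * r s ^ (m - (s + 1)) \<le> exp (- 3 * ln n)"
        if s: "s \<in> {1..smax}" for s
      proof -
        define w where "w = min 1 (real s / real n)"
        have w: "0 \<le> w" "w \<le> 1" using s by (auto simp: w_def)
        have rw: "r s = 1 - c * w" by (simp add: r_def w_def c_def)
        have cw: "c * w \<le> 1" using mult_mono[of c 1 w 1] c w by simp
        have ms: "(real n)\<^sup>2 / 16 \<le> real (m - (s + 1))" using s s3 sm by (simp add: of_nat_diff)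
        have "r s ^ (m - (s + 1)) \<le> exp (- (c * w)) ^ (m - (s + 1))"
          using cw exp_ge_add_one_self[of "- (c * w)"] unfolding rw by (intro power_mono) auto
        also have "\<dots> = exp (- (c * w * real (m - (s + 1))))"
          by (simp add: exp_of_nat_mult[symmetric] mult.commute)
        also have "\<dots> \<le> exp (- (c * w * ((real n)\<^sup>2 / 16)))"
          using ms c w by (simp add: mult_left_mono)
        finally have R: "r s ^ (m - (s + 1)) \<le> exp (- (c * w * ((real n)\<^sup>2 / 16)))" .
        have R0: "0 \<le> r s ^ (m - (s + 1))" using cw by (simp add: rw)
        show ?thesis
        \<comment> \<open>For s \<le> n the crude count n^(4s+2) \<le> n^(6s) loses against exp(-c s
          n/16). Beyond n the decay saturates at exp(-c n^2/16), and the count has to be measured by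
          entropy.\<close>
        proof (cases "s \<le> n")
          case True
          then have ws: "w = s / n" using np by (simp add: w_def)
          have "(n\<^sup>2 choose s) * (m choose (s + 1)) \<le> (n\<^sup>2) ^ s * (n\<^sup>2) ^ (s + 1)"
          proof (rule mult_le_mono)
            show "m choose (s + 1) \<le> (n\<^sup>2) ^ (s + 1)"
              by (rule order_trans[OF binomial_le_power power_mono[OF m(2)]]) simp
          qed (rule binomial_le_power)
          also have "\<dots> = n ^ (4 * s + 2)" by (simp add: power_mult[symmetric] power_add[symmetric])
          also have "\<dots> \<le> n ^ (6 * s)" using elim s by (intro power_increasing) auto
          finally have "real (n\<^sup>2 choose s) * real (m choose (s + 1)) \<le> real n ^ (6 * s)"
            unfolding of_nat_le_iff[symmetric, where 'a = real] by simp
          also have "\<dots> = exp (6 * s * ln n)"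
          proof -
            have "exp (ln (real n)) ^ (6 * s) = exp (real (6 * s) * ln n)" by (simp only: exp_of_nat_mult)
            then show ?thesis using np by simp
          qed
          finally have "real (n\<^sup>2 choose s) * real (m choose (s + 1)) * r s ^ (m - (s + 1))
              \<le> exp (6 * s * ln n) * exp (- (c * w * ((real n)\<^sup>2 / 16)))"
            using R R0 by (intro mult_mono) auto
          also have "\<dots> = exp (- (s * (c * n / 16 - 6 * ln n)))"
            using np by (simp add: exp_add[symmetric] ws power2_eq_square field_simps)
          also have "\<dots> \<le> exp (- (1 * (3 * ln n)))"
          proof -
            have "1 * (3 * ln (real n)) \<le> s * (c * n / 16 - 6 * ln n)"
              using ln ln0 s by (intro mult_mono) auto
            then show ?thesis by simp
          qed
          finally show ?thesis by simp
        next
          case False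
          then have w1: "w = 1" using np by (simp add: w_def)
          have y2: "0 \<le> y * (real n)\<^sup>2" using y by simp
          have "real (n\<^sup>2 choose s) \<le> exp (y * (real n)\<^sup>2 + s * L)"
            using binomial_le_exp[OF y(1), of "n\<^sup>2" s] by (simp add: L_def)
          moreover have "real (m choose (s + 1)) \<le> exp (y * (real n)\<^sup>2 + (s + 1) * L)"
          proof -
            have "y * real m \<le> y * (real n)\<^sup>2"
              using m(2) y unfolding of_nat_le_iff[symmetric, where 'a = real] by (intro mult_left_mono) auto
            then have "exp (y * real m + real (s + 1) * L) \<le> exp (y * (real n)\<^sup>2 + (s + 1) * L)" by simp
            with binomial_le_exp[OF y(1), of m "s + 1"] show ?thesis unfolding L_def by linarith
          qed
          ultimately have "real (n\<^sup>2 choose s) * real (m choose (s + 1)) * r s ^ (m - (s + 1))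
              \<le> exp (y * (real n)\<^sup>2 + s * L) * exp (y * (real n)\<^sup>2 + (s + 1) * L) * exp (- (c * w * ((real n)\<^sup>2 / 16)))"
            using R R0 by (intro mult_mono) auto
          also have "\<dots> = exp (2 * y * (real n)\<^sup>2 + (2 * s + 1) * L - c * (real n)\<^sup>2 / 16)"
            by (simp add: exp_add[symmetric] w1 algebra_simps)
          also have "\<dots> \<le> exp (- 3 * ln n)"
          proof -
            have "real s > 16" using False np by simp
            then have "real (2 * s + 1) \<le> 3 * (\<epsilon> * (real n)\<^sup>2)" using s s2 by auto
            then have "real (2 * s + 1) * L \<le> 3 * (\<epsilon> * (real n)\<^sup>2) * L" using L by (intro mult_right_mono) auto
            also have "\<dots> = (3 * \<epsilon> * L) * (real n)\<^sup>2" by simp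
            also have "\<dots> \<le> c / 64 * (real n)\<^sup>2" using \<epsilon>(3) by (rule mult_right_mono) simp
            finally have 1: "real (2 * s + 1) * L \<le> c * (real n)\<^sup>2 / 64" by simp
            have 2: "2 * y * (real n)\<^sup>2 = c * (real n)\<^sup>2 / 64" by (simp add: y_def)
            have "c * (real n * 16) \<le> c * (real n)\<^sup>2" using n2 c by (intro mult_left_mono) auto
            then have 3: "3 * ln n \<le> c * (real n)\<^sup>2 / 32" using ln ln0 by linarith
            have "0 \<le> c * (real n)\<^sup>2" using c by simp
            then have "2 * y * (real n)\<^sup>2 + real (2 * s + 1) * L - c * (real n)\<^sup>2 / 16 \<le> - 3 * ln (real n)"
              using 1 2 3 by linarith
            then show ?thesis by (simp only: exp_le_cancel_iff)
          qed
          finally show ?thesis .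
        qed
      qed
      have "measure_pmf.prob (Pi_pmf A d (\<lambda>_. pmf_of_set (sym_group n))) {f. \<not> generic \<epsilon> n (f ` {..<m})}
        \<le> (\<Sum>s\<in>{1..smax}. real (n\<^sup>2 choose s) * real (m choose (s + 1)) * r s ^ (m - (s + 1)))"
        by (rule prob_not_generic_sum) (use elim A s1 sm in \<open>auto simp: r_def\<close>)
      also have "\<dots> \<le> (\<Sum>s\<in>{1..smax}. exp (- 3 * ln n))" by (rule sum_mono) (rule summand)
      also have "\<dots> = smax * exp (- 3 * ln n)" by simp
      also have "\<dots> \<le> (real n)\<^sup>2 * exp (- 3 * ln n)"
        using s3 sm m(2) unfolding of_nat_le_iff[symmetric, where 'a = real]
        by (intro mult_right_mono) auto
      also have "exp (- 3 * ln (real n)) = 1 / real n ^ 3"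
        using np exp_of_nat_mult[of 3 "ln (real n)"] by (simp add: exp_minus field_simps)
      also have "(real n)\<^sup>2 * (1 / real n ^ 3) = 1 / real n" using np by (simp add: power2_eq_square power3_eq_cube)
      finally show "measure_pmf.prob (Pi_pmf A d (\<lambda>_. pmf_of_set (sym_group n))) {f. \<not> generic \<epsilon> n (f ` {..<m})} \<le> 1 / real n" .
    qed
  qed
  then show ?thesis using \<epsilon>(1) by blast
qed

section \<open>The span of the permutation matrices\<close>

text \<open>For size \<open>Suc N\<close>, the standard generators of the matrices with zero row and
  column sums, one for each position off the last row and column.\<close>

definition corner_fun :: "nat \<Rightarrow> nat \<times> nat \<Rightarrow> nat \<times> nat \<Rightarrow> real" where
  "corner_fun N p = unit_fun p + unit_fun (N, N) - unit_fun (fst p, N) - unit_fun (N, snd p)"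

text \<open>Zero line sums determine a matrix from its upper left N by N block: the entries of the
  last row and column are minus the sums along their lines. The cases follow these regions.\<close>

lemma corner_fun_expansion:
  fixes v :: "nat \<times> nat \<Rightarrow> real"
  assumes out: "\<And>i j. N < i \<or> N < j \<Longrightarrow> v (i, j) = 0"
    and rows: "\<And>i. i \<le> N \<Longrightarrow> (\<Sum>j\<le>N. v (i, j)) = 0"
    and cols: "\<And>j. j \<le> N \<Longrightarrow> (\<Sum>i\<le>N. v (i, j)) = 0"
  shows "v = (\<Sum>p\<in>{..<N} \<times> {..<N}. fscale (v p) (corner_fun N p))"
proof
  fix x :: "nat \<times> nat"
  obtain i j where x: "x = (i, j)" by (cases x)
  have lastc: "v (i, N) = - (\<Sum>j<N. v (i, j))" if "i \<le> N" for i
    using rows[OF that] by (simp add: lessThan_Suc_atMost[symmetric] add_eq_0_iff)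
  have lastr: "v (N, j) = - (\<Sum>i<N. v (i, j))" if "j \<le> N" for j
    using cols[OF that] by (simp add: lessThan_Suc_atMost[symmetric] add_eq_0_iff)
  have "(\<Sum>p\<in>{..<N} \<times> {..<N}. fscale (v p) (corner_fun N p)) x =
      (\<Sum>k<N. \<Sum>l<N. v (k, l) * (of_bool (i = k \<and> j = l) + of_bool (i = N \<and> j = N) - of_bool (i = k \<and> j = N) - of_bool (i = N \<and> j = l)))"
    by (simp add: sum_fun_apply sum.cartesian_product case_prod_unfold fscale_def corner_fun_def unit_fun_def x prod_eq_iff)
  also have "\<dots> = v (i, j)"
  proof -
    consider "N < i \<or> N < j" | "i < N" "j < N" | "i < N" "j = N" | "i = N" "j < N" | "i = N" "j = N"
      by linarith
    then show ?thesis
    proof cases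
      case 1
      then show ?thesis using out[of i j] by (auto intro!: sum.neutral)
    next
      case 2
      have "(\<Sum>k<N. \<Sum>l<N. v (k, l) * (of_bool (i = k \<and> j = l) + of_bool (i = N \<and> j = N) - of_bool (i = k \<and> j = N) - of_bool (i = N \<and> j = l))) =
         (\<Sum>k<N. if k = i then (\<Sum>l<N. if l = j then v (k, l) else 0) else 0)"
        using 2 by (intro sum.cong refl) (auto intro!: sum.cong sum.neutral)
      then show ?thesis using 2 by simp
    next
      case 3
      have "(\<Sum>k<N. \<Sum>l<N. v (k, l) * (of_bool (i = k \<and> j = l) + of_bool (i = N \<and> j = N) - of_bool (i = k \<and> j = N) - of_bool (i = N \<and> j = l))) =
         (\<Sum>k<N. if k = i then (\<Sum>l<N. - v (k, l)) else 0)"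
        using 3 by (intro sum.cong refl) (auto intro!: sum.cong sum.neutral)
      then show ?thesis using 3 lastc[of i] by (simp add: sum_negf)
    next
      case 4
      have "(\<Sum>k<N. \<Sum>l<N. v (k, l) * (of_bool (i = k \<and> j = l) + of_bool (i = N \<and> j = N) - of_bool (i = k \<and> j = N) - of_bool (i = N \<and> j = l))) =
         (\<Sum>k<N. \<Sum>l<N. if l = j then - v (k, l) else 0)"
        using 4 by (intro sum.cong refl) auto
      then show ?thesis using 4 lastr[of j] by (simp add: sum_negf)
    next
      case 5
      have "(\<Sum>k<N. \<Sum>l<N. v (k, l) * (of_bool (i = k \<and> j = l) + of_bool (i = N \<and> j = N) - of_bool (i = k \<and> j = N) - of_bool (i = N \<and> j = l))) =
         (\<Sum>k<N. \<Sum>l<N. v (k, l))"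
        using 5 by (intro sum.cong refl) auto
      also have "\<dots> = (\<Sum>k<N. - v (k, N))" using lastc by (intro sum.cong) auto
      also have "\<dots> = v (N, N)" using lastr[of N] by (simp add: sum_negf)
      finally show ?thesis using 5 by simp
    qed
  qed
  finally show "v x = (\<Sum>p\<in>{..<N} \<times> {..<N}. fscale (v p) (corner_fun N p)) x" by (simp add: x)
qed

lemma corner_fun_apply: "fst x < N \<Longrightarrow> snd x < N \<Longrightarrow> corner_fun N p x = of_bool (p = x)"
  by (cases x) (auto simp: corner_fun_def unit_fun_def)

lemma corner_fun_last_row: "snd p < N \<Longrightarrow> fst p < N \<Longrightarrow> (\<Sum>j\<le>N. corner_fun N p (N, j)) = 0"
  by (cases p) (auto simp: corner_fun_def unit_fun_def sum.distrib sum_subtractf)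

lemma perm_fun_row_col:
  assumes "\<pi> \<in> sym_group (Suc N)"
  shows "i \<le> N \<Longrightarrow> (\<Sum>j\<le>N. perm_fun (Suc N) \<pi> (i, j)) = 1"
    and "j \<le> N \<Longrightarrow> (\<Sum>i\<le>N. perm_fun (Suc N) \<pi> (i, j)) = 1"
    and "N < i \<or> N < j \<Longrightarrow> perm_fun (Suc N) \<pi> (i, j) = 0"
proof -
  have \<pi>: "\<pi> permutes {..N}" using assms by (simp add: sym_group_def lessThan_Suc_atMost)
  have in_img: "\<pi> i \<le> N \<longleftrightarrow> i \<le> N" for i using permutes_in_image[OF \<pi>, of i] by simp
  show "(\<Sum>j\<le>N. perm_fun (Suc N) \<pi> (i, j)) = 1" if "i \<le> N"
  proof -
    have "(\<Sum>j\<le>N. perm_fun (Suc N) \<pi> (i, j)) = (\<Sum>j\<le>N. if j = \<pi> i then 1 else 0)"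
      using that by (intro sum.cong) (auto simp: perm_fun_def)
    then show ?thesis using that in_img by simp
  qed
  show "(\<Sum>i\<le>N. perm_fun (Suc N) \<pi> (i, j)) = 1" if "j \<le> N"
  proof -
    have "(\<Sum>i\<le>N. perm_fun (Suc N) \<pi> (i, j)) = (\<Sum>i\<le>N. if \<pi> i = j then 1 else 0)"
      by (intro sum.cong) (auto simp: perm_fun_def)
    also have "\<dots> = (\<Sum>i\<le>N. if i = j then 1 else 0)"
      by (rule sum.permute[OF \<pi>, of "\<lambda>i. if i = j then 1 else 0", symmetric, unfolded o_def])
    finally show ?thesis using that by simp
  qed
  show "perm_fun (Suc N) \<pi> (i, j) = 0" if "N < i \<or> N < j"
    using that in_img[of i] by (auto simp: perm_fun_def)
qed

text \<open>Two permutations that agree off the rows i and N differ by a corner matrix: one sends i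
  to j and fixes N, the other sends i to N and N to j.\<close>

lemma corner_fun_in_span:
  assumes "fst p < N" "snd p < N"
  shows "corner_fun N p \<in> fs.span (perm_fun (Suc N) ` sym_group (Suc N))"
proof -
  obtain i j where p: "p = (i, j)" by (cases p)
  have ij: "i < N" "j < N" using assms by (auto simp: p)
  define \<pi> where "\<pi> = Transposition.transpose i j"
  define \<sigma> where "\<sigma> = \<pi> \<circ> Transposition.transpose i N"
  have \<pi>: "\<pi> permutes {..<Suc N}" unfolding \<pi>_def using ij by (intro permutes_swap_id) auto
  have "Transposition.transpose i N permutes {..<Suc N}" using ij by (intro permutes_swap_id) auto
  then have \<sigma>: "\<sigma> permutes {..<Suc N}" unfolding \<sigma>_def using \<pi> by (rule permutes_compose)
  have v: "\<pi> i = j" "\<pi> N = N" "\<sigma> i = N" "\<sigma> N = j" "\<And>k. k \<noteq> i \<Longrightarrow> k \<noteq> N \<Longrightarrow> \<sigma> k = \<pi> k"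
    using ij by (auto simp: \<sigma>_def \<pi>_def Transposition.transpose_def)
  have "corner_fun N p = perm_fun (Suc N) \<pi> - perm_fun (Suc N) \<sigma>"
  proof
    fix x :: "nat \<times> nat"
    obtain k l where x: "x = (k, l)" by (cases x)
    consider "k = i" | "k = N" | "k \<noteq> i" "k \<noteq> N" by blast
    then show "corner_fun N p x = (perm_fun (Suc N) \<pi> - perm_fun (Suc N) \<sigma>) x"
      by cases (use ij in \<open>auto simp: x p corner_fun_def unit_fun_def perm_fun_def v\<close>)
  qed
  also have "\<dots> \<in> fs.span (perm_fun (Suc N) ` sym_group (Suc N))"
    using \<pi> \<sigma> by (intro fs.span_diff fs.span_base) (auto simp: sym_group_def)
  finally show ?thesis .
qed

text \<open>Two permutation matrices differ by a matrix with zero line sums, so the corner matrices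
  together with the identity span. The identity is independent of them because its last row sums to
  1.\<close>

lemma perm_fun_basis_exists:
  assumes "n \<ge> 1"
  obtains G where "finite G" "fs.independent G" "card G = (n - 1)\<^sup>2 + 1"
    "G \<subseteq> fs.span (perm_fun n ` sym_group n)" "perm_fun n ` sym_group n \<subseteq> fs.span G"
proof -
  obtain N where N: "n = Suc N" using assms by (cases n) auto
  let ?I = "{..<N} \<times> {..<N}"
  let ?E = "corner_fun N ` ?I" and ?J = "perm_fun n id"
  have id: "id \<in> sym_group n" by (simp add: sym_group_def permutes_id)
  have inj: "inj_on (corner_fun N) ?I"
  proof (rule inj_onI)
    fix p q assume "p \<in> ?I" "q \<in> ?I" "corner_fun N p = corner_fun N q"
    then have "corner_fun N p p = corner_fun N q p" "fst p < N" "snd p < N" by auto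
    then show "p = q" by (simp add: corner_fun_apply split: if_splits)
  qed
  have indE: "fs.independent ?E"
  proof
    assume "fs.dependent ?E"
    then obtain u p where p: "p \<in> ?I" "u (corner_fun N p) \<noteq> 0"
      and "(\<Sum>v\<in>?E. fscale (u v) v) = 0"
      by (auto simp: fs.dependent_finite)
    then have "(\<Sum>v\<in>?E. fscale (u v) v) p = 0" by simp
    then have "(\<Sum>q\<in>?I. fscale (u (corner_fun N q)) (corner_fun N q) p) = 0"
      by (simp add: sum_fun_apply sum.reindex[OF inj])
    moreover have "(\<Sum>q\<in>?I. fscale (u (corner_fun N q)) (corner_fun N q) p) = (\<Sum>q\<in>?I. if q = p then u (corner_fun N p) else 0)"
      using p(1) by (intro sum.cong) (auto simp: fscale_def corner_fun_apply)
    ultimately show False using p by simp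
  qed
  have JE: "?J \<notin> fs.span ?E"
  proof
    let ?K = "{v. (\<Sum>j\<le>N. v (N, j)) = (0::real)}"
    have "fs.subspace ?K"
      by (rule fs.subspaceI) (auto simp: fscale_def sum.distrib sum_distrib_left[symmetric])
    moreover have "?E \<subseteq> ?K" using corner_fun_last_row by auto
    ultimately have "fs.span ?E \<subseteq> ?K" by (rule fs.span_minimal[rotated])
    moreover assume "?J \<in> fs.span ?E"
    ultimately show False using perm_fun_row_col(1)[of id N N] id by (auto simp: N)
  qed
  show ?thesis
  proof (rule that[of "insert ?J ?E"])
    show "finite (insert ?J ?E)" by simp
    show "fs.independent (insert ?J ?E)" using indE JE by (simp add: fs.independent_insert)
    have "?J \<notin> ?E" using JE fs.span_base[of ?J ?E] by argo
    then show "card (insert ?J ?E) = (n - 1)\<^sup>2 + 1"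
      by (simp add: card_image[OF inj] N power2_eq_square)
    show "insert ?J ?E \<subseteq> fs.span (perm_fun n ` sym_group n)"
      using id corner_fun_in_span unfolding N by (auto intro: fs.span_base)
    show "perm_fun n ` sym_group n \<subseteq> fs.span (insert ?J ?E)"
    proof clarify
      fix \<pi> assume \<pi>: "\<pi> \<in> sym_group n"
      define v where "v = perm_fun n \<pi> - ?J"
      have "v = (\<Sum>p\<in>?I. fscale (v p) (corner_fun N p))"
        using perm_fun_row_col[of \<pi> N] perm_fun_row_col[of id N] \<pi> id unfolding N
        by (intro corner_fun_expansion) (auto simp: v_def N sum_subtractf)
      also have "\<dots> \<in> fs.span (insert ?J ?E)"
        by (intro fs.span_sum fs.span_scale fs.span_base) auto
      finally have "v + ?J \<in> fs.span (insert ?J ?E)"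
        by (rule fs.span_add) (rule fs.span_base, rule insertI1)
      then show "perm_fun n \<pi> \<in> fs.span (insert ?J ?E)" by (simp add: v_def)
    qed
  qed
qed

section \<open>Exposing the permutations one at a time\<close>

lemma prob_dependent:
  "\<exists>K. \<forall>\<^sub>F n in sequentially. \<forall>d0. measure_pmf.prob (Pi_pmf {..<(n - 1)\<^sup>2 + 1} d0 (\<lambda>_. pmf_of_set (sym_group n)))
      {f. \<exists>k<(n - 1)\<^sup>2 + 1. perm_fun n (f k) \<in> fs.span (perm_fun n ` f ` {..<k})} \<le> K / sqrt (real n)"
proof -
  obtain \<epsilon> where \<epsilon>: "\<epsilon> > 0" and gen: "\<forall>\<^sub>F n in sequentially. \<forall>m A d. n\<^sup>2 \<le> 8 * m \<longrightarrow> m \<le> n\<^sup>2 \<longrightarrow> finite A \<longrightarrow> {..<m} \<subseteq> A \<longrightarrow>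
     measure_pmf.prob (Pi_pmf A d (\<lambda>_. pmf_of_set (sym_group n))) {f. \<not> generic \<epsilon> n (f ` {..<m})}
       \<le> 1 / real n"
    using prob_not_generic by blast
  define Q where "Q n \<Theta> = measure_pmf.prob (pmf_of_set (sym_group n)) {\<pi>. perm_fun n \<pi> \<in> fs.span (perm_fun n ` \<Theta>)}" for n \<Theta>
  obtain K1 where K1: "\<forall>n\<ge>1. \<forall>\<Theta> \<Theta>' G. finite \<Theta> \<longrightarrow> \<Theta> \<subseteq> sym_group n \<longrightarrow> \<Theta>' \<subseteq> \<Theta> \<longrightarrow> generic \<epsilon> n \<Theta>' \<longrightarrow>
     fs.independent G \<longrightarrow> G \<subseteq> fs.span (perm_fun n ` sym_group n) \<longrightarrow>
     card \<Theta> + DIM(real) \<le> card G \<longrightarrow> Q n \<Theta> \<le> K1 / sqrt (real n) ^ DIM(real)"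
    unfolding Q_def using prob_in_span_generic[OF \<epsilon>, where 'e = real] by blast
  obtain K5 where K5: "\<forall>n\<ge>1. \<forall>\<Theta> \<Theta>' G. finite \<Theta> \<longrightarrow> \<Theta> \<subseteq> sym_group n \<longrightarrow> \<Theta>' \<subseteq> \<Theta> \<longrightarrow> generic \<epsilon> n \<Theta>' \<longrightarrow>
     fs.independent G \<longrightarrow> G \<subseteq> fs.span (perm_fun n ` sym_group n) \<longrightarrow>
     card \<Theta> + DIM(real ^ 5) \<le> card G \<longrightarrow> Q n \<Theta> \<le> K5 / sqrt (real n) ^ DIM(real ^ 5)"
    unfolding Q_def using prob_in_span_generic[OF \<epsilon>, where 'e = "real ^ 5"] by blast
  obtain K0 where K0: "\<forall>n \<ge> 32 * (DIM(real ^ 5) + 1). \<forall>\<Theta>. finite \<Theta> \<longrightarrow> 2 * card \<Theta> \<le> n\<^sup>2 \<longrightarrow>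
      Q n \<Theta> \<le> K0 / sqrt (real n) ^ DIM(real ^ 5)"
    unfolding Q_def using prob_in_span_small[where 'e = "real ^ 5"] by blast
  define K where "K = 1 + (\<bar>K0\<bar> + \<bar>K5\<bar>) + 5 * \<bar>K1\<bar>"
  have "\<forall>\<^sub>F n in sequentially. \<forall>d0. measure_pmf.prob (Pi_pmf {..<(n - 1)\<^sup>2 + 1} d0 (\<lambda>_. pmf_of_set (sym_group n)))
      {f. \<exists>k<(n - 1)\<^sup>2 + 1. perm_fun n (f k) \<in> fs.span (perm_fun n ` f ` {..<k})} \<le> K / sqrt (real n)"
    \<comment> \<open>192 = 32 * (5 + 1) is the threshold of the small-span bound in dimension
      five.\<close>
    using gen eventually_ge_at_top[of 192]
  proof eventually_elim
    case (elim n)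
    define d where "d = (n - 1)\<^sup>2 + 1"
    define m where "m = d div 2"
    have n1: "n \<ge> 1" using elim by simp
    obtain N where N: "n = Suc N" "N \<ge> 191" using elim(2) by (cases n) auto
    have dn: "d \<le> n\<^sup>2" and nd: "n\<^sup>2 \<le> 8 * m"
    proof -
      define q where "q = N * N"
      have "191 * N \<le> q" unfolding q_def using N by (intro mult_right_mono) auto
      moreover have "d = q + 1" "n\<^sup>2 = q + 2 * N + 1"
        by (simp_all add: d_def N(1) q_def power2_eq_square)
      ultimately show "d \<le> n\<^sup>2" "n\<^sup>2 \<le> 8 * m" using N(2) unfolding m_def by linarith+
    qed
    obtain G where G: "fs.independent G" "card G = d" "G \<subseteq> fs.span (perm_fun n ` sym_group n)"
      using perm_fun_basis_exists[OF n1] unfolding d_def by metis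
    define R where "R = sqrt (real n)"
    have R: "R > 0" "R ^ 2 = n" using n1 by (auto simp: R_def)
    \<comment> \<open>The second term enters only in the last four steps, where five functionals are
      no longer guaranteed.\<close>
    define b where "b k = (\<bar>K0\<bar> + \<bar>K5\<bar>) / R ^ 5 + (if d < k + 5 then \<bar>K1\<bar> / R else 0)" for k
    have b0: "0 \<le> b k" for k using R by (simp add: b_def)
    have b5: "(\<bar>K0\<bar> + \<bar>K5\<bar>) / R ^ 5 \<le> b k" for k using R by (simp add: b_def)
    \<comment> \<open>An atypical past gives the empty set, so the bound holds for every
      \<open>f\<close>; the loss is charged to \<open>?N\<close> or is a null event. Genericity is
      demanded only from m on, so that \<open>W k f\<close> depends on the permutations before k
      alone.\<close>
    define W where "W k f = (if f ` {..<k} \<subseteq> sym_group n \<and> (m \<le> k \<longrightarrow> generic \<epsilon> n (f ` {..<m}))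
      then {\<pi>. perm_fun n \<pi> \<in> fs.span (perm_fun n ` f ` {..<k})} else {})" for k and f :: "nat \<Rightarrow> nat \<Rightarrow> nat"
    have Wb: "measure_pmf.prob (pmf_of_set (sym_group n)) (W k f) \<le> b k" if "k < d" for k f
    proof (cases "f ` {..<k} \<subseteq> sym_group n \<and> (m \<le> k \<longrightarrow> generic \<epsilon> n (f ` {..<m}))")
      case True
      let ?\<Theta> = "f ` {..<k}"
      have mk: "f ` {..<m} \<subseteq> ?\<Theta>" if "m \<le> k" using that by auto
      have ck: "card ?\<Theta> \<le> k" using card_image_le[of "{..<k}" f] by simp
      have "Q n ?\<Theta> \<le> b k"
      proof -
        consider "k < m" | "m \<le> k" "k + 5 \<le> d" | "m \<le> k" "d < k + 5" by linarith
        then show ?thesis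
        proof cases
          case 1
          then have "2 * card ?\<Theta> \<le> n\<^sup>2" using ck dn unfolding m_def by linarith
          then have "Q n ?\<Theta> \<le> K0 / R ^ 5" using K0 elim(2) unfolding R_def by simp
          also have "\<dots> \<le> (\<bar>K0\<bar> + \<bar>K5\<bar>) / R ^ 5" using R(1) by (intro divide_right_mono) auto
          finally show ?thesis using b5[of k] by linarith
        next
          case 2
          have "card ?\<Theta> + DIM(real ^ 5) \<le> card G" using 2 ck G(2) by simp
          then have "Q n ?\<Theta> \<le> K5 / R ^ 5"
            using K5[rule_format, of n ?\<Theta> "f ` {..<m}" G, OF n1 _ _ mk[OF 2(1)]] 2(1) True G(1,3)
            unfolding R_def by simp
          also have "\<dots> \<le> (\<bar>K0\<bar> + \<bar>K5\<bar>) / R ^ 5" using R(1) by (intro divide_right_mono) auto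
          finally show ?thesis using b5[of k] by linarith
        next
          case 3
          have "card ?\<Theta> + DIM(real) \<le> card G" using that ck G(2) by simp
          then have "Q n ?\<Theta> \<le> K1 / R"
            using K1[rule_format, of n ?\<Theta> "f ` {..<m}" G, OF n1 _ _ mk[OF 3(1)]] 3(1) True G(1,3)
            unfolding R_def by simp
          also have "\<dots> \<le> \<bar>K1\<bar> / R" using R(1) by (intro divide_right_mono) auto
          also have "\<dots> \<le> b k"
          proof -
            have "0 \<le> (\<bar>K0\<bar> + \<bar>K5\<bar>) / R ^ 5" using R(1) by simp
            then show ?thesis using 3(2) by (simp add: b_def)
          qed
          finally show ?thesis .
        qed
      qed
      then show ?thesis using True by (simp add: W_def Q_def)
    next
      case False
      then have "W k f = {}" unfolding W_def by (rule if_not_P)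
      then show ?thesis using b0 by simp
    qed
    show ?case
    proof
      fix d0
      let ?P = "Pi_pmf {..<d} d0 (\<lambda>_. pmf_of_set (sym_group n))"
      let ?E = "\<lambda>k. {f. f k \<in> W k f}" and ?N = "{f. \<not> generic \<epsilon> n (f ` {..<m})}"
      have Eb: "measure_pmf.prob ?P (?E k) \<le> b k" if k: "k < d" for k
      proof -
        have "measure_pmf.prob ?P {f. \<forall>j\<in>{k}. f j \<in> W j f} \<le> b k ^ card {k}"
        proof (rule prob_Pi_pmf_le)
          fix j and f g :: "nat \<Rightarrow> nat \<Rightarrow> nat"
          assume j: "j \<in> {k}" and "\<And>i. i \<in> {..<d} - {k} \<Longrightarrow> f i = g i"
          then have eq: "f i = g i" if "i < k" for i using that k by auto
          then have "f ` {..<k} = g ` {..<k}" by (intro image_cong) auto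
          moreover have "m \<le> k \<longrightarrow> f ` {..<m} = g ` {..<m}" using eq by (auto intro!: image_cong)
          ultimately have "W k f = W k g" unfolding W_def by (cases "m \<le> k") (simp_all only: simp_thms)
          then show "W j f = W j g" using j by simp
        qed (use Wb k b0 in auto)
        then show ?thesis by simp
      qed
      have ae: "AE f in ?P. (\<exists>k<d. perm_fun n (f k) \<in> fs.span (perm_fun n ` f ` {..<k})) \<longrightarrow> f \<in> ?N \<union> (\<Union>k\<in>{..<d}. ?E k)"
      proof (rule AE_pmfI, intro impI)
        fix f assume "f \<in> set_pmf ?P" and "\<exists>k<d. perm_fun n (f k) \<in> fs.span (perm_fun n ` f ` {..<k})"
        then obtain k where k: "k < d" "perm_fun n (f k) \<in> fs.span (perm_fun n ` f ` {..<k})" by blast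
        have "f i \<in> sym_group n" if "i < d" for i
          using \<open>f \<in> set_pmf ?P\<close> that by (auto simp: set_Pi_pmf PiE_dflt_def set_pmf_of_set)
        then have "f ` {..<k} \<subseteq> sym_group n" using k(1) by auto
        then have "f k \<in> W k f" if "generic \<epsilon> n (f ` {..<m})"
          unfolding W_def using k(2) that by simp
        then show "f \<in> ?N \<union> (\<Union>k\<in>{..<d}. ?E k)" using k(1) by blast
      qed
      have "measure_pmf.prob ?P {f. \<exists>k<d. perm_fun n (f k) \<in> fs.span (perm_fun n ` f ` {..<k})}
          \<le> measure_pmf.prob ?P (?N \<union> (\<Union>k\<in>{..<d}. ?E k))"
        by (rule measure_pmf.finite_measure_mono_AE) (use ae in \<open>auto elim!: eventually_mono\<close>)
      also have "\<dots> \<le> measure_pmf.prob ?P ?N + measure_pmf.prob ?P (\<Union>k\<in>{..<d}. ?E k)"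
        by (rule measure_Un_le) auto
      also have "measure_pmf.prob ?P (\<Union>k\<in>{..<d}. ?E k) \<le> (\<Sum>k<d. measure_pmf.prob ?P (?E k))"
        by (rule measure_pmf.finite_measure_subadditive_finite) auto
      also have "\<dots> \<le> (\<Sum>k<d. b k)" by (rule sum_mono) (use Eb in auto)
      also have "\<dots> \<le> (\<bar>K0\<bar> + \<bar>K5\<bar>) / R + 5 * \<bar>K1\<bar> / R"
      proof -
        have "(\<Sum>k<d. b k) = d * ((\<bar>K0\<bar> + \<bar>K5\<bar>) / R ^ 5) + (\<Sum>k\<in>{k. k < d \<and> d < k + 5}. \<bar>K1\<bar> / R)"
          by (simp add: b_def sum.distrib sum.If_cases Int_def)
        also have "real d * ((\<bar>K0\<bar> + \<bar>K5\<bar>) / R ^ 5) \<le> R ^ 4 * ((\<bar>K0\<bar> + \<bar>K5\<bar>) / R ^ 5)"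
        proof -
          have "real d \<le> (real n)\<^sup>2" using dn unfolding of_nat_le_iff[symmetric, where 'a = real] by simp
          also have "\<dots> = R ^ 4" using R(2)[symmetric] by (simp add: power_mult[symmetric])
          finally show ?thesis using R by (intro mult_right_mono) auto
        qed
        also have "R ^ 4 * ((\<bar>K0\<bar> + \<bar>K5\<bar>) / R ^ 5) = (\<bar>K0\<bar> + \<bar>K5\<bar>) / R"
        proof -
          have "R ^ 5 = R ^ 4 * R" by (simp add: eval_nat_numeral)
          then show ?thesis using R(1) by simp
        qed
        also have "(\<Sum>k\<in>{k. k < d \<and> d < k + 5}. \<bar>K1\<bar> / R) \<le> 5 * (\<bar>K1\<bar> / R)"
        proof -
          have "{k. k < d \<and> d < k + 5} \<subseteq> {d - 5..<d}" by auto
          then have "card {k. k < d \<and> d < k + 5} \<le> card {d - 5..<d}" by (intro card_mono) auto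
          also have "\<dots> \<le> 5" by simp
          finally have "real (card {k. k < d \<and> d < k + 5}) \<le> 5" by linarith
          then have "real (card {k. k < d \<and> d < k + 5}) * (\<bar>K1\<bar> / R) \<le> 5 * (\<bar>K1\<bar> / R)"
            using R by (intro mult_right_mono) auto
          then show ?thesis by simp
        qed
        finally show ?thesis by simp
      qed
      also have "measure_pmf.prob ?P ?N \<le> 1 / real n"
      proof -
        have "m \<le> d" by (simp add: m_def)
        then show ?thesis
          using dn by (intro elim(1)[rule_format, OF nd]) auto
      qed
      also have "1 / real n \<le> 1 / R"
      proof -
        have "R \<ge> 1" using n1 by (simp add: R_def)
        then have "R * 1 \<le> R * R" by (intro mult_left_mono) auto
        then have "R \<le> real n" using R(2) by (simp add: power2_eq_square)
        then show ?thesis using R by (intro divide_left_mono) auto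
      qed
      finally show "measure_pmf.prob (Pi_pmf {..<(n - 1)\<^sup>2 + 1} d0 (\<lambda>_. pmf_of_set (sym_group n)))
          {f. \<exists>k<(n - 1)\<^sup>2 + 1. perm_fun n (f k) \<in> fs.span (perm_fun n ` f ` {..<k})} \<le> K / sqrt (real n)"
        unfolding d_def[symmetric] R_def[symmetric] K_def by (simp add: add_divide_distrib algebra_simps)
    qed
  qed
  then show ?thesis by blast
qed

section \<open>Linear dependence of matrices\<close>

text \<open>Carries matrices into the function space used so far; padding by 0 lets one function
  type serve all sizes.\<close>

definition mat_fun :: "nat \<Rightarrow> real mat \<Rightarrow> nat \<times> nat \<Rightarrow> real" where
  "mat_fun n A = (\<lambda>(i, j). if i < n \<and> j < n then A $$ (i, j) else 0)"

lemma perm_mat_carrier [simp]: "perm_mat n \<pi> \<in> carrier_mat n n"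
  by (simp add: perm_mat_def)

lemma mat_fun_perm_mat: "\<pi> \<in> sym_group n \<Longrightarrow> mat_fun n (perm_mat n \<pi>) = perm_fun n \<pi>"
  using permutes_in_image[of \<pi> "{..<n}"]
  by (auto simp: mat_fun_def perm_mat_def perm_fun_def sym_group_def fun_eq_iff)

lemma inj_on_mat_fun: "inj_on (mat_fun n) (carrier_mat n n)"
proof (rule inj_onI)
  fix A B assume *: "A \<in> carrier_mat n n" "B \<in> carrier_mat n n" "mat_fun n A = mat_fun n B"
  show "A = B"
  proof (rule eq_matI)
    fix i j assume "i < dim_row B" "j < dim_col B"
    moreover have "mat_fun n A (i, j) = mat_fun n B (i, j)" using *(3) by simp
    ultimately show "A $$ (i, j) = B $$ (i, j)" using *(2) by (simp add: mat_fun_def)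
  qed (use * in auto)
qed

lemma inj_on_perm_fun: "inj_on (perm_fun n) (sym_group n)"
proof (rule inj_onI)
  fix \<pi> \<sigma> assume *: "\<pi> \<in> sym_group n" "\<sigma> \<in> sym_group n" "perm_fun n \<pi> = perm_fun n \<sigma>"
  have "\<pi> i = \<sigma> i" for i
  proof (cases "i < n")
    case True
    have "perm_fun n \<pi> (i, \<pi> i) = perm_fun n \<sigma> (i, \<pi> i)" using *(3) by simp
    then show ?thesis using True by (simp add: perm_fun_def split: if_splits)
  next
    case False
    then show ?thesis using * by (simp add: sym_group_def permutes_not_in)
  qed
  then show "\<pi> = \<sigma>" by blast
qed

lemma inj_on_perm_mat: "inj_on (perm_mat n) (sym_group n)"
proof (rule inj_onI)
  fix \<pi> \<sigma> assume *: "\<pi> \<in> sym_group n" "\<sigma> \<in> sym_group n" "perm_mat n \<pi> = perm_mat n \<sigma>"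
  then have "perm_fun n \<pi> = perm_fun n \<sigma>" by (metis mat_fun_perm_mat)
  with * show "\<pi> = \<sigma>" by (meson inj_on_perm_fun inj_onD)
qed

lemma mat_fun_finsum:
  assumes "finite I" "A ` I \<subseteq> carrier_mat n n"
  shows "finsum (real_mats n) (\<lambda>i. c i \<cdot>\<^sub>m A i) I \<in> carrier_mat n n"
    and "mat_fun n (finsum (real_mats n) (\<lambda>i. c i \<cdot>\<^sub>m A i) I) = (\<Sum>i\<in>I. fscale (c i) (mat_fun n (A i)))"
proof -
  interpret V: vectorspace "class_ring :: real ring" "real_mats n" by (rule matrix_vs)
  have "finsum (real_mats n) (\<lambda>i. c i \<cdot>\<^sub>m A i) I \<in> carrier_mat n n \<and>
    mat_fun n (finsum (real_mats n) (\<lambda>i. c i \<cdot>\<^sub>m A i) I) = (\<Sum>i\<in>I. fscale (c i) (mat_fun n (A i)))"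
    using assms
  proof (induction I rule: finite_induct)
    case empty
    show ?case by (auto simp: module_mat_simps mat_fun_def fun_eq_iff)
  next
    case (insert i I)
    define S where "S = finsum (real_mats n) (\<lambda>i. c i \<cdot>\<^sub>m A i) I"
    have S: "S \<in> carrier_mat n n" "mat_fun n S = (\<Sum>i\<in>I. fscale (c i) (mat_fun n (A i)))"
      using insert by (simp_all add: S_def)
    have Ai: "A i \<in> carrier_mat n n" using insert.prems by simp
    have "finsum (real_mats n) (\<lambda>i. c i \<cdot>\<^sub>m A i) (insert i I) = c i \<cdot>\<^sub>m A i + S"
      using insert.hyps insert.prems by (subst V.finsum_insert) (auto simp: module_mat_simps S_def)
    moreover have "mat_fun n (c i \<cdot>\<^sub>m A i + S) = fscale (c i) (mat_fun n (A i)) + mat_fun n S"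
      using S(1) Ai by (auto simp: mat_fun_def fscale_def fun_eq_iff)
    moreover have "c i \<cdot>\<^sub>m A i + S \<in> carrier_mat n n" using S(1) Ai by simp
    ultimately show ?case using S(2) insert.hyps by simp
  qed
  then show "finsum (real_mats n) (\<lambda>i. c i \<cdot>\<^sub>m A i) I \<in> carrier_mat n n"
    and "mat_fun n (finsum (real_mats n) (\<lambda>i. c i \<cdot>\<^sub>m A i) I) = (\<Sum>i\<in>I. fscale (c i) (mat_fun n (A i)))"
    by blast+
qed

lemma lin_dep_family_iff:
  assumes "finite I" "A ` I \<subseteq> carrier_mat n n"
  shows "lin_dep_family n I A \<longleftrightarrow>
    (\<exists>c. (\<exists>i\<in>I. c i \<noteq> 0) \<and> (\<Sum>i\<in>I. fscale (c i) (mat_fun n (A i))) = 0)"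
proof -
  have "finsum (real_mats n) (\<lambda>i. c i \<cdot>\<^sub>m A i) I = 0\<^sub>m n n \<longleftrightarrow>
      (\<Sum>i\<in>I. fscale (c i) (mat_fun n (A i))) = 0" for c
  proof -
    have "finsum (real_mats n) (\<lambda>i. c i \<cdot>\<^sub>m A i) I = 0\<^sub>m n n \<longleftrightarrow>
       mat_fun n (finsum (real_mats n) (\<lambda>i. c i \<cdot>\<^sub>m A i) I) = mat_fun n (0\<^sub>m n n)"
      using mat_fun_finsum(1)[OF assms] inj_on_mat_fun[of n] by (auto dest: inj_onD)
    also have "mat_fun n (0\<^sub>m n n) = 0" by (auto simp: mat_fun_def fun_eq_iff)
    finally show ?thesis unfolding mat_fun_finsum(2)[OF assms] .
  qed
  then show ?thesis by (simp add: lin_dep_family_def)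
qed

lemma lin_dep_set_iff_family:
  assumes "finite S" "S \<subseteq> carrier_mat n n"
  shows "lin_dep_set n S \<longleftrightarrow> lin_dep_family n S (\<lambda>A. A)"
proof -
  interpret V: vectorspace "class_ring :: real ring" "real_mats n" by (rule matrix_vs)
  show ?thesis
  proof
    assume "lin_dep_set n S"
    then obtain a v where "V.lincomb a S = \<zero>\<^bsub>real_mats n\<^esub>" "v \<in> S" "a v \<noteq> \<zero>\<^bsub>class_ring\<^esub>"
      using V.finite_lin_dep[OF assms(1)] assms(2) by (auto simp: lin_dep_set_def module_mat_simps)
    then show "lin_dep_family n S (\<lambda>A. A)"
      unfolding lin_dep_family_def V.lincomb_def by (auto simp: module_mat_simps class_ring_simps)
  next
    assume "lin_dep_family n S (\<lambda>A. A)"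
    then obtain c v where "v \<in> S" "c v \<noteq> 0" "finsum (real_mats n) (\<lambda>A. c A \<cdot>\<^sub>m A) S = 0\<^sub>m n n"
      unfolding lin_dep_family_def by blast
    then show "lin_dep_set n S"
      unfolding lin_dep_set_def
      by (intro V.lin_dep_crit[OF assms(1), of S c v])
         (auto simp: V.lincomb_def module_mat_simps class_ring_simps)
  qed
qed

text \<open>Without repetitions, coefficients on matrices and coefficients on indices correspond
  through \<open>A\<close> and \<open>inv_into I A\<close>.\<close>

lemma lin_dep_set_image:
  assumes "finite I" "inj_on A I" "A ` I \<subseteq> carrier_mat n n"
  shows "lin_dep_set n (A ` I) \<longleftrightarrow> lin_dep_family n I A"
proof -
  have fin: "finite (A ` I)" and sub: "(\<lambda>A. A) ` (A ` I) \<subseteq> carrier_mat n n" using assms by auto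
  have "lin_dep_set n (A ` I) \<longleftrightarrow>
      (\<exists>c. (\<exists>X\<in>A ` I. c X \<noteq> 0) \<and> (\<Sum>X\<in>A ` I. fscale (c X) (mat_fun n X)) = 0)"
    unfolding lin_dep_set_iff_family[OF fin assms(3)] lin_dep_family_iff[OF fin sub] ..
  also have "\<dots> \<longleftrightarrow> (\<exists>c. (\<exists>i\<in>I. c (A i) \<noteq> 0) \<and> (\<Sum>i\<in>I. fscale (c (A i)) (mat_fun n (A i))) = 0)"
    unfolding sum.reindex[OF assms(2)] by simp
  also have "\<dots> \<longleftrightarrow> (\<exists>c. (\<exists>i\<in>I. c i \<noteq> 0) \<and> (\<Sum>i\<in>I. fscale (c i) (mat_fun n (A i))) = 0)"
  proof
    assume "\<exists>c. (\<exists>i\<in>I. c i \<noteq> 0) \<and> (\<Sum>i\<in>I. fscale (c i) (mat_fun n (A i))) = 0"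
    then obtain c where c: "\<exists>i\<in>I. c i \<noteq> 0" "(\<Sum>i\<in>I. fscale (c i) (mat_fun n (A i))) = 0" by blast
    have inv: "inv_into I A (A i) = i" if "i \<in> I" for i using assms(2) that by (rule inv_into_f_f)
    have "(\<Sum>i\<in>I. fscale ((c \<circ> inv_into I A) (A i)) (mat_fun n (A i))) = (\<Sum>i\<in>I. fscale (c i) (mat_fun n (A i)))"
      using inv by (intro sum.cong) auto
    moreover have "\<exists>i\<in>I. (c \<circ> inv_into I A) (A i) \<noteq> 0" using c(1) inv by auto
    ultimately show "\<exists>c. (\<exists>i\<in>I. c (A i) \<noteq> 0) \<and> (\<Sum>i\<in>I. fscale (c (A i)) (mat_fun n (A i))) = 0"
      using c(2) by (intro exI[of _ "c \<circ> inv_into I A"] conjI) simp_all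
  next
    assume "\<exists>c. (\<exists>i\<in>I. c (A i) \<noteq> 0) \<and> (\<Sum>i\<in>I. fscale (c (A i)) (mat_fun n (A i))) = 0"
    then obtain c where "\<exists>i\<in>I. c (A i) \<noteq> 0" "(\<Sum>i\<in>I. fscale (c (A i)) (mat_fun n (A i))) = 0" by blast
    then show "\<exists>c. (\<exists>i\<in>I. c i \<noteq> 0) \<and> (\<Sum>i\<in>I. fscale (c i) (mat_fun n (A i))) = 0"
      by (intro exI[of _ "\<lambda>i. c (A i)"] conjI)
  qed
  also have "\<dots> \<longleftrightarrow> lin_dep_family n I A"
    unfolding lin_dep_family_iff[OF assms(1,3)] ..
  finally show ?thesis .
qed

text \<open>Coefficients 1 and -1 at two indices of the same matrix give a dependence.\<close>

lemma lin_dep_family_not_inj: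
  assumes "finite I" "A ` I \<subseteq> carrier_mat n n" "\<not> inj_on A I"
  shows "lin_dep_family n I A"
proof -
  obtain i j where ij: "i \<in> I" "j \<in> I" "i \<noteq> j" "A i = A j" using assms(3) by (auto simp: inj_on_def)
  define c where "c k = (if k = i then 1 else if k = j then - 1 else 0 :: real)" for k
  have "(\<Sum>k\<in>I. fscale (c k) (mat_fun n (A k))) = (\<Sum>k\<in>{i, j}. fscale (c k) (mat_fun n (A k)))"
    using ij assms(1) by (intro sum.mono_neutral_right) (auto simp: c_def fscale_def fun_eq_iff)
  also have "\<dots> = 0" using ij by (auto simp: c_def fscale_def fun_eq_iff)
  finally have "(\<Sum>k\<in>I. fscale (c k) (mat_fun n (A k))) = 0" .
  moreover have "c i \<noteq> 0" by (simp add: c_def)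
  ultimately show ?thesis
    unfolding lin_dep_family_iff[OF assms(1,2)] using ij(1) by (intro exI[of _ c] conjI bexI[of _ i])
qed

text \<open>The corner matrices are not permutation matrices, so a basis is selected among the
  permutations instead and carried over to matrices; the exchange lemma equates the two sizes. The
  selection also shows that subsets of this size exist.\<close>

lemma perm_dim_eq:
  assumes "n \<ge> 1"
  shows "perm_dim n = (n - 1)\<^sup>2 + 1" and "(n - 1)\<^sup>2 + 1 \<le> fact n"
proof -
  interpret V: vectorspace "class_ring :: real ring" "real_mats n" by (rule matrix_vs)
  obtain G where G: "finite G" "fs.independent G" "card G = (n - 1)\<^sup>2 + 1"
    "G \<subseteq> fs.span (perm_fun n ` sym_group n)" "perm_fun n ` sym_group n \<subseteq> fs.span G"
    using perm_fun_basis_exists[OF assms] .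
  obtain B0 where B0: "B0 \<subseteq> perm_fun n ` sym_group n" "fs.independent B0"
    "perm_fun n ` sym_group n \<subseteq> fs.span B0"
    using fs.maximal_independent_subset .
  have finB0: "finite B0" using B0(1) by (rule finite_subset) simp
  have "B0 \<subseteq> fs.span G" using B0(1) G(5) by blast
  then have "card B0 \<le> card G" using fs.independent_span_bound[OF G(1) B0(2)] by blast
  moreover have "G \<subseteq> fs.span B0" using G(4) fs.span_minimal[OF B0(3) fs.subspace_span] by blast
  then have "card G \<le> card B0" using fs.independent_span_bound[OF finB0 G(2)] by blast
  ultimately have cB0: "card B0 = (n - 1)\<^sup>2 + 1" using G(3) by simp
  define T where "T = {\<pi> \<in> sym_group n. perm_fun n \<pi> \<in> B0}"
  have T: "T \<subseteq> sym_group n" "finite T" "perm_fun n ` T = B0" using B0(1) by (auto simp: T_def)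
  have inj: "inj_on (perm_fun n) T" "inj_on (perm_mat n) T"
    using inj_on_subset[OF inj_on_perm_fun T(1)] inj_on_subset[OF inj_on_perm_mat T(1)] by auto
  have cT: "card T = (n - 1)\<^sup>2 + 1" using cB0 card_image[OF inj(1)] T(3) by simp
  have "card T \<le> card (sym_group n)" using T(1) by (intro card_mono) auto
  then show "(n - 1)\<^sup>2 + 1 \<le> fact n" by (simp add: cT card_sym_group)
  define B where "B = perm_mat n ` T"
  have B: "finite B" "B \<subseteq> perm_mats n" "B \<subseteq> carrier_mat n n" "card B = (n - 1)\<^sup>2 + 1"
    using T cT card_image[OF inj(2)] by (auto simp: B_def perm_mats_def)
  have mf: "mat_fun n (perm_mat n \<pi>) = perm_fun n \<pi>" if "\<pi> \<in> T" for \<pi>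
    using that T(1) by (auto intro: mat_fun_perm_mat)
  have PT: "perm_mat n ` T \<subseteq> carrier_mat n n" by auto
  have indB: "\<not> V.lin_dep B"
  proof
    assume "V.lin_dep B"
    then have "lin_dep_family n T (perm_mat n)"
      using lin_dep_set_image[OF T(2) inj(2) PT] by (simp add: lin_dep_set_def B_def)
    then obtain c \<pi> where c: "\<pi> \<in> T" "c \<pi> \<noteq> 0" "(\<Sum>\<pi>\<in>T. fscale (c \<pi>) (mat_fun n (perm_mat n \<pi>))) = 0"
      unfolding lin_dep_family_iff[OF T(2) PT] by blast
    have "(\<Sum>v\<in>B0. fscale (c (inv_into T (perm_fun n) v)) v) = (\<Sum>\<pi>\<in>T. fscale (c \<pi>) (perm_fun n \<pi>))"
      unfolding T(3)[symmetric] using inv_into_f_f[OF inj(1)] by (subst sum.reindex[OF inj(1)]) simp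
    also have "\<dots> = 0" using c(3) mf by simp
    finally have "(\<Sum>v\<in>B0. fscale (c (inv_into T (perm_fun n) v)) v) = 0" .
    moreover have "perm_fun n \<pi> \<in> B0" "c (inv_into T (perm_fun n) (perm_fun n \<pi>)) \<noteq> 0"
      using c(1,2) T(3) inv_into_f_f[OF inj(1)] by auto
    ultimately have "fs.dependent B0"
      unfolding fs.dependent_finite[OF finB0]
      by (intro exI[of _ "\<lambda>v. c (inv_into T (perm_fun n) v)"] conjI bexI)
    then show False using B0(2) by blast
  qed
  have PC: "perm_mats n \<subseteq> carrier (real_mats n)" by (auto simp: perm_mats_def module_mat_simps)
  have BC: "B \<subseteq> carrier (real_mats n)" using B(2) PC by blast
  have "perm_mats n \<subseteq> V.span B"
  proof
    fix A assume "A \<in> perm_mats n"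
    then obtain \<sigma> where \<sigma>: "\<sigma> \<in> sym_group n" "A = perm_mat n \<sigma>" by (auto simp: perm_mats_def)
    then have "perm_fun n \<sigma> \<in> fs.span B0" using B0(3) by blast
    then obtain u where u: "perm_fun n \<sigma> = (\<Sum>v\<in>B0. fscale (u v) v)"
      using fs.span_finite[OF finB0] by auto
    define c where "c X = u (mat_fun n X)" for X
    have "mat_fun n (finsum (real_mats n) (\<lambda>X. c X \<cdot>\<^sub>m X) B) = (\<Sum>X\<in>B. fscale (c X) (mat_fun n X))"
      using B by (intro mat_fun_finsum) auto
    also have "\<dots> = (\<Sum>\<pi>\<in>T. fscale (u (perm_fun n \<pi>)) (perm_fun n \<pi>))"
      unfolding B_def by (subst sum.reindex[OF inj(2)]) (simp add: c_def mf)
    also have "\<dots> = (\<Sum>v\<in>B0. fscale (u v) v)"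
      unfolding T(3)[symmetric] by (subst sum.reindex[OF inj(1)]) simp
    also have "\<dots> = mat_fun n A" using u \<sigma> by (simp add: mat_fun_perm_mat)
    finally have "mat_fun n (finsum (real_mats n) (\<lambda>X. c X \<cdot>\<^sub>m X) B) = mat_fun n A" .
    moreover have "finsum (real_mats n) (\<lambda>X. c X \<cdot>\<^sub>m X) B \<in> carrier_mat n n"
      using B by (intro mat_fun_finsum) auto
    ultimately have "finsum (real_mats n) (\<lambda>X. c X \<cdot>\<^sub>m X) B = A"
      using inj_on_mat_fun[of n] \<sigma>(2) by (auto dest: inj_onD)
    then have "V.lincomb c B = A" by (simp add: V.lincomb_def module_mat_simps)
    moreover have "c \<in> B \<rightarrow> carrier class_ring" by (simp add: class_ring_simps)
    ultimately show "A \<in> V.span B"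
      unfolding V.span_def using B(1) by (intro CollectI exI[of _ c] exI[of _ B]) simp
  qed
  then have "V.span (perm_mats n) \<subseteq> V.span B"
    by (rule V.span_is_subset[OF _ V.span_is_submodule[OF BC]])
  moreover have "V.span B \<subseteq> V.span (perm_mats n)" by (rule V.span_is_monotone[OF B(2)])
  ultimately have spB: "V.span B = V.span (perm_mats n)" by blast
  have BW: "B \<subseteq> V.span (perm_mats n)" using V.in_own_span[OF BC] spB by blast
  have sub: "submodule class_ring (V.span (perm_mats n)) (real_mats n)" by (rule V.span_is_submodule[OF PC])
  interpret W: vectorspace class_ring "(real_mats n)\<lparr>carrier := V.span (perm_mats n)\<rparr>"
    by (rule V.subspace_is_vs[OF V.span_is_subspace[OF PC]])
  have "W.basis B"
    unfolding W.basis_def using V.span_li_not_depend[OF BW sub] indB spB BW by simp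
  then have "W.dim = card B" by (rule W.dim_basis[OF B(1)])
  then show "perm_dim n = (n - 1)\<^sup>2 + 1" by (simp add: perm_dim_def B(4))
qed

text \<open>The largest index with a nonzero coefficient is the one whose permutation lies in the
  span of its predecessors.\<close>

lemma lin_dep_family_perm_mat:
  fixes d :: nat
  assumes "lin_dep_family n {..<d} (\<lambda>k. perm_mat n (f k))" and f: "\<And>k. k < d \<Longrightarrow> f k \<in> sym_group n"
  shows "\<exists>k<d. perm_fun n (f k) \<in> fs.span (perm_fun n ` f ` {..<k})"
proof -
  have "(\<lambda>k. perm_mat n (f k)) ` {..<d} \<subseteq> carrier_mat n n" by auto
  from assms(1)[unfolded lin_dep_family_iff[OF finite_lessThan this]]
  obtain c where c: "\<exists>i\<in>{..<d}. c i \<noteq> 0" "(\<Sum>i<d. fscale (c i) (mat_fun n (perm_mat n (f i)))) = 0"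
    by blast
  have c2: "(\<Sum>i<d. fscale (c i) (perm_fun n (f i))) = 0"
    using c(2) f by (simp add: mat_fun_perm_mat)
  define k where "k = Max {i. i < d \<and> c i \<noteq> 0}"
  have "k \<in> {i. i < d \<and> c i \<noteq> 0}" unfolding k_def using c(1) by (intro Max_in) auto
  then have k: "k < d" "c k \<noteq> 0" by auto
  have c0: "c i = 0" if "k < i" "i < d" for i
  proof (rule ccontr)
    assume "c i \<noteq> 0"
    then have "i \<le> k" unfolding k_def using that(2) by (intro Max_ge) auto
    then show False using that(1) by simp
  qed
  have "(\<Sum>i<d. fscale (c i) (perm_fun n (f i))) = (\<Sum>i\<in>insert k {..<k}. fscale (c i) (perm_fun n (f i)))"
  proof (intro sum.mono_neutral_right ballI)
    fix i assume "i \<in> {..<d} - insert k {..<k}"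
    then have "k < i" "i < d" by auto
    then show "fscale (c i) (perm_fun n (f i)) = 0" using c0 by simp
  qed (use k(1) in auto)
  then have "fscale (c k) (perm_fun n (f k)) = - (\<Sum>i<k. fscale (c i) (perm_fun n (f i)))"
    using c2 by (simp add: eq_neg_iff_add_eq_0)
  also have "\<dots> \<in> fs.span (perm_fun n ` f ` {..<k})"
    by (intro fs.span_neg fs.span_sum fs.span_scale fs.span_base) auto
  finally have "fscale (1 / c k) (fscale (c k) (perm_fun n (f k))) \<in> fs.span (perm_fun n ` f ` {..<k})"
    by (rule fs.span_scale)
  then show ?thesis using k by auto
qed

text \<open>An independent tuple is injective, and each independent set arises from at most d!
  tuples. With N = n!, a tuple is thus independent with probability at most |\<Omega>'| d! / N^d
  \<le> |\<Omega>'| / |\<Omega>|, since (N choose d) d! \<le> N^d.\<close>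

lemma prob_subset_le:
  assumes "d \<le> fact n"
  shows "1 - measure_pmf.prob (random_perm_mat_subset n d) {S. \<not> lin_dep_set n S}
    \<le> measure_pmf.prob (random_perms n d) {\<pi>. lin_dep_family n {..<d} (\<lambda>k. perm_mat n (\<pi> k))}"
proof -
  let ?dep = "\<lambda>f. lin_dep_family n {..<d} (\<lambda>k. perm_mat n (f k))"
  define \<Omega> where "\<Omega> = {S. S \<subseteq> perm_mats n \<and> card S = d}"
  define \<Phi> where "\<Phi> = PiE_dflt {..<d} id (\<lambda>_. sym_group n)"
  define \<Omega>' where "\<Omega>' = {S \<in> \<Omega>. \<not> lin_dep_set n S}"
  define \<Phi>' where "\<Phi>' = {f \<in> \<Phi>. \<not> ?dep f}"
  have card_perm_mats: "finite (perm_mats n)" "card (perm_mats n) = fact n"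
    by (simp_all add: perm_mats_def card_image[OF inj_on_perm_mat] card_sym_group)
  have fin\<Omega>: "finite \<Omega>" unfolding \<Omega>_def by (rule finite_subset[of _ "Pow (perm_mats n)"]) (use card_perm_mats in auto)
  have card\<Omega>: "card \<Omega> = fact n choose d" unfolding \<Omega>_def using n_subsets[OF card_perm_mats(1)] card_perm_mats(2) by simp
  have \<Omega>0: "0 < card \<Omega>" unfolding card\<Omega> using assms by (simp add: zero_less_binomial_iff)
  have fin\<Phi>: "finite \<Phi>" unfolding \<Phi>_def by (rule finite_PiE_dflt) auto
  have card\<Phi>: "card \<Phi> = fact n ^ d" unfolding \<Phi>_def by (subst card_PiE_dflt) (auto simp: card_sym_group)
  have \<Phi>sym: "f k \<in> sym_group n" if "f \<in> \<Phi>" "k < d" for f k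
    using that by (auto simp: \<Phi>_def PiE_dflt_def)
  have inj: "inj_on (\<lambda>k. perm_mat n (f k)) {..<d}" if "f \<in> \<Phi>'" for f
    using that lin_dep_family_not_inj[of "{..<d}" "\<lambda>k. perm_mat n (f k)" n]
    by (auto simp: \<Phi>'_def image_subset_iff)
  define img where "img f = (\<lambda>k. perm_mat n (f k)) ` {..<d}" for f
  have img: "img f \<in> \<Omega>'" if "f \<in> \<Phi>'" for f
  proof -
    have "f \<in> \<Phi>" "\<not> ?dep f" using that by (simp_all add: \<Phi>'_def)
    moreover have "(\<lambda>k. perm_mat n (f k)) ` {..<d} \<subseteq> carrier_mat n n" by auto
    moreover have "img f \<subseteq> perm_mats n" using \<Phi>sym[OF \<open>f \<in> \<Phi>\<close>] by (auto simp: img_def perm_mats_def)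
    moreover have "card (img f) = d" unfolding img_def card_image[OF inj[OF that]] by simp
    ultimately show ?thesis
      using lin_dep_set_image[OF finite_lessThan inj[OF that]] by (simp add: \<Omega>'_def \<Omega>_def img_def)
  qed
  have fin\<Phi>': "finite \<Phi>'" "finite \<Omega>'" using fin\<Phi> fin\<Omega> by (auto simp: \<Phi>'_def \<Omega>'_def)
  have fiber: "card {f \<in> \<Phi>'. img f = S} \<le> fact d" if S: "S \<in> \<Omega>'" for S
  proof -
    define T where "T = {\<pi> \<in> sym_group n. perm_mat n \<pi> \<in> S}"
    have T: "finite T" "perm_mat n ` T = S"
      using S by (auto simp: T_def \<Omega>'_def \<Omega>_def perm_mats_def)
    have "inj_on (perm_mat n) T" by (rule inj_on_subset[OF inj_on_perm_mat]) (auto simp: T_def)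
    then have cT: "card T = d" using T(2) S card_image[of "perm_mat n" T] by (auto simp: \<Omega>'_def \<Omega>_def)
    have inj_res: "inj_on (\<lambda>f. restrict f {..<d}) {f \<in> \<Phi>'. img f = S}"
    proof (rule inj_onI)
      fix f g assume *: "f \<in> {f \<in> \<Phi>'. img f = S}" "g \<in> {f \<in> \<Phi>'. img f = S}" "restrict f {..<d} = restrict g {..<d}"
      show "f = g"
      proof
        fix k
        show "f k = g k"
        proof (cases "k < d")
          case True then show ?thesis using fun_cong[OF *(3), of k] by simp
        next
          \<comment> \<open>Off the index set both tuples take the default value
            \<open>id\<close>.\<close>
          case False then show ?thesis using * by (auto simp: \<Phi>'_def \<Phi>_def PiE_dflt_def)
        qed
      qed
    qed
    have "(\<lambda>f. restrict f {..<d}) ` {f \<in> \<Phi>'. img f = S} \<subseteq> bijs {..<d} T"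
    proof clarify
      fix f assume f: "f \<in> \<Phi>'" "S = img f"
      have fT: "f ` {..<d} \<subseteq> T" using f \<Phi>sym by (auto simp: T_def img_def \<Phi>'_def)
      have injf: "inj_on f {..<d}" using inj[OF f(1)] by (auto simp: inj_on_def)
      then have "card (f ` {..<d}) = card T" using cT by (simp add: card_image)
      then have "f ` {..<d} = T" using fT T(1) by (simp add: card_subset_eq)
      then have "bij_betw (restrict f {..<d}) {..<d} T" using injf by (simp add: bij_betw_def inj_on_restrict_eq)
      then show "restrict f {..<d} \<in> bijs {..<d} T" using fT by (auto simp: bijs_def)
    qed
    then have "card {f \<in> \<Phi>'. img f = S} \<le> card (bijs {..<d} T)"
      using T(1) by (intro card_inj_on_le[OF inj_res]) auto
    also have "\<dots> = fact d" using T(1) cT by (subst card_bijs) auto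
    finally show ?thesis .
  qed
  have "\<Phi>' = (\<Union>S\<in>\<Omega>'. {f \<in> \<Phi>'. img f = S})" using img by blast
  then have "card \<Phi>' = card (\<Union>S\<in>\<Omega>'. {f \<in> \<Phi>'. img f = S})" by (rule arg_cong)
  also have "\<dots> \<le> (\<Sum>S\<in>\<Omega>'. card {f \<in> \<Phi>'. img f = S})"
    by (rule card_UN_le[OF fin\<Phi>'(2)])
  also have "\<dots> \<le> card \<Omega>' * fact d" using fiber sum_bounded_above[of \<Omega>' "\<lambda>S. card {f \<in> \<Phi>'. img f = S}" "fact d"] by simp
  finally have le: "real (card \<Phi>') \<le> real (card \<Omega>') * fact d"
    unfolding of_nat_le_iff[symmetric, where 'a = real] by simp
  have pow: "real (card \<Omega>) * fact d \<le> real (card \<Phi>)"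
    using binomial_fact_pow[of "fact n" d] unfolding card\<Omega> card\<Phi> of_nat_le_iff[symmetric, where 'a = real] by simp
  have "real (card \<Phi>') / card \<Phi> \<le> real (card \<Omega>') * fact d / card \<Phi>"
    using le by (rule divide_right_mono) simp
  also have "\<dots> \<le> real (card \<Omega>') * fact d / (card \<Omega> * fact d)"
    using pow \<Omega>0 card\<Phi> by (intro divide_left_mono) auto
  also have "\<dots> = card \<Omega>' / card \<Omega>" by simp
  finally have main: "real (card \<Phi>') / card \<Phi> \<le> card \<Omega>' / card \<Omega>" .
  have "measure_pmf.prob (random_perm_mat_subset n d) {S. \<not> lin_dep_set n S} = card \<Omega>' / card \<Omega>"
    using fin\<Omega> \<Omega>0 unfolding random_perm_mat_subset_def \<Omega>_def[symmetric] \<Omega>'_def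
    by (subst measure_pmf_of_set) (auto simp: Int_def)
  moreover have "measure_pmf.prob (random_perms n d) {f. ?dep f} = 1 - card \<Phi>' / card \<Phi>"
  proof -
    have eq: "random_perms n d = pmf_of_set \<Phi>"
      unfolding random_perms_def \<Phi>_def by (rule Pi_pmf_of_set) auto
    have "0 < card \<Phi>" by (simp add: card\<Phi>)
    then have "measure_pmf.prob (random_perms n d) {f. \<not> ?dep f} = card \<Phi>' / card \<Phi>"
      unfolding eq using fin\<Phi> by (subst measure_pmf_of_set) (auto simp: \<Phi>'_def Int_def)
    then show ?thesis
      using measure_pmf.prob_compl[of "{f. ?dep f}" "random_perms n d"]
      by (simp add: set_diff_eq)
  qed
  ultimately show ?thesis using main by simp
qed

theorem theorem1p1:
  shows "(\<forall>n\<ge>1. perm_dim n = (n - 1)\<^sup>2 + 1)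
    \<and> (\<lambda>n. measure_pmf.prob (random_perms n (perm_dim n))
          {\<pi>. lin_dep_family n {..<perm_dim n} (\<lambda>k. perm_mat n (\<pi> k))})
        \<in> O(\<lambda>n. real n powr (-1/2))
    \<and> (\<lambda>n. 1 - measure_pmf.prob (random_perm_mat_subset n (perm_dim n))
          {S. \<not> lin_dep_set n S})
        \<in> O(\<lambda>n. real n powr (-1/2))"
proof -
  let ?p = "\<lambda>n. measure_pmf.prob (random_perms n (perm_dim n))
          {\<pi>. lin_dep_family n {..<perm_dim n} (\<lambda>k. perm_mat n (\<pi> k))}"
  let ?q = "\<lambda>n. 1 - measure_pmf.prob (random_perm_mat_subset n (perm_dim n)) {S. \<not> lin_dep_set n S}"
  obtain K where K: "\<forall>\<^sub>F n in sequentially. \<forall>d0. measure_pmf.prob (Pi_pmf {..<(n - 1)\<^sup>2 + 1} d0 (\<lambda>_. pmf_of_set (sym_group n)))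
      {f. \<exists>k<(n - 1)\<^sup>2 + 1. perm_fun n (f k) \<in> fs.span (perm_fun n ` f ` {..<k})} \<le> K / sqrt (real n)"
    using prob_dependent by blast
  have bound: "\<forall>\<^sub>F n in sequentially. ?p n \<le> K * real n powr (-1/2)"
    using K eventually_ge_at_top[of 1]
  proof eventually_elim
    case (elim n)
    define d where "d = (n - 1)\<^sup>2 + 1"
    have d: "perm_dim n = d" using perm_dim_eq(1)[OF elim(2)] by (simp add: d_def)
    let ?P = "Pi_pmf {..<d} id (\<lambda>_. pmf_of_set (sym_group n))"
    have "AE f in ?P. lin_dep_family n {..<d} (\<lambda>k. perm_mat n (f k)) \<longrightarrow>
        (\<exists>k<d. perm_fun n (f k) \<in> fs.span (perm_fun n ` f ` {..<k}))"
    proof (rule AE_pmfI, rule impI)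
      fix f assume f: "f \<in> set_pmf ?P" "lin_dep_family n {..<d} (\<lambda>k. perm_mat n (f k))"
      have "f i \<in> sym_group n" if "i < d" for i
        using f(1) that by (auto simp: set_Pi_pmf PiE_dflt_def set_pmf_of_set)
      then show "\<exists>k<d. perm_fun n (f k) \<in> fs.span (perm_fun n ` f ` {..<k})"
        using lin_dep_family_perm_mat[OF f(2)] by blast
    qed
    then have "?p n \<le> measure_pmf.prob ?P {f. \<exists>k<d. perm_fun n (f k) \<in> fs.span (perm_fun n ` f ` {..<k})}"
      unfolding d random_perms_def
      by (intro measure_pmf.finite_measure_mono_AE) (auto elim!: eventually_mono)
    also have "\<dots> \<le> K / sqrt (real n)" using elim(1) by (simp only: d_def)
    also have "\<dots> = K * real n powr (-1/2)"
      using elim(2) powr_minus_divide[of "real n" "1 / 2"] by (simp add: powr_half_sqrt)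
    finally show ?case .
  qed
  have bound2: "\<forall>\<^sub>F n in sequentially. ?q n \<le> K * real n powr (-1/2)"
    using bound eventually_ge_at_top[of 1]
  proof eventually_elim
    case (elim n)
    have "?q n \<le> ?p n" using perm_dim_eq[OF elim(2)] by (intro prob_subset_le) simp
    then show ?case using elim(1) by linarith
  qed
  have "?p \<in> O(\<lambda>n. real n powr (-1/2))"
    using bound by (intro bigoI[of _ K]) (auto elim!: eventually_mono)
  moreover have "?q \<in> O(\<lambda>n. real n powr (-1/2))"
    using bound2 by (intro bigoI[of _ K]) (auto elim!: eventually_mono)
  ultimately show ?thesis using perm_dim_eq(1) by blast
qed

end
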